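(* Assume $(S^2-1)\alpha\in\ell^3$ and $\alpha\in\ell^6$. Then $$\int_0^{2\pi}(1-\cos\theta)^2(1+\cos\theta)\log w(\theta)\frac{d\theta}{2\pi}>-\infty\iff (S-1)\alpha\in\ell^4\ \text{ and }\ (S-1)^2(S+1)\alpha\in\ell^2.$$
   Context: $\mu$ is a probability measure with infinite support on the unit circle (identified with $[0,2\pi]$ via $e^{i\theta}\mapsto\theta$), with Lebesgue decomposition $d\mu(\theta)=w(\theta)\frac{d\theta}{2\pi}+d\mu_s(\theta)$. $\Phi_n$ are its monic orthogonal polynomials, and its sequence of Verblunsky coefficients is $\alpha=(\alpha_n)_{n\ge0}$, $\alpha_n=-\overline{\Phi_{n+1}(0)}\in\mathbb{D}$. $S$ is the left shift on sequences, $(S\alpha)_n=\alpha_{n+1}$. The integral is well defined in $[-\infty,\infty)$. *)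

theory Defs
  imports "HOL-Probability.Probability" "HOL-Computational_Algebra.Polynomial"
begin

text \<open>Measures on the unit circle are Borel measures on the complex plane that are concentrated
  on \<open>sphere 0 1\<close>; the parametrisation \<open>\<theta> \<mapsto> e\<^sup>i\<^sup>\<theta>\<close> is \<^const>\<open>cis\<close>.\<close>

definition measure_support :: "'a::topological_space measure \<Rightarrow> 'a set" where
  "measure_support M = {x. \<forall>U. open U \<longrightarrow> x \<in> U \<longrightarrow> emeasure M U > 0}"

definition nontrivial_circle_prob :: "complex measure \<Rightarrow> bool" where
  "nontrivial_circle_prob \<mu> \<longleftrightarrow>
     prob_space \<mu> \<and> sets \<mu> = sets borel \<and> (AE z in \<mu>. z \<in> sphere 0 1) \<and>
     infinite (measure_support \<mu>)"

text \<open>The measure \<open>d\<theta>/2\<pi>\<close> on \<open>[0,2\<pi>]\<close>.\<close>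

definition normalized_angle :: "real measure" where
  "normalized_angle = uniform_measure lborel {0..2 * pi}"

text \<open>\<open>d\<mu> = w d\<theta>/2\<pi> + d\<mu>\<^sub>s\<close> with \<open>\<mu>\<^sub>s\<close> singular; the absolutely continuous part and the
  arc-length measure are transported to the circle by \<^const>\<open>cis\<close>.\<close>

definition circle_lebesgue_decomposition ::
  "complex measure \<Rightarrow> (real \<Rightarrow> real) \<Rightarrow> complex measure \<Rightarrow> bool" where
  "circle_lebesgue_decomposition \<mu> w \<mu>\<^sub>s \<longleftrightarrow>
     w \<in> borel_measurable borel \<and> (\<forall>\<theta>. 0 \<le> w \<theta>) \<and> sets \<mu>\<^sub>s = sets borel \<and>
     (\<forall>A\<in>sets borel. emeasure \<mu> A =
        emeasure (distr (density normalized_angle (\<lambda>\<theta>. ennreal (w \<theta>))) borel cis) A + emeasure \<mu>\<^sub>s A) \<and>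
     (\<exists>N\<in>sets borel. emeasure (distr normalized_angle borel cis) N = 0 \<and> emeasure \<mu>\<^sub>s (- N) = 0)"

definition monic_orthogonal_polys :: "complex measure \<Rightarrow> (nat \<Rightarrow> complex poly) \<Rightarrow> bool" where
  "monic_orthogonal_polys \<mu> \<Phi> \<longleftrightarrow>
     (\<forall>n. degree (\<Phi> n) = n \<and> lead_coeff (\<Phi> n) = 1 \<and>
          (\<forall>k<n. (\<integral>z. cnj (z ^ k) * poly (\<Phi> n) z \<partial>\<mu>) = 0))"

definition verblunsky :: "(nat \<Rightarrow> complex poly) \<Rightarrow> nat \<Rightarrow> complex" where
  "verblunsky \<Phi> n = - cnj (poly (\<Phi> (Suc n)) 0)"

definition shift :: "(nat \<Rightarrow> 'a) \<Rightarrow> nat \<Rightarrow> 'a" where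
  "shift a n = a (Suc n)"

text \<open>The operators \<open>S - 1\<close>, \<open>S + 1\<close> and \<open>S\<^sup>2 - 1\<close>.\<close>

definition S_minus_1 :: "(nat \<Rightarrow> complex) \<Rightarrow> nat \<Rightarrow> complex" where
  "S_minus_1 a n = shift a n - a n"

definition S_plus_1 :: "(nat \<Rightarrow> complex) \<Rightarrow> nat \<Rightarrow> complex" where
  "S_plus_1 a n = shift a n + a n"

definition S2_minus_1 :: "(nat \<Rightarrow> complex) \<Rightarrow> nat \<Rightarrow> complex" where
  "S2_minus_1 a n = shift (shift a) n - a n"

definition ell :: "nat \<Rightarrow> (nat \<Rightarrow> complex) set" where
  "ell p = {a. summable (\<lambda>n. norm (a n) ^ p)}"

text \<open>Logarithm on \<open>[0,\<infinity>)\<close> with \<open>log 0 = -\<infinity>\<close>; for \<^const>\<open>ln\<close> itself \<open>ln 0 = 0\<close>.\<close>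

definition ext_log :: "real \<Rightarrow> ereal" where
  "ext_log x = (if x = 0 then -\<infinity> else ereal (ln x))"

text \<open>Integral of an extended-real function as \<open>\<integral>f\<^sup>+ - \<integral>f\<^sup>-\<close> (\<^const>\<open>e2ennreal\<close> sends negative
  values to 0); meaningful whenever one of the two parts is finite.\<close>

definition ext_integral :: "'a measure \<Rightarrow> ('a \<Rightarrow> ereal) \<Rightarrow> ereal" where
  "ext_integral M f =
     enn2ereal (\<integral>\<^sup>+ x. e2ennreal (f x) \<partial>M) - enn2ereal (\<integral>\<^sup>+ x. e2ennreal (- f x) \<partial>M)"

end

theory Submission
  imports Defs "HOL-Complex_Analysis.Complex_Analysis"
begin

text \<open>Truncating the Verblunsky coefficients after \<open>n\<close> terms gives the Bernstein--Szego measure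
  \<open>\<mu>\<^sub>n = c\<^sub>n |\<Phi>\<^sub>n|\<^sup>-\<^sup>2 d\<theta>/2\<pi>\<close>, which has the same moments as \<open>\<mu>\<close> up to order \<open>n\<close>. Write
  \<open>Z\<^sub>n\<close> for the integral of the theorem with \<open>\<mu>\<^sub>n\<close> in place of \<open>\<mu>\<close>. The elementary inequality \<open>log t \<le> t\<close>
  shows in both directions that the integral for \<open>\<mu>\<close> is finite iff \<open>Z\<^sub>n\<close> is bounded below: applied to
  \<open>t = w |\<Phi>\<^sub>n|\<^sup>2 / c\<^sub>n\<close> it bounds \<open>Z\<^sub>n\<close> from below, and applied to \<open>t = f c\<^sub>n |\<Phi>\<^sub>n|\<^sup>-\<^sup>2\<close> it gives, as \<open>n \<rightarrow> \<infinity>\<close>,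
  a variational inequality that is tested with \<open>f \<approx> 1/w\<close> off the singular part.

  The weight is a trigonometric polynomial of degree 3 and \<open>log \<Phi>\<^sub>n\<^sup>*\<close> is analytic in the closed disc,
  so \<open>Z\<^sub>n\<close> is an explicit sum of terms, each depending on four consecutive coefficients. Its quadratic part is
  \<open>-\<parallel>(S-1)\<^sup>2(S+1)\<alpha>\<parallel>\<^sup>2/8\<close> and its quartic part is \<open>-\<parallel>(S-1)\<alpha>\<parallel>\<^sub>4\<^sup>4/8\<close>, up to telescoping terms, terms
  of order six in \<open>\<alpha>\<close>, and terms quadratic in \<open>(S\<^sup>2-1)\<alpha>\<close> and in \<open>\<alpha>\<close>. The reflection symmetry
  of the quartic part is what removes the errors linear in \<open>(S\<^sup>2-1)\<alpha>\<close>, which the hypotheses do not control.\<close>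

subsection \<open>Estimates for the sum of the Szego terms\<close>

text \<open>On the circle the weight equals \<open>|(z - 1)^2 (z + 1)|^2 / 8\<close>; this is the
  origin of the operator \<open>(S-1)^2 (S+1)\<close> and of the factor 1/8. Put
  \<open>b_n = \<Phi>_n / \<Phi>_n^*\<close>. One more coefficient changes
  \<open>log \<Phi>_n^*\<close> by \<open>log (1 - z \<alpha>_n b_n)\<close>. A weight of degree 3
  sees its Taylor coefficients up to order 3, hence those of \<open>b_n\<close> up to order 2, and
  these involve only the three preceding Verblunsky coefficients. The exponents 3 and 6 come from
  one Hoelder count. With \<open>d = (S^2-1) \<alpha>\<close>, a product of two factors
  \<open>d\<close> and two factors \<open>\<alpha>\<close> is summable because 1/3 + 1/3 + 1/6 + 1/6
  = 1, and so is a product of six factors \<open>\<alpha>\<close>. One factor \<open>d\<close> with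
  three factors \<open>\<alpha>\<close> reaches only 5/6, so the quartic part has to be arranged
  with errors of second order in \<open>d\<close>. On the measure side the obstacle is that weak
  convergence does not control \<open>log w\<close>. The variational inequality avoids this:
  \<open>n\<close> enters only through an integral that is linear in the measure, and the entropies
  enter only through their common lower bound.\<close>

definition bounded_partial_sums :: "(nat \<Rightarrow> real) \<Rightarrow> bool" where
  "bounded_partial_sums f \<longleftrightarrow> (\<exists>C. \<forall>n. \<bar>\<Sum>j<n. f j\<bar> \<le> C)"

lemma bounded_partial_sums_add:
  assumes "bounded_partial_sums f" "bounded_partial_sums g"
  shows "bounded_partial_sums (\<lambda>j. f j + g j)"
proof -
  obtain C D where "\<And>n. \<bar>\<Sum>j<n. f j\<bar> \<le> C" "\<And>n. \<bar>\<Sum>j<n. g j\<bar> \<le> D"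
    using assms unfolding bounded_partial_sums_def by blast
  then have "\<bar>\<Sum>j<n. f j + g j\<bar> \<le> C + D" for n
    unfolding sum.distrib by (meson abs_triangle_ineq add_mono order_trans)
  then show ?thesis unfolding bounded_partial_sums_def by blast
qed

lemma bounded_partial_sums_cmult:
  assumes "bounded_partial_sums f"
  shows "bounded_partial_sums (\<lambda>j. c * f j)"
proof -
  obtain C where "\<And>n. \<bar>\<Sum>j<n. f j\<bar> \<le> C"
    using assms unfolding bounded_partial_sums_def by blast
  then have "\<bar>\<Sum>j<n. c * f j\<bar> \<le> \<bar>c\<bar> * C" for n
    unfolding sum_distrib_left[symmetric] abs_mult by (simp add: mult_left_mono)
  then show ?thesis unfolding bounded_partial_sums_def by blast
qed

lemma bounded_partial_sums_diff:
  assumes "bounded_partial_sums f" "bounded_partial_sums g"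
  shows "bounded_partial_sums (\<lambda>j. f j - g j)"
  using bounded_partial_sums_add[OF assms(1) bounded_partial_sums_cmult[OF assms(2), of "-1"]] by simp

text \<open>Telescoping sums of a bounded sequence are bounded but need not converge, which is why
  boundedness of partial sums, and not summability, is the notion of a negligible error. A shift by
  \<open>k\<close> splits into \<open>k\<close> unit shifts, each with partial sums of size at most
  \<open>2 * C\<close>.\<close>

lemma bounded_partial_sums_shift:
  assumes "\<And>j. \<bar>g j\<bar> \<le> C"
  shows "bounded_partial_sums (\<lambda>j. g (j + k) - g j)"
proof (induction k)
  case 0
  show ?case unfolding bounded_partial_sums_def by auto
next
  case (Suc k)
  have "\<bar>\<Sum>j<n. g (Suc j + k) - g (j + k)\<bar> \<le> 2 * C" for n
    using sum_lessThan_telescope[of "\<lambda>j. g (j + k)" n] assms[of "n + k"] assms[of k] by simp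
  then have "bounded_partial_sums (\<lambda>j. g (Suc j + k) - g (j + k))"
    unfolding bounded_partial_sums_def by blast
  from bounded_partial_sums_add[OF this Suc] show ?case by simp
qed

lemma bounded_partial_sums_comparison:
  fixes f g :: "nat \<Rightarrow> real"
  assumes "\<And>j. \<bar>f j\<bar> \<le> g j" "summable g"
  shows "bounded_partial_sums f"
proof -
  have "\<bar>\<Sum>j<n. f j\<bar> \<le> suminf g" for n
  proof -
    have "\<bar>\<Sum>j<n. f j\<bar> \<le> (\<Sum>j<n. g j)"
      by (rule order_trans[OF sum_abs]) (intro sum_mono assms)
    also have "\<dots> \<le> suminf g"
      by (rule sum_le_suminf[OF assms(2)]) (use assms(1) in \<open>auto intro: order_trans[OF abs_ge_zero]\<close>)
    finally show ?thesis .
  qed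
  then show ?thesis unfolding bounded_partial_sums_def by blast
qed

text \<open>Both signs follow from monotonicity, with derivatives
  \<open>y^2 (2 - 3y) / (1 - y)\<close> and \<open>y^2 / (1 - y)\<close>. The bound 1/2 on
  \<open>x\<close> keeps \<open>2 - 3y\<close> positive.\<close>

lemma abs_ln_one_minus_cubic:
  fixes x :: real
  assumes "0 \<le> x" "x \<le> 1 / 2"
  shows "\<bar>ln (1 - x) + x + x\<^sup>2 / 2\<bar> \<le> x ^ 3"
proof -
  have "(\<lambda>y. y ^ 3 + y + y\<^sup>2 / 2 + ln (1 - y)) 0 \<le> (\<lambda>y. y ^ 3 + y + y\<^sup>2 / 2 + ln (1 - y)) x"
  proof (rule DERIV_nonneg_imp_nondecreasing[OF assms(1)])
    fix y :: real assume y: "0 \<le> y" "y \<le> x"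
    then have y1: "y < 1" using assms by simp
    have "((\<lambda>y. y ^ 3 + y + y\<^sup>2 / 2 + ln (1 - y)) has_real_derivative 3 * y\<^sup>2 + 1 + y - 1 / (1 - y)) (at y)"
      using y1 by (auto intro!: derivative_eq_intros simp: field_simps)
    moreover have "3 * y\<^sup>2 + 1 + y - 1 / (1 - y) = y\<^sup>2 * (2 - 3 * y) / (1 - y)"
      using y1 by (simp add: field_simps power2_eq_square)
    moreover have "y\<^sup>2 * (2 - 3 * y) / (1 - y) \<ge> 0"
      using y y1 assms(2) by (intro divide_nonneg_nonneg mult_nonneg_nonneg zero_le_power2) linarith+
    ultimately show "\<exists>z. ((\<lambda>y. y ^ 3 + y + y\<^sup>2 / 2 + ln (1 - y)) has_real_derivative z) (at y) \<and> 0 \<le> z"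
      by auto
  qed
  moreover have "(\<lambda>y. - ln (1 - y) - y - y\<^sup>2 / 2) 0 \<le> (\<lambda>y. - ln (1 - y) - y - y\<^sup>2 / 2) x"
  proof (rule DERIV_nonneg_imp_nondecreasing[OF assms(1)])
    fix y :: real assume y: "0 \<le> y" "y \<le> x"
    then have y1: "y < 1" using assms by simp
    have "((\<lambda>y. - ln (1 - y) - y - y\<^sup>2 / 2) has_real_derivative 1 / (1 - y) - 1 - y) (at y)"
      using y1 by (auto intro!: derivative_eq_intros simp: field_simps)
    moreover have "1 / (1 - y) - 1 - y = y\<^sup>2 / (1 - y)"
      using y1 by (simp add: field_simps power2_eq_square)
    moreover have "y\<^sup>2 / (1 - y) \<ge> 0" using y1 by simp
    ultimately show "\<exists>z. ((\<lambda>y. - ln (1 - y) - y - y\<^sup>2 / 2) has_real_derivative z) (at y) \<and> 0 \<le> z"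
      by auto
  qed
  moreover have "0 \<le> x ^ 3" using assms by simp
  ultimately show ?thesis by (simp add: abs_if)
qed

text \<open>This is the Hoelder count 1/3 + 1/3 + 1/6 + 1/6 = 1 in pointwise form. Replacing each
  pair by its maximum leaves \<open>U^2 X^2\<close>, which is at most \<open>U^3\<close> or
  \<open>X^6\<close> according to whether \<open>X^2\<close> or \<open>U\<close> is larger.\<close>

lemma four_term_young:
  fixes u v x y :: real
  assumes "0 \<le> u" "0 \<le> v" "0 \<le> x" "0 \<le> y"
  shows "u * v * x * y \<le> u ^ 3 + v ^ 3 + x ^ 6 + y ^ 6"
proof -
  define U X where "U = max u v" and "X = max x y"
  have UX: "0 \<le> U" "0 \<le> X" using assms by (auto simp: U_def X_def)
  have "u * v \<le> U * U" "x * y \<le> X * X"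
    using assms by (auto simp: U_def X_def intro!: mult_mono)
  then have "(u * v) * (x * y) \<le> (U * U) * (X * X)"
    by (rule mult_mono) (use assms UX in auto)
  also have "\<dots> \<le> U ^ 3 + X ^ 6"
  proof (cases "X * X \<le> U")
    case True
    then have "(U * U) * (X * X) \<le> (U * U) * U" using UX by (intro mult_left_mono) auto
    then show ?thesis using UX by (simp add: power3_eq_cube add_increasing2)
  next
    case False
    then have "(U * U) * (X * X) \<le> ((X * X) * (X * X)) * (X * X)"
      using UX by (intro mult_right_mono mult_mono) auto
    then show ?thesis using UX by (simp add: numeral_eq_Suc mult.assoc add_increasing)
  qed
  also have "\<dots> \<le> (u ^ 3 + v ^ 3) + (x ^ 6 + y ^ 6)"
    using assms by (intro add_mono) (auto simp: U_def X_def max_def)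
  finally show ?thesis by (simp add: mult.assoc)
qed

text \<open>The contribution of \<open>\<alpha>\<^sub>j\<^sub>+\<^sub>3\<close> to the entropy: half of \<open>log (1 - |\<alpha>|\<^sup>2)\<close> minus the real part
  of the combination \<open>-c\<^sub>1/4 - c\<^sub>2/2 + c\<^sub>3/4\<close> of the Taylor coefficients of
  \<open>log (1 - z \<alpha>\<^sub>j\<^sub>+\<^sub>3 \<Phi>\<^sub>j\<^sub>+\<^sub>3 / \<Phi>\<^sub>j\<^sub>+\<^sub>3\<^sup>*)\<close>; the first three coefficients only add a constant.\<close>

definition szego_term :: "(nat \<Rightarrow> complex) \<Rightarrow> nat \<Rightarrow> real" where
  "szego_term a j =
    (let x0 = a j; x1 = a (j + 1); x2 = a (j + 2); x3 = a (j + 3);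
         r1 = of_real (1 - (cmod x1)\<^sup>2); r2 = of_real (1 - (cmod x2)\<^sup>2)
     in ln (1 - (cmod x3)\<^sup>2) / 2 + Re (x3 * cnj x2) / 4
        + Re (r2 * x3 * cnj x1 - x3\<^sup>2 * (cnj x2)\<^sup>2 / 2) / 2
        - Re (r2 * r1 * x3 * cnj x0 - r2 * x3 * x2 * (cnj x1)\<^sup>2
              - r2 * x3\<^sup>2 * cnj x2 * cnj x1 + x3 ^ 3 * cnj x2 ^ 3 / 3) / 4)"

text \<open>The coefficients of the Szego term are, up to sign, the Fourier coefficients of the
  weight (doubled off the constant term), and \<open>x3 - x2 - x1 + x0\<close> is
  \<open>(S-1)^2 (S+1)\<close> because that operator expands to \<open>S^3 - S^2 - S + 1\<close>.
  Expanding its square gives the same correlations at shifted positions, so the difference on the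
  right telescopes.\<close>

lemma quadratic_part:
  fixes x0 x1 x2 x3 :: complex
  shows "(cmod (x3 - x2 - x1 + x0))\<^sup>2 / 8 - (cmod x3)\<^sup>2 / 2 + Re (x3 * cnj x2) / 4
      + Re (x3 * cnj x1) / 2 - Re (x3 * cnj x0) / 4
    = ((cmod x0)\<^sup>2 + (cmod x1)\<^sup>2 + (cmod x2)\<^sup>2 - 3 * (cmod x3)\<^sup>2) / 8
      + (Re (x3 * cnj x1) - Re (x2 * cnj x0)) / 4 + (Re (x2 * cnj x1) - Re (x1 * cnj x0)) / 4"
  unfolding cmod_power2 by (simp add: field_simps power2_eq_square)

text \<open>The last group is of second order in \<open>d0\<close>, \<open>d1\<close>; everything before it telescopes when summed over a sequence.\<close>

lemma quartic_part:
  fixes x0 x1 x2 x3 :: complex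
  defines "n0 \<equiv> (cmod x0)\<^sup>2" and "n1 \<equiv> (cmod x1)\<^sup>2" and "n2 \<equiv> (cmod x2)\<^sup>2" and "n3 \<equiv> (cmod x3)\<^sup>2"
    and "e0 \<equiv> Re (x1 * cnj x0)" and "e1 \<equiv> Re (x2 * cnj x1)" and "e2 \<equiv> Re (x3 * cnj x2)"
    and "d0 \<equiv> x2 - x0" and "d1 \<equiv> x3 - x1"
  shows "cmod (x1 - x0) ^ 4 / 8 - n3\<^sup>2 / 4 - n2 * Re (x3 * cnj x1) / 2 - Re (x3\<^sup>2 * (cnj x2)\<^sup>2) / 4
      + (n2 + n1) * Re (x3 * cnj x0) / 4 + Re (x3 * x2 * (cnj x1)\<^sup>2) / 4 + Re (x3\<^sup>2 * cnj x2 * cnj x1) / 4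
    = (n0\<^sup>2 + n1\<^sup>2 - 2 * n3\<^sup>2) / 8 - (n2 * n1 - n1 * n0) / 4 - (e2\<^sup>2 - e0\<^sup>2) / 2
      + (2 * (n1 * e1) - 2 * (n0 * e0) + (n2 * e1) + (n3 * e2) - 2 * (n1 * e0)) / 4
      + ((n1 + n2) * (e2 - e1) - (n0 + n1) * (e1 - e0)) / 4
      + (n2 * (cmod d1)\<^sup>2 / 4 - (n1 + n2) * Re (d1 * cnj d0) / 4
         - (n2 - n0) * Re (d0 * cnj x1) / 4 - (cmod d1)\<^sup>2 * (e1 + e2) / 8
         - Im (d1 * cnj x1) * Im (d1 * cnj x2) / 4 - (n3 - n1) * Re (d1 * cnj x2) / 8)"
proof -
  have 1: "Re (x3 * cnj x1) = (n1 + n3 - (cmod d1)\<^sup>2) / 2"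
    unfolding n1_def n3_def d1_def cmod_power2 by (simp add: field_simps power2_eq_square)
  have 2: "Re (x3\<^sup>2 * (cnj x2)\<^sup>2) = 2 * e2\<^sup>2 - n2 * n3"
    unfolding n2_def n3_def e2_def cmod_power2 by (simp add: algebra_simps power2_eq_square)
  have 3: "Re (x3 * cnj x0) = e2 + e0 - e1 - Re (d1 * cnj d0)"
    unfolding e2_def e1_def e0_def d1_def d0_def by (simp add: algebra_simps)
  have 4: "Re (d0 * cnj x1) = e1 - e0" "Re (d1 * cnj x2) = e2 - e1"
    unfolding e2_def e1_def e0_def d1_def d0_def by (simp_all add: algebra_simps)
  \<comment> \<open>The two mixed terms are treated together. Their sum is the real part of one
    product, and both imaginary parts in it are of first order in \<open>d1\<close>:
    \<open>x1 * cnj x1\<close> is real, and \<open>Im (x2 * cnj x1)\<close> equals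
    \<open>- Im (x1 * cnj x2)\<close>. The product of the imaginary parts is therefore of second
    order, which neither term would give alone.\<close>
  have "Re (x3 * x2 * (cnj x1)\<^sup>2) + Re (x3\<^sup>2 * cnj x2 * cnj x1)
     = Re ((x3 * cnj x1) * (x2 * cnj x1 + x3 * cnj x2))"
    by (simp add: algebra_simps power2_eq_square)
  also have "\<dots> = Re (x3 * cnj x1) * (e1 + e2) - Im (x3 * cnj x1) * Im (x2 * cnj x1 + x3 * cnj x2)"
    unfolding e1_def e2_def by simp
  also have "Im (x3 * cnj x1) = Im (d1 * cnj x1)"
    unfolding d1_def by (simp add: algebra_simps)
  also have "Im (x2 * cnj x1 + x3 * cnj x2) = Im (d1 * cnj x2)"
    unfolding d1_def by (simp add: algebra_simps)
  finally have 5: "Re (x3 * x2 * (cnj x1)\<^sup>2) + Re (x3\<^sup>2 * cnj x2 * cnj x1) =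
     (n1 + n3 - (cmod d1)\<^sup>2) / 2 * (e1 + e2) - Im (d1 * cnj x1) * Im (d1 * cnj x2)"
    unfolding 1 .
  have "(cmod (x1 - x0))\<^sup>2 = n0 + n1 - 2 * e0"
    unfolding n0_def n1_def e0_def cmod_power2 by (simp add: algebra_simps power2_eq_square)
  then have 6: "cmod (x1 - x0) ^ 4 = (n0 + n1 - 2 * e0)\<^sup>2"
    by (metis power_even_eq mult_2 numeral_Bit0)
  from 5 have h5: "Re (x3 * x2 * (cnj x1)\<^sup>2) = 
     (n1 + n3 - (cmod d1)\<^sup>2) / 2 * (e1 + e2) - Im (d1 * cnj x1) * Im (d1 * cnj x2) - Re (x3\<^sup>2 * cnj x2 * cnj x1)"
    by linarith
  show ?thesis
    unfolding 1 2 3 4 h5 6 by (simp add: field_simps power2_eq_square)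
qed


lemma sextic_product_le:
  fixes x y z w :: real
  assumes "0 \<le> x" "0 \<le> y" "0 \<le> z" "0 \<le> w"
  shows "x * y * z * w * (x * y) \<le> x ^ 6 + y ^ 6 + z ^ 6 + w ^ 6"
proof -
  define m where "m = max (max x y) (max z w)"
  have m: "x \<le> m" "y \<le> m" "z \<le> m" "w \<le> m" "0 \<le> m" using assms by (auto simp: m_def)
  have "x * y * z * w * (x * y) \<le> m * m * m * m * (m * m)"
    using assms m by (intro mult_mono mult_nonneg_nonneg) auto
  also have "\<dots> = m ^ 6" by (simp add: numeral_eq_Suc)
  also have "\<dots> \<le> x ^ 6 + y ^ 6 + z ^ 6 + w ^ 6"
    using assms by (auto simp: m_def max_def)
  finally show ?thesis .
qed

lemma abs_mult_Re_le: "0 \<le> c \<Longrightarrow> \<bar>c * Re z\<bar> \<le> c * cmod z"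
  by (simp add: abs_mult abs_Re_le_cmod mult_left_mono)

text \<open>Expanding the factors \<open>1 - |x|^2\<close> in \<open>szego_term\<close> leaves,
  besides the logarithm and the terms of degree two and four, only monomials of degree exactly six.
  In each of them some pair of factors occurs twice, which is the shape of
  \<open>sextic_product_le\<close>.\<close>

lemma higher_order_part_bound:
  fixes x0 x1 x2 x3 :: complex
  assumes "cmod x3 < 1"
  shows "\<bar>(cmod x2)\<^sup>2 * (cmod x1)\<^sup>2 * Re (x3 * cnj x0) + (cmod x2)\<^sup>2 * Re (x3 * x2 * (cnj x1)\<^sup>2)
      + (cmod x2)\<^sup>2 * Re (x3\<^sup>2 * cnj x2 * cnj x1) + Re (x3 ^ 3 * cnj x2 ^ 3) / 3\<bar>
    \<le> 6 * (cmod x0 ^ 6 + cmod x1 ^ 6 + cmod x2 ^ 6 + cmod x3 ^ 6)"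
proof -
  let ?S = "cmod x0 ^ 6 + cmod x1 ^ 6 + cmod x2 ^ 6 + cmod x3 ^ 6"
  have "\<bar>(cmod x2)\<^sup>2 * (cmod x1)\<^sup>2 * Re (x3 * cnj x0)\<bar> \<le> (cmod x2)\<^sup>2 * (cmod x1)\<^sup>2 * cmod (x3 * cnj x0)"
    by (intro abs_mult_Re_le) simp
  also have "\<dots> = cmod x2 * cmod x1 * cmod x3 * cmod x0 * (cmod x2 * cmod x1)"
    by (simp add: norm_mult power2_eq_square)
  also have "\<dots> \<le> ?S" using sextic_product_le[of "cmod x2" "cmod x1" "cmod x3" "cmod x0"] by simp
  finally have 1: "\<bar>(cmod x2)\<^sup>2 * (cmod x1)\<^sup>2 * Re (x3 * cnj x0)\<bar> \<le> ?S" .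
  have "\<bar>(cmod x2)\<^sup>2 * Re (x3 * x2 * (cnj x1)\<^sup>2)\<bar> \<le> (cmod x2)\<^sup>2 * cmod (x3 * x2 * (cnj x1)\<^sup>2)"
    by (intro abs_mult_Re_le) simp
  also have "\<dots> = cmod x2 * cmod x1 * cmod x3 * cmod x2 * (cmod x2 * cmod x1)"
    by (simp add: norm_mult norm_power power2_eq_square)
  also have "\<dots> \<le> cmod x2 ^ 6 + cmod x1 ^ 6 + cmod x3 ^ 6 + cmod x2 ^ 6"
    by (rule sextic_product_le) auto
  finally have 2: "\<bar>(cmod x2)\<^sup>2 * Re (x3 * x2 * (cnj x1)\<^sup>2)\<bar> \<le> ?S + cmod x2 ^ 6"
    using zero_le_power[OF norm_ge_zero[of x0], of 6] by linarith
  have "\<bar>(cmod x2)\<^sup>2 * Re (x3\<^sup>2 * cnj x2 * cnj x1)\<bar> \<le> (cmod x2)\<^sup>2 * cmod (x3\<^sup>2 * cnj x2 * cnj x1)"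
    by (intro abs_mult_Re_le) simp
  also have "\<dots> = cmod x2 * cmod x3 * cmod x1 * cmod x2 * (cmod x2 * cmod x3)"
    by (simp add: norm_mult norm_power power2_eq_square)
  also have "\<dots> \<le> cmod x2 ^ 6 + cmod x3 ^ 6 + cmod x1 ^ 6 + cmod x2 ^ 6"
    by (rule sextic_product_le) auto
  finally have 3: "\<bar>(cmod x2)\<^sup>2 * Re (x3\<^sup>2 * cnj x2 * cnj x1)\<bar> \<le> ?S + cmod x2 ^ 6"
    using zero_le_power[OF norm_ge_zero[of x0], of 6] by linarith
  have "\<bar>Re (x3 ^ 3 * cnj x2 ^ 3)\<bar> \<le> cmod (x3 ^ 3 * cnj x2 ^ 3)" by (rule abs_Re_le_cmod)
  also have "\<dots> = cmod x2 * cmod x3 * cmod x3 * cmod x2 * (cmod x2 * cmod x3)"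
    by (simp add: norm_mult norm_power power3_eq_cube)
  also have "\<dots> \<le> cmod x2 ^ 6 + cmod x3 ^ 6 + cmod x3 ^ 6 + cmod x2 ^ 6"
    by (rule sextic_product_le) auto
  finally have 4: "\<bar>Re (x3 ^ 3 * cnj x2 ^ 3)\<bar> \<le> cmod x2 ^ 6 + cmod x3 ^ 6 + cmod x3 ^ 6 + cmod x2 ^ 6" .
  have aux: "\<bar>A + B + C + D / 3\<bar> \<le> 6 * (x + y + z + w)"
    if "\<bar>A\<bar> \<le> x + y + z + w" "\<bar>B\<bar> \<le> x + y + z + w + z" "\<bar>C\<bar> \<le> x + y + z + w + z"
      "\<bar>D\<bar> \<le> z + w + w + z" "0 \<le> x" "0 \<le> y" "0 \<le> z" "0 \<le> w" for A B C D x y z w :: real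
    using that by (auto simp: abs_le_iff)
  show ?thesis by (rule aux[OF 1 2 3 4]) auto
qed

text \<open>The right side has three groups: telescoping differences, terms of second order in
  \<open>d\<close>, and terms of order six including the logarithmic remainder. Indices such as
  \<open>j + 1 + 2\<close> are left unsimplified so that each difference literally has the form
  \<open>g (j + i + k) - g (j + i)\<close> on which the telescoping rule works.\<close>

lemma szego_term_decomp:
  fixes a :: "nat \<Rightarrow> complex"
  defines "n \<equiv> \<lambda>j. (cmod (a j))\<^sup>2" and "e \<equiv> \<lambda>j. Re (a (Suc j) * cnj (a j))"
    and "m \<equiv> \<lambda>j. Re (a (j + 2) * cnj (a j))" and "d \<equiv> S2_minus_1 a"
  shows "szego_term a j + (cmod (S_minus_1 (S_minus_1 (S_plus_1 a)) j))\<^sup>2 / 8 + cmod (S_minus_1 a j) ^ 4 / 8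
    = (((-1/8) * (n (j + 3) - n j) + (-1/8) * (n (j + 2 + 1) - n (j + 2)) + (-1/8) * (n (j + 1 + 2) - n (j + 1)))
      + (1/4) * (m (j + 1) - m j) + (1/4) * (e (j + 1) - e j)
      + ((-1/8) * ((n (j + 3))\<^sup>2 - (n j)\<^sup>2) + (-1/8) * ((n (j + 1 + 2))\<^sup>2 - (n (j + 1))\<^sup>2))
      + (-1/4) * (n (Suc (j + 1)) * n (j + 1) - n (Suc j) * n j)
      + (-1/2) * ((e (j + 2))\<^sup>2 - (e j)\<^sup>2)
      + (1/2) * (n (j + 1) * e (j + 1) - n j * e j)
      + (1/4) * (n (Suc (j + 1)) * e (j + 1) - n (Suc j) * e j)
      + (1/4) * (n (Suc (j + 2)) * e (j + 2) - n (Suc j) * e j)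
      + (1/4) * ((n (j + 1) + n (Suc (j + 1))) * (e (Suc (j + 1)) - e (j + 1)) - (n j + n (Suc j)) * (e (Suc j) - e j)))
     + (n (j + 2) * (cmod (d (j + 1)))\<^sup>2 / 4 - (n (j + 1) + n (j + 2)) * Re (d (j + 1) * cnj (d j)) / 4
         - (n (j + 2) - n j) * Re (d j * cnj (a (j + 1))) / 4
         - (cmod (d (j + 1)))\<^sup>2 * (e (j + 1) + e (j + 2)) / 8
         - Im (d (j + 1) * cnj (a (j + 1))) * Im (d (j + 1) * cnj (a (j + 2))) / 4
         - (n (j + 3) - n (j + 1)) * Re (d (j + 1) * cnj (a (j + 2))) / 8)
     + ((1/2) * (ln (1 - n (j + 3)) + n (j + 3) + (n (j + 3))\<^sup>2 / 2)
      - (1/4) * (n (j + 2) * n (j + 1) * Re (a (j + 3) * cnj (a j))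
         + n (j + 2) * Re (a (j + 3) * a (j + 2) * (cnj (a (j + 1)))\<^sup>2)
         + n (j + 2) * Re ((a (j + 3))\<^sup>2 * cnj (a (j + 2)) * cnj (a (j + 1)))
         + Re (a (j + 3) ^ 3 * cnj (a (j + 2)) ^ 3) / 3))"
proof -
  define x0 x1 x2 x3 where x: "x0 = a j" "x1 = a (Suc j)" "x2 = a (Suc (Suc j))" "x3 = a (Suc (Suc (Suc j)))"
  have D: "S_minus_1 (S_minus_1 (S_plus_1 a)) j = x3 - x2 - x1 + x0"
    by (simp add: S_minus_1_def S_plus_1_def shift_def x)
  have E: "S_minus_1 a j = x1 - x0"
    by (simp add: S_minus_1_def shift_def x)
  have d: "d j = x2 - x0" "d (Suc j) = x3 - x1"
    by (simp_all add: d_def S2_minus_1_def shift_def x)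
  define n0 n1 n2 n3 where n0123: "n0 = (cmod x0)\<^sup>2" "n1 = (cmod x1)\<^sup>2" "n2 = (cmod x2)\<^sup>2" "n3 = (cmod x3)\<^sup>2"
  have nn: "n j = n0" "n (Suc j) = n1" "n (Suc (Suc j)) = n2" "n (Suc (Suc (Suc j))) = n3"
    by (simp_all add: n_def x n0123)
  define e0 e1 e2 where e012: "e0 = Re (x1 * cnj x0)" "e1 = Re (x2 * cnj x1)" "e2 = Re (x3 * cnj x2)"
  have ee: "e j = e0" "e (Suc j) = e1" "e (Suc (Suc j)) = e2"
    by (simp_all only: e_def x e012)
  have mm: "m j = Re (x2 * cnj x0)" "m (Suc j) = Re (x3 * cnj x1)"
    by (simp_all add: m_def x)
  have Rm: "Re (complex_of_real r * z) = r * Re z" for r z by simp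
  have t: "szego_term a j = ln (1 - n3) / 2 + e2 / 4 
      + ((1 - n2) * Re (x3 * cnj x1) - Re (x3\<^sup>2 * (cnj x2)\<^sup>2) / 2) / 2
      - ((1 - n2) * ((1 - n1) * Re (x3 * cnj x0)) - (1 - n2) * Re (x3 * x2 * (cnj x1)\<^sup>2)
         - (1 - n2) * Re (x3\<^sup>2 * cnj x2 * cnj x1) + Re (x3 ^ 3 * cnj x2 ^ 3) / 3) / 4"
    unfolding szego_term_def Let_def e012 n0123
    by (simp only: x[symmetric] add_2_eq_Suc' numeral_3_eq_3 add_Suc_right add_0_right One_nat_def
        Rm mult.assoc minus_complex.simps plus_complex.simps Re_divide_numeral)
  \<comment> \<open>Positional instantiation follows the order of first occurrence in the statement,
    so \<open>[of x3 x2 x1 x0]\<close> here and \<open>[of x1 x0 x3 x2]\<close> below both send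
    every variable to its namesake.\<close>
  have q2: "(cmod (x3 - x2 - x1 + x0))\<^sup>2 / 8 = n3 / 2 - e2 / 4
      - Re (x3 * cnj x1) / 2 + Re (x3 * cnj x0) / 4 + (n0 + n1 + n2 - 3 * n3) / 8
      + (Re (x3 * cnj x1) - Re (x2 * cnj x0)) / 4 + (e1 - e0) / 4"
    using quadratic_part[of x3 x2 x1 x0] unfolding n0123 e012 by linarith
  note q4 = quartic_part[of x1 x0 x3 x2, folded n0123 e012]
  have q4': "cmod (x1 - x0) ^ 4 / 8 = n3\<^sup>2 / 4 + n2 * Re (x3 * cnj x1) / 2 + Re (x3\<^sup>2 * (cnj x2)\<^sup>2) / 4
      - (n2 + n1) * Re (x3 * cnj x0) / 4 - Re (x3 * x2 * (cnj x1)\<^sup>2) / 4 - Re (x3\<^sup>2 * cnj x2 * cnj x1) / 4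
    + ((n0\<^sup>2 + n1\<^sup>2 - 2 * n3\<^sup>2) / 8 - (n2 * n1 - n1 * n0) / 4 - (e2\<^sup>2 - e0\<^sup>2) / 2
      + (2 * (n1 * e1) - 2 * (n0 * e0) + (n2 * e1) + (n3 * e2) - 2 * (n1 * e0)) / 4
      + ((n1 + n2) * (e2 - e1) - (n0 + n1) * (e1 - e0)) / 4
      + (n2 * (cmod (x3 - x1))\<^sup>2 / 4 - (n1 + n2) * Re ((x3 - x1) * cnj (x2 - x0)) / 4
         - (n2 - n0) * Re ((x2 - x0) * cnj x1) / 4 - (cmod (x3 - x1))\<^sup>2 * (e1 + e2) / 8
         - Im ((x3 - x1) * cnj x1) * Im ((x3 - x1) * cnj x2) / 4 - (n3 - n1) * Re ((x3 - x1) * cnj x2) / 8))"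
    using q4 by linarith
  have idx: "j + 1 = Suc j" "j + 2 = Suc (Suc j)" "j + 3 = Suc (Suc (Suc j))" "Suc j + 1 = Suc (Suc j)"
    "Suc j + 2 = Suc (Suc (Suc j))" "Suc (Suc j) + 1 = Suc (Suc (Suc j))" by simp_all
  show ?thesis
    unfolding D E t q2 q4' idx nn ee mm d x[symmetric]
    by (simp add: field_simps power2_eq_square)
qed


lemma bounded_partial_sums_szego_term:
  assumes a1: "\<And>j. cmod (a j) < 1" and d3: "S2_minus_1 a \<in> ell 3" and a6: "a \<in> ell 6"
  shows "bounded_partial_sums (\<lambda>j. szego_term a j
    + (cmod (S_minus_1 (S_minus_1 (S_plus_1 a)) j))\<^sup>2 / 8 + cmod (S_minus_1 a j) ^ 4 / 8)"
proof -
  define n where "n j = (cmod (a j))\<^sup>2" for j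
  define e where "e j = Re (a (Suc j) * cnj (a j))" for j
  define m where "m j = Re (a (j + 2) * cnj (a j))" for j
  define d where "d = S2_minus_1 a"
  have d_eq: "d j = a (j + 2) - a j" for j
    by (simp add: d_def S2_minus_1_def shift_def)
  have nb: "\<bar>n j\<bar> \<le> 1" for j
    using a1[of j] by (simp add: n_def power_le_one)
  have ab: "\<bar>Re (a i * cnj (a j))\<bar> \<le> 1" for i j
    using abs_Re_le_cmod[of "a i * cnj (a j)"] a1[of i] a1[of j]
    by (intro order_trans[OF abs_Re_le_cmod]) (simp add: norm_mult mult_le_one)
  then have eb: "\<bar>e j\<bar> \<le> 1" and mb: "\<bar>m j\<bar> \<le> 1" for j
    unfolding e_def m_def by auto
  have mult_b: "\<bar>x * y\<bar> \<le> 1" if "\<bar>x\<bar> \<le> 1" "\<bar>y\<bar> \<le> 1" for x y :: real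
    using that by (simp add: abs_mult mult_le_one)
  have tele: "bounded_partial_sums (\<lambda>j. c * (g (j + k) - g j))" if "\<And>j. \<bar>g j\<bar> \<le> C" for c g k C
    using bounded_partial_sums_cmult[OF bounded_partial_sums_shift[of g C k, OF that]] .
  have shift: "bounded_partial_sums (\<lambda>j. c * (g (j + i + k) - g (j + i)))" if "\<And>j. \<bar>g j\<bar> \<le> C" for c g i k C
  proof -
    have "(\<lambda>j. c * (g (j + i + k) - g (j + i))) = (\<lambda>j. c * (g (j + k + i) - g (j + i)))"
      by (simp add: ac_simps)
    then show ?thesis using tele[of "\<lambda>j. g (j + i)", OF that, of c k] by simp
  qed
  have T: "bounded_partial_sums (\<lambda>j.
      ((-1/8) * (n (j + 3) - n j) + (-1/8) * (n (j + 2 + 1) - n (j + 2)) + (-1/8) * (n (j + 1 + 2) - n (j + 1)))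
      + (1/4) * (m (j + 1) - m j) + (1/4) * (e (j + 1) - e j)
      + ((-1/8) * ((n (j + 3))\<^sup>2 - (n j)\<^sup>2) + (-1/8) * ((n (j + 1 + 2))\<^sup>2 - (n (j + 1))\<^sup>2))
      + (-1/4) * (n (Suc (j + 1)) * n (j + 1) - n (Suc j) * n j)
      + (-1/2) * ((e (j + 2))\<^sup>2 - (e j)\<^sup>2)
      + (1/2) * (n (j + 1) * e (j + 1) - n j * e j)
      + (1/4) * (n (Suc (j + 1)) * e (j + 1) - n (Suc j) * e j)
      + (1/4) * (n (Suc (j + 2)) * e (j + 2) - n (Suc j) * e j)
      + (1/4) * ((n (j + 1) + n (Suc (j + 1))) * (e (Suc (j + 1)) - e (j + 1)) - (n j + n (Suc j)) * (e (Suc j) - e j)))"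
    (is "bounded_partial_sums ?T")
  proof -
    have l: "\<bar>(n j + n (Suc j)) * (e (Suc j) - e j)\<bar> \<le> 2 * 2" for j
      unfolding abs_mult
      by (intro mult_mono) (use nb[of j] nb[of "Suc j"] eb[of j] eb[of "Suc j"] in auto)
    have sq: "\<bar>x\<^sup>2\<bar> \<le> 1" if "\<bar>x\<bar> \<le> 1" for x :: real
      using mult_b[OF that that] by (simp add: power2_eq_square)
    have t0: "bounded_partial_sums (\<lambda>j. (-1/8) * (n (j + 3) - n j))"
      by (rule tele[OF nb])
    have t1: "bounded_partial_sums (\<lambda>j. (-1/8) * (n (j + 2 + 1) - n (j + 2)))"
      by (rule shift[of n, OF nb])
    have t2: "bounded_partial_sums (\<lambda>j. (-1/8) * (n (j + 1 + 2) - n (j + 1)))"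
      by (rule shift[of n, OF nb])
    have t3: "bounded_partial_sums (\<lambda>j. (1/4) * (m (j + 1) - m j))"
      by (rule tele[OF mb])
    have t4: "bounded_partial_sums (\<lambda>j. (1/4) * (e (j + 1) - e j))"
      by (rule tele[OF eb])
    have t5: "bounded_partial_sums (\<lambda>j. (-1/8) * ((n (j + 3))\<^sup>2 - (n j)\<^sup>2))"
      by (rule tele[of "\<lambda>j. (n j)\<^sup>2", OF sq[OF nb]])
    have t6: "bounded_partial_sums (\<lambda>j. (-1/8) * ((n (j + 1 + 2))\<^sup>2 - (n (j + 1))\<^sup>2))"
      by (rule shift[of "\<lambda>j. (n j)\<^sup>2", OF sq[OF nb]])
    have t7: "bounded_partial_sums (\<lambda>j. (-1/4) * (n (Suc (j + 1)) * n (j + 1) - n (Suc j) * n j))"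
      by (rule tele[of "\<lambda>j. n (Suc j) * n j", OF mult_b[OF nb nb]])
    have t8: "bounded_partial_sums (\<lambda>j. (-1/2) * ((e (j + 2))\<^sup>2 - (e j)\<^sup>2))"
      by (rule tele[of "\<lambda>j. (e j)\<^sup>2", OF sq[OF eb]])
    have t9: "bounded_partial_sums (\<lambda>j. (1/2) * (n (j + 1) * e (j + 1) - n j * e j))"
      by (rule tele[of "\<lambda>j. n j * e j", OF mult_b[OF nb eb]])
    have t10: "bounded_partial_sums (\<lambda>j. (1/4) * (n (Suc (j + 1)) * e (j + 1) - n (Suc j) * e j))"
      by (rule tele[of "\<lambda>j. n (Suc j) * e j", OF mult_b[OF nb eb]])
    have t11: "bounded_partial_sums (\<lambda>j. (1/4) * (n (Suc (j + 2)) * e (j + 2) - n (Suc j) * e j))"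
      by (rule tele[of "\<lambda>j. n (Suc j) * e j", OF mult_b[OF nb eb]])
    have t12: "bounded_partial_sums (\<lambda>j. (1/4) * ((n (j + 1) + n (Suc (j + 1))) * (e (Suc (j + 1)) - e (j + 1)) - (n j + n (Suc j)) * (e (Suc j) - e j)))"
      by (rule tele[of "\<lambda>j. (n j + n (Suc j)) * (e (Suc j) - e j)", OF l])
    show ?thesis
      by (intro bounded_partial_sums_add t0 t1 t2 t3 t4 t5 t6 t7 t8 t9 t10 t11 t12)
  qed
  have sum3: "summable (\<lambda>j. cmod (d (j + i)) ^ 3)" for i
    using d3 unfolding ell_def d_def by (auto simp: summable_iff_shift[of "\<lambda>j. cmod (S2_minus_1 a j) ^ 3"])
  have sum6: "summable (\<lambda>j. cmod (a (j + i)) ^ 6)" for i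
    using a6 unfolding ell_def by (auto simp: summable_iff_shift[of "\<lambda>j. cmod (a j) ^ 6"])
  have second: "bounded_partial_sums f"
    if "\<And>j. \<bar>f j\<bar> \<le> cmod (d (j + p)) * cmod (d (j + q)) * cmod (a (j + r)) * cmod (a (j + s))" for f p q r s
  proof (rule bounded_partial_sums_comparison)
    show "\<bar>f j\<bar> \<le> cmod (d (j + p)) ^ 3 + cmod (d (j + q)) ^ 3 + cmod (a (j + r)) ^ 6 + cmod (a (j + s)) ^ 6" for j
      by (rule order_trans[OF that four_term_young]) auto
  qed (intro summable_add sum3 sum6)
  have second_c: "bounded_partial_sums (\<lambda>j. c * f j)"
    if "\<And>j. \<bar>f j\<bar> \<le> cmod (d (j + p)) * cmod (d (j + q)) * cmod (a (j + r)) * cmod (a (j + s))" for c f p q r s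
    by (rule bounded_partial_sums_cmult[OF second[OF that]])
  have ReIm: "\<bar>Re (x * cnj y)\<bar> \<le> cmod x * cmod y" "\<bar>Im (x * cnj y)\<bar> \<le> cmod x * cmod y" for x y
    using abs_Re_le_cmod[of "x * cnj y"] abs_Im_le_cmod[of "x * cnj y"] by (simp_all only: norm_mult complex_mod_cnj)
  \<comment> \<open>A difference of squared moduli at distance two is of first order in
    \<open>d\<close>; multiplied by another factor \<open>d\<close> it becomes an admissible
    error.\<close>
  have nd: "n (j + i + 2) - n (j + i) = Re (d (j + i) * cnj (a (j + i + 2))) + Re (d (j + i) * cnj (a (j + i)))" for i j
    unfolding n_def d_eq cmod_power2 by (simp add: field_simps power2_eq_square)
  \<comment> \<open>The two variants differ in how the four factors are grouped: here each factor of
    the product contributes one \<open>d\<close> and one \<open>a\<close>, while in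
    \<open>abs2'\<close> one factor contributes both \<open>d\<close> and the other both
    \<open>a\<close>.\<close>
  have abs2: "\<bar>x * y\<bar> \<le> u1 * u2 * v1 * v2" if "\<bar>x\<bar> \<le> u1 * v1" "\<bar>y\<bar> \<le> u2 * v2" for x y u1 u2 v1 v2 :: real
  proof -
    have "\<bar>x * y\<bar> \<le> (u1 * v1) * (u2 * v2)"
      unfolding abs_mult using that by (intro mult_mono) (auto intro: order_trans[OF abs_ge_zero])
    then show ?thesis by (simp add: ac_simps)
  qed
  have abs2': "\<bar>x * y\<bar> \<le> u1 * u2 * v1 * v2" if "\<bar>x\<bar> \<le> u1 * u2" "\<bar>y\<bar> \<le> v1 * v2" for x y u1 u2 v1 v2 :: real
  proof -
    have "\<bar>x * y\<bar> \<le> (u1 * u2) * (v1 * v2)"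
      unfolding abs_mult using that by (intro mult_mono) (auto intro: order_trans[OF abs_ge_zero])
    then show ?thesis by (simp add: ac_simps)
  qed
  have S: "bounded_partial_sums (\<lambda>j. n (j + 2) * (cmod (d (j + 1)))\<^sup>2 / 4 - (n (j + 1) + n (j + 2)) * Re (d (j + 1) * cnj (d j)) / 4
         - (n (j + 2) - n j) * Re (d j * cnj (a (j + 1))) / 4
         - (cmod (d (j + 1)))\<^sup>2 * (e (j + 1) + e (j + 2)) / 8
         - Im (d (j + 1) * cnj (a (j + 1))) * Im (d (j + 1) * cnj (a (j + 2))) / 4
         - (n (j + 3) - n (j + 1)) * Re (d (j + 1) * cnj (a (j + 2))) / 8)"
    (is "bounded_partial_sums ?S")
  proof -
    have "?S = (\<lambda>j. (1/4) * ((cmod (d (j + 1)))\<^sup>2 * n (j + 2))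
        - (1/4) * (Re (d (j + 1) * cnj (d j)) * n (j + 1)) - (1/4) * (Re (d (j + 1) * cnj (d j)) * n (j + 2))
        - (1/4) * (Re (d j * cnj (a (j + 2))) * Re (d j * cnj (a (j + 1))))
        - (1/4) * (Re (d j * cnj (a j)) * Re (d j * cnj (a (j + 1))))
        - (1/8) * ((cmod (d (j + 1)))\<^sup>2 * e (j + 1)) - (1/8) * ((cmod (d (j + 1)))\<^sup>2 * e (j + 2))
        - (1/4) * (Im (d (j + 1) * cnj (a (j + 1))) * Im (d (j + 1) * cnj (a (j + 2))))
        - (1/8) * (Re (d (j + 1) * cnj (a (j + 3))) * Re (d (j + 1) * cnj (a (j + 2))))
        - (1/8) * (Re (d (j + 1) * cnj (a (j + 1))) * Re (d (j + 1) * cnj (a (j + 2)))))"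
    proof
      fix j
      show "?S j = (1/4) * ((cmod (d (j + 1)))\<^sup>2 * n (j + 2))
        - (1/4) * (Re (d (j + 1) * cnj (d j)) * n (j + 1)) - (1/4) * (Re (d (j + 1) * cnj (d j)) * n (j + 2))
        - (1/4) * (Re (d j * cnj (a (j + 2))) * Re (d j * cnj (a (j + 1))))
        - (1/4) * (Re (d j * cnj (a j)) * Re (d j * cnj (a (j + 1))))
        - (1/8) * ((cmod (d (j + 1)))\<^sup>2 * e (j + 1)) - (1/8) * ((cmod (d (j + 1)))\<^sup>2 * e (j + 2))
        - (1/4) * (Im (d (j + 1) * cnj (a (j + 1))) * Im (d (j + 1) * cnj (a (j + 2))))
        - (1/8) * (Re (d (j + 1) * cnj (a (j + 3))) * Re (d (j + 1) * cnj (a (j + 2))))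
        - (1/8) * (Re (d (j + 1) * cnj (a (j + 1))) * Re (d (j + 1) * cnj (a (j + 2))))"
      proof -
        have i: "n (j + 2) - n j = Re (d j * cnj (a (j + 2))) + Re (d j * cnj (a j))"
          "n (j + 3) - n (j + 1) = Re (d (j + 1) * cnj (a (j + 3))) + Re (d (j + 1) * cnj (a (j + 1)))"
          using nd[of j 0] nd[of j 1] by (simp_all add: numeral_3_eq_3)
        have r: "A * B / 4 - (C + A) * D / 4 - (X1 + X2) * E / 4 - B * (F + G) / 8 - H * I / 4 - (Y1 + Y2) * J / 8
          = 1/4 * (B * A) - 1/4 * (D * C) - 1/4 * (D * A) - 1/4 * (X1 * E) - 1/4 * (X2 * E)
           - 1/8 * (B * F) - 1/8 * (B * G) - 1/4 * (H * I) - 1/8 * (Y1 * J) - 1/8 * (Y2 * J)"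
          for A B C D X1 X2 E F G H I Y1 Y2 J :: real
          by (simp add: field_simps)
        show ?thesis unfolding i by (rule r)
      qed
    qed
    moreover have "bounded_partial_sums \<dots>"
      unfolding n_def e_def power2_eq_square[of "cmod (a _)"]  power2_eq_square[of "cmod (d _)"]
      apply (intro bounded_partial_sums_diff)
      subgoal by (rule second_c[of _ 1 1 2 2], rule abs2') auto
      subgoal by (rule second_c[of _ 1 0 1 1], rule abs2') (auto simp only: ReIm add_0_right abs_mult abs_norm_cancel order_refl)
      subgoal by (rule second_c[of _ 1 0 2 2], rule abs2') (auto simp only: ReIm add_0_right abs_mult abs_norm_cancel order_refl)
      subgoal by (rule second_c[of _ 0 0 2 1], rule abs2) (auto simp only: ReIm add_0_right)
      subgoal by (rule second_c[of _ 0 0 0 1], rule abs2) (auto simp only: ReIm add_0_right)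
      subgoal by (rule second_c[of _ 1 1 2 1], rule abs2') (auto simp only: ReIm add_Suc_right add_2_eq_Suc' One_nat_def add_0_right abs_mult abs_norm_cancel order_refl)
      subgoal by (rule second_c[of _ 1 1 3 2], rule abs2') (auto simp only: ReIm add_Suc_right add_2_eq_Suc' numeral_3_eq_3 One_nat_def add_0_right abs_mult abs_norm_cancel order_refl)
      subgoal by (rule second_c[of _ 1 1 1 2], rule abs2) (auto simp only: ReIm)
      subgoal by (rule second_c[of _ 1 1 3 2], rule abs2) (auto simp only: ReIm)
      subgoal by (rule second_c[of _ 1 1 1 2], rule abs2) (auto simp only: ReIm)
      done
    ultimately show ?thesis by simp
  qed
  have ln: "bounded_partial_sums (\<lambda>j. ln (1 - n (j + 3)) + n (j + 3) + (n (j + 3))\<^sup>2 / 2)"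
  proof -
    have n3: "n j ^ 3 = cmod (a j) ^ 6" for j
      unfolding n_def by (simp flip: power_mult)
    \<comment> \<open>The cubic estimate of the logarithm holds only for
      \<open>n (j + 3) \<le> 1/2\<close>. This is true eventually since the sixth powers tend to 0,
      and \<open>(1/2)^3\<close> is the matching threshold for \<open>n^3 = |a|^6\<close>.\<close>
    have "(\<lambda>j. cmod (a (j + 3)) ^ 6) \<longlonglongrightarrow> 0"
      by (rule summable_LIMSEQ_zero[OF sum6])
    then have "eventually (\<lambda>j. cmod (a (j + 3)) ^ 6 < (1/2) ^ 3) sequentially"
      by (rule order_tendstoD) (simp add: power3_eq_cube)
    then have "eventually (\<lambda>j. norm (ln (1 - n (j + 3)) + n (j + 3) + (n (j + 3))\<^sup>2 / 2) \<le> cmod (a (j + 3)) ^ 6) sequentially"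
    proof eventually_elim
      case (elim j)
      then have "n (j + 3) ^ 3 < (1/2) ^ 3" unfolding n3 .
      then have "n (j + 3) \<le> 1/2"
        using power_mono[of "1/2" "n (j + 3)" 3] by fastforce
      then show ?case
        using abs_ln_one_minus_cubic[of "n (j + 3)"] unfolding n3 by (simp add: n_def)
    qed
    then have s: "summable (\<lambda>j. norm (norm (ln (1 - n (j + 3)) + n (j + 3) + (n (j + 3))\<^sup>2 / 2)))"
      by (intro summable_norm_comparison_test[OF _ sum6[of 3]]) (auto simp: eventually_sequentially)
    show ?thesis
      by (rule bounded_partial_sums_comparison[OF _ s]) simp
  qed
  have H: "bounded_partial_sums (\<lambda>j. n (j + 2) * n (j + 1) * Re (a (j + 3) * cnj (a j))
         + n (j + 2) * Re (a (j + 3) * a (j + 2) * (cnj (a (j + 1)))\<^sup>2)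
         + n (j + 2) * Re ((a (j + 3))\<^sup>2 * cnj (a (j + 2)) * cnj (a (j + 1)))
         + Re (a (j + 3) ^ 3 * cnj (a (j + 2)) ^ 3) / 3)"
    unfolding n_def
    by (rule bounded_partial_sums_comparison[OF higher_order_part_bound[OF a1]])
      (intro summable_mult summable_add sum6 sum6[of 0, unfolded add_0_right])
  show ?thesis
    unfolding szego_term_decomp
    by (intro bounded_partial_sums_add[OF bounded_partial_sums_add[OF T[unfolded n_def e_def m_def] S[unfolded n_def e_def d_def]]]
        bounded_partial_sums_diff[OF bounded_partial_sums_cmult[OF ln[unfolded n_def]] bounded_partial_sums_cmult[OF H[unfolded n_def]]])
qed

text \<open>The two norms enter with the same sign. If \<open>A + D/8 + E/8\<close> is bounded with
  \<open>D\<close> and \<open>E\<close> nonnegative, then a lower bound for \<open>A\<close> bounds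
  \<open>D\<close> and \<open>E\<close> separately, so one scalar condition yields both summability
  statements.\<close>

lemma szego_term_sums_bounded_below_iff:
  assumes "\<And>j. cmod (a j) < 1" "S2_minus_1 a \<in> ell 3" "a \<in> ell 6"
  shows "(\<exists>L. \<forall>n. L \<le> (\<Sum>j<n. szego_term a j)) \<longleftrightarrow>
    S_minus_1 a \<in> ell 4 \<and> S_minus_1 (S_minus_1 (S_plus_1 a)) \<in> ell 2"
proof -
  let ?D = "\<lambda>j. (cmod (S_minus_1 (S_minus_1 (S_plus_1 a)) j))\<^sup>2" and ?E = "\<lambda>j. cmod (S_minus_1 a j) ^ 4"
  obtain C where "\<And>n. \<bar>\<Sum>j<n. szego_term a j + ?D j / 8 + ?E j / 8\<bar> \<le> C"
    using bounded_partial_sums_szego_term[OF assms] unfolding bounded_partial_sums_def by blast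
  then have C: "\<bar>(\<Sum>j<n. szego_term a j) + (\<Sum>j<n. ?D j) / 8 + (\<Sum>j<n. ?E j) / 8\<bar> \<le> C" for n
    by (simp add: sum.distrib sum_divide_distrib)
  have nonneg: "0 \<le> (\<Sum>j<n. ?D j)" "0 \<le> (\<Sum>j<n. ?E j)" for n
    by (auto intro: sum_nonneg)
  show ?thesis
  proof
    assume "\<exists>L. \<forall>n. L \<le> (\<Sum>j<n. szego_term a j)"
    then obtain L where L: "\<And>n. L \<le> (\<Sum>j<n. szego_term a j)" by blast
    have aux: "D \<le> 8 * (C - L) \<and> E \<le> 8 * (C - L)"
      if "\<bar>A + D / 8 + E / 8\<bar> \<le> C" "L \<le> A" "0 \<le> D" "0 \<le> E" for A D E :: real
      using that by (auto simp: abs_le_iff)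
    have "(\<Sum>j<n. ?D j) \<le> 8 * (C - L)" "(\<Sum>j<n. ?E j) \<le> 8 * (C - L)" for n
      using aux[OF C[of n] L[of n] nonneg] by blast+
    then show "S_minus_1 a \<in> ell 4 \<and> S_minus_1 (S_minus_1 (S_plus_1 a)) \<in> ell 2"
      unfolding ell_def by (auto intro!: summableI_nonneg_bounded)
  next
    assume "S_minus_1 a \<in> ell 4 \<and> S_minus_1 (S_minus_1 (S_plus_1 a)) \<in> ell 2"
    then have s: "summable ?D" "summable ?E" unfolding ell_def by auto
    have aux: "- C - D' / 8 - E' / 8 \<le> A"
      if "\<bar>A + D / 8 + E / 8\<bar> \<le> C" "D \<le> D'" "E \<le> E'" for A D E D' E' :: real
      using that by (auto simp: abs_le_iff)
    have le: "(\<Sum>j<n. ?D j) \<le> suminf ?D" "(\<Sum>j<n. ?E j) \<le> suminf ?E" for n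
      using sum_le_suminf[OF s(1), of "{..<n}"] sum_le_suminf[OF s(2), of "{..<n}"] by simp_all
    have "- C - suminf ?D / 8 - suminf ?E / 8 \<le> (\<Sum>j<n. szego_term a j)" for n
      by (rule aux[OF C[of n] le])
    then show "\<exists>L. \<forall>n. L \<le> (\<Sum>j<n. szego_term a j)" by blast
  qed
qed

subsection \<open>Simultaneous approximation by continuous functions\<close>

text \<open>One function \<open>g\<close> has to serve both measures: the variational inequality
  compares an integral against arc length with one against \<mu>, and the singular part of \<mu>
  lives on an arc-length null set.\<close>

definition continuous_approx :: "complex measure \<Rightarrow> complex measure \<Rightarrow> (complex \<Rightarrow> real) \<Rightarrow> bool" where
  "continuous_approx M N f \<longleftrightarrow> (\<forall>e>0. \<exists>g. continuous_on UNIV g \<and>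
     (\<integral>\<^sup>+z. ennreal \<bar>f z - g z\<bar> \<partial>M) < ennreal e \<and> (\<integral>\<^sup>+z. ennreal \<bar>f z - g z\<bar> \<partial>N) < ennreal e)"

lemma continuous_approxD:
  assumes "continuous_approx M N f" "0 < e"
  obtains g where "continuous_on UNIV g" "(\<integral>\<^sup>+z. ennreal \<bar>f z - g z\<bar> \<partial>M) < ennreal e"
    "(\<integral>\<^sup>+z. ennreal \<bar>f z - g z\<bar> \<partial>N) < ennreal e"
  using assms unfolding continuous_approx_def by blast

lemma nn_integral_dist_triangle:
  fixes f g h :: "complex \<Rightarrow> real"
  assumes [measurable]: "f \<in> borel_measurable M" "g \<in> borel_measurable M" "h \<in> borel_measurable M"
    and "(\<integral>\<^sup>+z. ennreal \<bar>f z - g z\<bar> \<partial>M) < ennreal e" "(\<integral>\<^sup>+z. ennreal \<bar>g z - h z\<bar> \<partial>M) < ennreal e'"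
    and "0 < e" "0 < e'"
  shows "(\<integral>\<^sup>+z. ennreal \<bar>f z - h z\<bar> \<partial>M) < ennreal (e + e')"
proof -
  have "(\<integral>\<^sup>+z. ennreal \<bar>f z - h z\<bar> \<partial>M) \<le> (\<integral>\<^sup>+z. ennreal \<bar>f z - g z\<bar> + ennreal \<bar>g z - h z\<bar> \<partial>M)"
    by (intro nn_integral_mono) (simp flip: ennreal_plus)
  also have "\<dots> = (\<integral>\<^sup>+z. ennreal \<bar>f z - g z\<bar> \<partial>M) + (\<integral>\<^sup>+z. ennreal \<bar>g z - h z\<bar> \<partial>M)"
    by (intro nn_integral_add) auto
  also have "\<dots> < ennreal e + ennreal e'"
    using assms by (intro add_strict_mono) auto
  finally show ?thesis using assms by (simp add: ennreal_plus)
qed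

lemma regular_sandwich:
  fixes M :: "complex measure"
  assumes "finite_measure M" "sets M = sets borel" "A \<in> sets borel" "0 < e"
  obtains K U where "compact K" "open U" "K \<subseteq> A" "A \<subseteq> U" "emeasure M (U - K) < ennreal e"
proof -
  interpret finite_measure M by fact
  have fin: "emeasure M (space M) \<noteq> \<infinity>" by simp
  have in_sets: "compact K \<Longrightarrow> K \<in> sets M" "open U \<Longrightarrow> U \<in> sets M" for K U
    using assms(2) by (auto simp: compact_imp_closed)
  have A: "A \<in> sets M" using assms by simp
  have "\<exists>K\<in>{K. K \<subseteq> A \<and> compact K}. emeasure M A < emeasure M K + ennreal (e/2)"
    by (rule SUP_approx_ennreal[OF _ _ inner_regular[OF assms(2) fin assms(3)]])
      (use assms(4) fin in \<open>auto intro: exI[of _ "{}"]\<close>)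
  then obtain K where K: "K \<subseteq> A" "compact K" "emeasure M A < emeasure M K + ennreal (e/2)" by auto
  have "\<exists>U\<in>{U. A \<subseteq> U \<and> open U}. emeasure M U < emeasure M A + ennreal (e/2)"
    by (rule INF_approx_ennreal[OF _ outer_regular[OF assms(2) fin assms(3)]])
      (use assms(4) fin in auto)
  then obtain U where U: "A \<subseteq> U" "open U" "emeasure M U < emeasure M A + ennreal (e/2)" by auto
  have "measure M A < measure M K + e/2" 
    using K(3) assms(4) by (simp add: emeasure_eq_measure ennreal_plus[symmetric] ennreal_less_iff del: ennreal_plus)
  moreover have "measure M U < measure M A + e/2" 
    using U(3) assms(4) by (simp add: emeasure_eq_measure ennreal_plus[symmetric] ennreal_less_iff del: ennreal_plus)
  moreover have "measure M (U - K) = measure M U - measure M K"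
    using K U in_sets by (intro finite_measure_Diff) auto
  ultimately have "measure M (U - K) < e" by linarith
  then have "emeasure M (U - K) < ennreal e"
    unfolding emeasure_eq_measure by (intro ennreal_lessI assms(4))
  then show thesis using that K U by blast
qed

text \<open>With sandwiches \<open>K1, U1\<close> and \<open>K2, U2\<close> for the two measures, a
  Urysohn function equal to 1 on \<open>K1 \<union> K2\<close> and to 0 off
  \<open>U1 \<inter> U2\<close> differs from the indicator only inside \<open>U1 - K1\<close> and
  also only inside \<open>U2 - K2\<close>.\<close>

lemma continuous_approx_indicator:
  assumes M: "finite_measure M" "sets M = sets borel" and N: "finite_measure N" "sets N = sets borel"
    and A: "A \<in> sets borel"
  shows "continuous_approx M N (indicator A)"
  unfolding continuous_approx_def
proof (intro allI impI)
  fix e :: real assume e: "0 < e"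
  obtain K1 U1 where 1: "compact K1" "open U1" "K1 \<subseteq> A" "A \<subseteq> U1" "emeasure M (U1 - K1) < ennreal e"
    using regular_sandwich[OF M A e] .
  obtain K2 U2 where 2: "compact K2" "open U2" "K2 \<subseteq> A" "A \<subseteq> U2" "emeasure N (U2 - K2) < ennreal e"
    using regular_sandwich[OF N A e] .
  obtain g where g: "continuous_on UNIV g" "\<And>x. g x \<in> closed_segment 1 (0::real)"
    "\<And>x. x \<in> K1 \<union> K2 \<Longrightarrow> g x = 1" "\<And>x. x \<in> - (U1 \<inter> U2) \<Longrightarrow> g x = 0"
    by (rule Urysohn[of "K1 \<union> K2" "- (U1 \<inter> U2)" "1::real" 0])
      (use 1 2 in \<open>auto simp: compact_imp_closed intro: closed_Un\<close>)
  have g01: "0 \<le> g x" "g x \<le> 1" for x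
    using g(2)[of x] by (auto simp: closed_segment_eq_real_ivl)
  have b: "ennreal \<bar>indicator A x - g x\<bar> \<le> indicator (U1 - K1) x" "ennreal \<bar>indicator A x - g x\<bar> \<le> indicator (U2 - K2) x" for x
    using g01[of x] g(3,4)[of x] 1(3,4) 2(3,4) by (auto simp: indicator_def abs_if)
  have "(\<integral>\<^sup>+z. ennreal \<bar>indicator A z - g z\<bar> \<partial>M) \<le> emeasure M (U1 - K1)"
    by (rule order_trans[OF nn_integral_mono[OF b(1)]]) (use 1 M in \<open>simp add: compact_imp_closed\<close>)
  moreover have "(\<integral>\<^sup>+z. ennreal \<bar>indicator A z - g z\<bar> \<partial>N) \<le> emeasure N (U2 - K2)"
    by (rule order_trans[OF nn_integral_mono[OF b(2)]]) (use 2 N in \<open>simp add: compact_imp_closed\<close>)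
  ultimately show "\<exists>g. continuous_on UNIV g \<and> (\<integral>\<^sup>+z. ennreal \<bar>indicator A z - g z\<bar> \<partial>M) < ennreal e \<and>
     (\<integral>\<^sup>+z. ennreal \<bar>indicator A z - g z\<bar> \<partial>N) < ennreal e"
    using g(1) 1(5) 2(5) by (intro exI[of _ g]) auto
qed

lemma continuous_approx_bounded:
  fixes f :: "complex \<Rightarrow> real"
  assumes M: "finite_measure M" "sets M = sets borel" and N: "finite_measure N" "sets N = sets borel"
    and f: "f \<in> borel_measurable borel" "\<And>x. 0 \<le> f x" and B: "\<And>x. f x \<le> B"
  shows "continuous_approx M N f"
proof -
  interpret M: finite_measure M by fact
  interpret N: finite_measure N by fact
  note [measurable_cong] = M(2) N(2)
  \<comment> \<open>Boundedness is made part of the induction statement, because the approximants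
    produced by the induction rule come without a bound.\<close>
  have "(\<exists>B. \<forall>x. f x \<le> B) \<longrightarrow> continuous_approx M N f"
    using f
  proof (induction f rule: borel_measurable_induct_real)
    case (set A)
    then show ?case using continuous_approx_indicator[OF M N] by simp
  next
    case (mult u c)
    show ?case
    proof (cases "c = 0")
      case True
      then show ?thesis
        unfolding continuous_approx_def by (auto intro!: exI[of _ "\<lambda>_. 0"] continuous_intros)
    next
      case False
      then have c: "0 < c" using mult.hyps by simp
      show ?thesis
      proof
        assume "\<exists>B. \<forall>x. c * u x \<le> B"
        then obtain B where "\<And>x. c * u x \<le> B" by blast
        then have "\<And>x. u x \<le> B / c" using c by (simp add: field_simps)
        then have u: "continuous_approx M N u" using mult by blast
        show "continuous_approx M N (\<lambda>x. c * u x)"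
          unfolding continuous_approx_def
        proof (intro allI impI)
          fix e :: real assume "0 < e"
          then obtain g where g: "continuous_on UNIV g"
            "(\<integral>\<^sup>+z. ennreal \<bar>u z - g z\<bar> \<partial>M) < ennreal (e / c)" "(\<integral>\<^sup>+z. ennreal \<bar>u z - g z\<bar> \<partial>N) < ennreal (e / c)"
            using continuous_approxD[OF u, of "e / c"] c by auto
          have [measurable]: "g \<in> borel_measurable borel" "u \<in> borel_measurable borel"
            using g mult.hyps by (auto intro: borel_measurable_continuous_onI)
          have eq: "ennreal \<bar>c * u z - c * g z\<bar> = ennreal c * ennreal \<bar>u z - g z\<bar>" for z
            using c by (simp add: abs_mult ennreal_mult' flip: right_diff_distrib)
          have less: "ennreal c * x < ennreal e" if "x < ennreal (e / c)" for x
          proof -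
            have "ennreal c * x < ennreal c * ennreal (e / c)"
              using that c by (intro ennreal_mult_strict_left_mono) auto
            then show ?thesis using c \<open>0 < e\<close> by (simp flip: ennreal_mult)
          qed
          show "\<exists>g. continuous_on UNIV g \<and> (\<integral>\<^sup>+z. ennreal \<bar>c * u z - g z\<bar> \<partial>M) < ennreal e
              \<and> (\<integral>\<^sup>+z. ennreal \<bar>c * u z - g z\<bar> \<partial>N) < ennreal e"
            using g by (intro exI[of _ "\<lambda>z. c * g z"]) (auto simp: eq nn_integral_cmult intro!: continuous_intros less)
        qed
      qed
    qed
  next
    case (add u v)
    show ?case
    proof
      assume "\<exists>B. \<forall>x. v x + u x \<le> B"
      then obtain B where B: "\<And>x. v x + u x \<le> B" by blast
      have "u x \<le> B" "v x \<le> B" for x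
        using B[of x] add.hyps(2)[of x] add.hyps(4)[of x] by linarith+
      then have u: "continuous_approx M N u" and v: "continuous_approx M N v" using add by blast+
      show "continuous_approx M N (\<lambda>x. v x + u x)"
        unfolding continuous_approx_def
      proof (intro allI impI)
        fix e :: real assume e: "0 < e"
        then have "0 < e / 2" by simp
        obtain g where g: "continuous_on UNIV g"
          "(\<integral>\<^sup>+z. ennreal \<bar>u z - g z\<bar> \<partial>M) < ennreal (e/2)" "(\<integral>\<^sup>+z. ennreal \<bar>u z - g z\<bar> \<partial>N) < ennreal (e/2)"
          using continuous_approxD[OF u \<open>0 < e / 2\<close>] .
        obtain h where h: "continuous_on UNIV h"
          "(\<integral>\<^sup>+z. ennreal \<bar>v z - h z\<bar> \<partial>M) < ennreal (e/2)" "(\<integral>\<^sup>+z. ennreal \<bar>v z - h z\<bar> \<partial>N) < ennreal (e/2)"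
          using continuous_approxD[OF v \<open>0 < e / 2\<close>] .
        have [measurable]: "g \<in> borel_measurable borel" "u \<in> borel_measurable borel"
          "h \<in> borel_measurable borel" "v \<in> borel_measurable borel"
          using g h add.hyps by (auto intro: borel_measurable_continuous_onI)
        have "(\<integral>\<^sup>+z. ennreal \<bar>v z + u z - (h z + g z)\<bar> \<partial>M) < ennreal (e/2 + e/2)"
          by (rule nn_integral_dist_triangle[of _ _ "\<lambda>z. v z + g z"]) (use g h e in \<open>auto simp: algebra_simps\<close>)
        moreover have "(\<integral>\<^sup>+z. ennreal \<bar>v z + u z - (h z + g z)\<bar> \<partial>N) < ennreal (e/2 + e/2)"
          by (rule nn_integral_dist_triangle[of _ _ "\<lambda>z. v z + g z"]) (use g h e in \<open>auto simp: algebra_simps\<close>)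
        ultimately show "\<exists>g. continuous_on UNIV g \<and> (\<integral>\<^sup>+z. ennreal \<bar>v z + u z - g z\<bar> \<partial>M) < ennreal e
              \<and> (\<integral>\<^sup>+z. ennreal \<bar>v z + u z - g z\<bar> \<partial>N) < ennreal e"
          using g h by (intro exI[of _ "\<lambda>z. h z + g z"]) (auto intro!: continuous_intros)
      qed
    qed
  next
    case (seq U)
    show ?case
    proof
      assume "\<exists>B. \<forall>x. f x \<le> B"
      then obtain B where B: "\<And>x. f x \<le> B" by blast
      have conv: "(\<lambda>i. U i x) \<longlonglongrightarrow> f x" for x using seq.hyps(4) by simp
      have le: "U i x \<le> f x" for i x
        by (rule incseq_le[OF _ conv]) (use \<open>incseq U\<close> in \<open>auto simp: incseq_def le_fun_def\<close>)
      have ap: "continuous_approx M N (U i)" for i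
        using seq.IH[of i] order_trans[OF le B] by blast
      have [measurable]: "f \<in> borel_measurable borel" "\<And>i. U i \<in> borel_measurable borel"
        using seq.hyps(1) f(1) by auto
      have nb: "norm (U i x) \<le> \<bar>B\<bar>" for i x
        using le[of i x] B[of x] seq.hyps(2)[of i x] by simp
      have M0: "(\<lambda>i. \<integral>\<^sup>+x. ennreal (norm (f x - U i x)) \<partial>M) \<longlonglongrightarrow> 0"
        by (rule nn_integral_dominated_convergence_norm[where w="\<lambda>_. \<bar>B\<bar>"])
          (use nb conv in \<open>auto simp: ennreal_mult_eq_top_iff less_top[symmetric]\<close>)
      have N0: "(\<lambda>i. \<integral>\<^sup>+x. ennreal (norm (f x - U i x)) \<partial>N) \<longlonglongrightarrow> 0"
        by (rule nn_integral_dominated_convergence_norm[where w="\<lambda>_. \<bar>B\<bar>"])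
          (use nb conv in \<open>auto simp: ennreal_mult_eq_top_iff less_top[symmetric]\<close>)
      show "continuous_approx M N f"
        unfolding continuous_approx_def
      proof (intro allI impI)
        fix e :: real assume e: "0 < e"
        then have e2: "0 < e / 2" "0 < ennreal (e/2)" by auto
        have "eventually (\<lambda>i. (\<integral>\<^sup>+x. ennreal (norm (f x - U i x)) \<partial>M) < ennreal (e/2) \<and>
          (\<integral>\<^sup>+x. ennreal (norm (f x - U i x)) \<partial>N) < ennreal (e/2)) sequentially"
          by (intro eventually_conj order_tendstoD[OF M0] order_tendstoD[OF N0] e2)
        then obtain i where i: "(\<integral>\<^sup>+x. ennreal \<bar>f x - U i x\<bar> \<partial>M) < ennreal (e/2)"
          "(\<integral>\<^sup>+x. ennreal \<bar>f x - U i x\<bar> \<partial>N) < ennreal (e/2)"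
          by (auto simp: eventually_sequentially)
        obtain g where g: "continuous_on UNIV g"
          "(\<integral>\<^sup>+z. ennreal \<bar>U i z - g z\<bar> \<partial>M) < ennreal (e/2)" "(\<integral>\<^sup>+z. ennreal \<bar>U i z - g z\<bar> \<partial>N) < ennreal (e/2)"
          using continuous_approxD[OF ap e2(1)] .
        have [measurable]: "g \<in> borel_measurable borel"
          using g by (auto intro: borel_measurable_continuous_onI)
        have "(\<integral>\<^sup>+z. ennreal \<bar>f z - g z\<bar> \<partial>M) < ennreal (e/2 + e/2)"
          by (rule nn_integral_dist_triangle[OF _ _ _ i(1) g(2) e2(1) e2(1)]) measurable
        moreover have "(\<integral>\<^sup>+z. ennreal \<bar>f z - g z\<bar> \<partial>N) < ennreal (e/2 + e/2)"
          by (rule nn_integral_dist_triangle[OF _ _ _ i(2) g(3) e2(1) e2(1)]) measurable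
        ultimately show "\<exists>g. continuous_on UNIV g \<and> (\<integral>\<^sup>+z. ennreal \<bar>f z - g z\<bar> \<partial>M) < ennreal e
              \<and> (\<integral>\<^sup>+z. ennreal \<bar>f z - g z\<bar> \<partial>N) < ennreal e"
          using g by (intro exI[of _ g]) auto
      qed
    qed
  qed
  then show ?thesis using B by blast
qed

subsection \<open>Means of disc algebra functions\<close>

definition circle_measure :: "complex measure" where
  "circle_measure = distr normalized_angle borel cis"

lemma cis_measurable [measurable]: "cis \<in> borel_measurable borel"
  by (intro borel_measurable_continuous_onI continuous_intros)

lemma sets_normalized_angle [measurable_cong, simp]: "sets normalized_angle = sets borel"
  by (simp add: normalized_angle_def)

lemma space_normalized_angle [simp]: "space normalized_angle = UNIV"
  by (simp add: normalized_angle_def)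

lemma sets_circle_measure [measurable_cong, simp]: "sets circle_measure = sets borel"
  by (simp add: circle_measure_def)

lemma space_circle_measure [simp]: "space circle_measure = UNIV"
  by (simp add: circle_measure_def)

lemma prob_space_normalized_angle: "prob_space normalized_angle"
  unfolding normalized_angle_def by (rule prob_space_uniform_measure) auto

lemma prob_space_circle_measure: "prob_space circle_measure"
  unfolding circle_measure_def by (intro prob_space.prob_space_distr prob_space_normalized_angle) simp

text \<open>Dropping the endpoint makes \<open>cis\<close> injective, so that \<open>Arg2pi\<close>
  inverts it almost everywhere.\<close>

lemma AE_normalized_angle: "AE \<theta> in normalized_angle. \<theta> \<in> {0..<2 * pi}"
proof -
  have "AE x in lborel. x \<in> {0..2 * pi} \<longrightarrow> x \<in> {0..<2 * pi}"
    using AE_lborel_singleton[of "2 * pi"] by eventually_elim auto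
  then show ?thesis
    unfolding normalized_angle_def by (subst AE_uniform_measure) auto
qed

lemma AE_circle_measure: "AE z in circle_measure. z \<in> sphere 0 1"
  unfolding circle_measure_def by (subst AE_distr_iff) auto

text \<open>Two functions occur because \<open>F\<close> is controlled only on the circle and may be
  arbitrary elsewhere, whereas Lebesgue integration of \<open>f\<close> needs global Borel
  measurability.\<close>

lemma circle_measure_integral:
  fixes f :: "complex \<Rightarrow> complex" and v :: complex
  assumes cont: "continuous_on (sphere 0 1) F" and f: "f \<in> borel_measurable borel"
    and eq: "\<And>z. z \<in> sphere 0 1 \<Longrightarrow> f z = F z"
    and int: "((\<lambda>\<theta>. F (cis \<theta>)) has_integral complex_of_real (2 * pi) * v) {0..2 * pi}"
  shows "integrable circle_measure f" "integral\<^sup>L circle_measure f = v"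
proof -
  have c: "continuous_on {0..2 * pi} (\<lambda>\<theta>. f (cis \<theta>))"
  proof -
    have "continuous_on {0..2 * pi} (\<lambda>\<theta>. F (cis \<theta>))"
      by (rule continuous_on_compose2[OF cont]) (auto intro!: continuous_intros)
    then show ?thesis using eq by simp
  qed
  have "((\<lambda>\<theta>. f (cis \<theta>)) has_integral complex_of_real (2 * pi) * v) {0..2 * pi}"
    using int eq by simp
  then have i: "set_lebesgue_integral lborel {0..2 * pi} (\<lambda>\<theta>. f (cis \<theta>)) = complex_of_real (2 * pi) * v"
    using set_borel_integral_eq_integral(2)[OF borel_integrable_atLeastAtMost'[OF c]]
    by (simp add: integral_unique)
  have d: "normalized_angle = density lborel (\<lambda>\<theta>. ennreal (indicator {0..2 * pi} \<theta> / (2 * pi)))"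
    unfolding normalized_angle_def uniform_measure_def
    by (intro arg_cong2[where f=density] refl ext) (auto simp: indicator_def divide_ennreal[symmetric] ennreal_1)
  have s: "integrable lborel (\<lambda>\<theta>. indicator {0..2 * pi} \<theta> *\<^sub>R f (cis \<theta>))"
    using borel_integrable_atLeastAtMost'[OF c] unfolding set_integrable_def .
  have e: "(\<lambda>\<theta>. (indicator {0..2 * pi} \<theta> / (2 * pi)) *\<^sub>R f (cis \<theta>)) =
    (\<lambda>\<theta>. (1 / (2 * pi)) *\<^sub>R (indicator {0..2 * pi} \<theta> *\<^sub>R f (cis \<theta>)))"
    by (auto simp: field_simps)
  note [measurable] = f
  have "integrable normalized_angle (\<lambda>\<theta>. f (cis \<theta>))"
  proof -
    have "integrable lborel (\<lambda>\<theta>. (indicator {0..2 * pi} \<theta> / (2 * pi)) *\<^sub>R f (cis \<theta>))"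
      unfolding e by (intro integrable_scaleR_right s)
    then show ?thesis unfolding d by (subst integrable_density) simp_all
  qed
  then show "integrable circle_measure f"
    unfolding circle_measure_def by (subst integrable_distr_eq) auto
  have "integral\<^sup>L circle_measure f = (\<integral>\<theta>. f (cis \<theta>) \<partial>normalized_angle)"
    unfolding circle_measure_def by (subst integral_distr) auto
  also have "\<dots> = (\<integral>\<theta>. (indicator {0..2 * pi} \<theta> / (2 * pi)) *\<^sub>R f (cis \<theta>) \<partial>lborel)"
    unfolding d by (rule integral_density) auto
  also have "\<dots> = (1 / (2 * pi)) *\<^sub>R (\<integral>\<theta>. indicator {0..2 * pi} \<theta> *\<^sub>R f (cis \<theta>) \<partial>lborel)"
    unfolding e by (rule integral_scaleR_right)
  also have "\<dots> = v"
    unfolding i[unfolded set_lebesgue_integral_def] by (simp add: scaleR_conv_of_real)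
  finally show "integral\<^sup>L circle_measure f = v" .
qed

section \<open>The disc algebra and the mean value property\<close>

definition disc_algebra :: "(complex \<Rightarrow> complex) set" where
  "disc_algebra = {f. continuous_on (cball 0 1) f \<and> f holomorphic_on ball 0 1}"

named_theorems disc_intros

lemma disc_algebra_const [disc_intros]: "(\<lambda>z. c) \<in> disc_algebra"
  by (auto simp: disc_algebra_def)

lemma disc_algebra_ident [disc_intros]: "(\<lambda>z. z) \<in> disc_algebra"
  by (auto simp: disc_algebra_def)

lemma disc_algebra_add [disc_intros]:
  "f \<in> disc_algebra \<Longrightarrow> g \<in> disc_algebra \<Longrightarrow> (\<lambda>z. f z + g z) \<in> disc_algebra"
  by (auto simp: disc_algebra_def intro!: continuous_intros holomorphic_intros)

lemma disc_algebra_minus [disc_intros]: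
  "f \<in> disc_algebra \<Longrightarrow> (\<lambda>z. - f z) \<in> disc_algebra"
  by (auto simp: disc_algebra_def intro!: continuous_intros holomorphic_intros)

lemma disc_algebra_diff [disc_intros]:
  "f \<in> disc_algebra \<Longrightarrow> g \<in> disc_algebra \<Longrightarrow> (\<lambda>z. f z - g z) \<in> disc_algebra"
  by (auto simp: disc_algebra_def intro!: continuous_intros holomorphic_intros)

lemma disc_algebra_mult [disc_intros]:
  "f \<in> disc_algebra \<Longrightarrow> g \<in> disc_algebra \<Longrightarrow> (\<lambda>z. f z * g z) \<in> disc_algebra"
  by (auto simp: disc_algebra_def intro!: continuous_intros holomorphic_intros)

lemma disc_algebra_power [disc_intros]:
  "f \<in> disc_algebra \<Longrightarrow> (\<lambda>z. f z ^ n) \<in> disc_algebra"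
  by (auto simp: disc_algebra_def intro!: continuous_intros holomorphic_intros)

lemma disc_algebra_divide:
  assumes "f \<in> disc_algebra" "g \<in> disc_algebra" "\<And>z. cmod z \<le> 1 \<Longrightarrow> g z \<noteq> 0"
  shows "(\<lambda>z. f z / g z) \<in> disc_algebra"
  using assms by (auto simp: disc_algebra_def intro!: continuous_intros holomorphic_intros)

lemma disc_algebra_poly [disc_intros]: "poly p \<in> disc_algebra"
  by (auto simp: disc_algebra_def intro!: continuous_intros holomorphic_intros)

lemma disc_algebra_compose:
  assumes "f holomorphic_on ball 0 1" "u \<in> disc_algebra" "\<And>z. cmod z \<le> 1 \<Longrightarrow> cmod (u z) < 1"
  shows "(\<lambda>z. f (u z)) \<in> disc_algebra"
proof -
  have "continuous_on (cball 0 1) (\<lambda>z. f (u z))"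
    by (rule continuous_on_compose2[OF holomorphic_on_imp_continuous_on[OF assms(1)]])
      (use assms(2,3) in \<open>auto simp: disc_algebra_def\<close>)
  moreover have "(\<lambda>z. f (u z)) holomorphic_on ball 0 1"
  proof -
    have "f \<circ> u holomorphic_on ball 0 1"
      by (rule holomorphic_on_compose_gen[OF _ assms(1)]) (use assms(2,3) in \<open>auto simp: disc_algebra_def\<close>)
    then show ?thesis by (simp add: o_def)
  qed
  ultimately show ?thesis by (simp add: disc_algebra_def)
qed

lemma disc_algebra_mean:
  assumes F: "F \<in> disc_algebra" and f: "f \<in> borel_measurable borel"
    and eq: "\<And>z. z \<in> sphere 0 1 \<Longrightarrow> f z = F z"
  shows "integrable circle_measure f" "integral\<^sup>L circle_measure f = F 0"
proof -
  have c: "continuous_on (sphere 0 1) F"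
    using F by (auto simp: disc_algebra_def intro: continuous_on_subset)
  have "((\<lambda>u. F u / (u - 0)) has_contour_integral 2 * of_real pi * \<i> * F 0) (circlepath 0 1)"
    by (rule Cauchy_integral_circlepath) (use F in \<open>auto simp: disc_algebra_def\<close>)
  then have "((\<lambda>t. \<i> * F (cis t)) has_integral 2 * of_real pi * \<i> * F 0) {0..2 * pi}"
    unfolding circlepath_def by (subst (asm) has_contour_integral_part_circlepath_iff) (auto simp: mult.commute)
  \<comment> \<open>On the unit circle \<open>dz / z = \<i> dt\<close>, so the factor
    \<open>- \<i>\<close> turns the Cauchy integral of \<open>F u / u\<close> into the integral over
    the angle.\<close>
  from has_integral_mult_right[OF this, of "- \<i>"] have i0:
    "((\<lambda>t. - \<i> * (\<i> * F (cis t))) has_integral - \<i> * (2 * of_real pi * \<i> * F 0)) {0..2 * pi}" .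
  have i: "((\<lambda>t. F (cis t)) has_integral complex_of_real (2 * pi) * F 0) {0..2 * pi}"
  proof -
    have "- \<i> * (\<i> * x) = x" "- \<i> * (2 * of_real pi * \<i> * x) = 2 * of_real pi * x" for x :: complex
      by (simp_all add: complex_eq_iff)
    with i0 show ?thesis by (simp only: of_real_mult of_real_numeral)
  qed
  show "integrable circle_measure f" "integral\<^sup>L circle_measure f = F 0"
    by (rule circle_measure_integral[OF c f eq i]; assumption)+
qed

lemma disc_algebra_mean_Re:
  assumes F: "F \<in> disc_algebra" and f: "f \<in> borel_measurable borel"
    and eq: "\<And>z. z \<in> sphere 0 1 \<Longrightarrow> f z = Re (F z)"
  shows "integrable circle_measure f" "integral\<^sup>L circle_measure f = Re (F 0)"
proof -
  define g where "g z = indicator (sphere 0 1) z *\<^sub>R F z" for z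
  have "g \<in> borel_measurable borel"
    unfolding g_def using F
    by (intro borel_measurable_continuous_on_indicator)
      (auto simp: disc_algebra_def intro: continuous_on_subset)
  note m = disc_algebra_mean[OF F this] 
  have g: "integrable circle_measure g" "integral\<^sup>L circle_measure g = F 0"
    by (rule m; simp add: g_def)+
  have ae: "AE z in circle_measure. f z = Re (g z)"
    using AE_circle_measure by eventually_elim (simp add: eq g_def)
  have "integrable circle_measure (\<lambda>z. Re (g z))" by (intro integrable_Re g)
  then show "integrable circle_measure f"
    by (subst integrable_cong_AE[OF _ _ ae]) (use f g in auto)
  have "integral\<^sup>L circle_measure f = (\<integral>z. Re (g z) \<partial>circle_measure)"
    by (rule integral_cong_AE[OF _ _ ae]) (use f g in auto)
  also have "\<dots> = Re (F 0)" using integral_Re[OF g(1)] g(2) by simp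
  finally show "integral\<^sup>L circle_measure f = Re (F 0)" .
qed

text \<open>The remainder is kept as \<open>u^4\<close> times a holomorphic function, not as an
  error bound. Composed with a disc algebra function it stays in the disc algebra, and means can
  then be evaluated exactly.\<close>

lemma Ln_one_minus_remainder:
  obtains L where "L holomorphic_on ball 0 1"
    "\<And>u. cmod u < 1 \<Longrightarrow> Ln (1 - u) = - u - u\<^sup>2 / 2 - u ^ 3 / 3 + u ^ 4 * L u"
proof -
  define L :: "complex \<Rightarrow> complex" where "L u = (\<Sum>n. - 1 / of_nat (n + 4) * u ^ n)" for u
  have s: "(\<lambda>n. - 1 / of_nat (n + 4) * u ^ n) sums L u" if "cmod u < 1" for u
    unfolding L_def
  proof (rule summable_sums, rule summable_comparison_test[OF _ summable_geometric[of "cmod u"]])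
    show "\<exists>N. \<forall>n\<ge>N. norm (- 1 / of_nat (n + 4) * u ^ n) \<le> cmod u ^ n"
    proof (intro exI[of _ 0] allI impI)
      fix n
      have "norm (- 1 / of_nat (n + 4) * u ^ n) = cmod u ^ n / real (n + 4)"
        unfolding norm_mult norm_divide norm_power norm_of_nat by simp
      also have "\<dots> \<le> cmod u ^ n / 1" by (intro divide_left_mono) auto
      finally show "norm (- 1 / of_nat (n + 4) * u ^ n) \<le> cmod u ^ n" by simp
    qed
  qed (use that in auto)
  show thesis
  proof
    show "L holomorphic_on ball 0 1"
      by (rule power_series_holomorphic[where a="\<lambda>n. - 1 / of_nat (n + 4)"]) (use s in auto)
    fix u :: complex assume u: "cmod u < 1"
    \<comment> \<open>The term with index 0 is a division by 0 and hence 0, so splitting off four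
      terms removes the powers 1, 2 and 3.\<close>
    have "(\<lambda>n. - (u ^ n) / of_nat n) sums Ln (1 - u)"
      using Ln_series'[of "- u"] u by simp
    from sums_split_initial_segment[OF this, of 4]
    have "(\<lambda>n. - (u ^ (n + 4)) / of_nat (n + 4)) sums (Ln (1 - u) - (- u - u\<^sup>2 / 2 - u ^ 3 / 3))"
      by (simp add: numeral_eq_Suc)
    moreover have "(\<lambda>n. u ^ 4 * (- 1 / of_nat (n + 4) * u ^ n)) sums (u ^ 4 * L u)"
      by (intro sums_mult s u)
    ultimately have "Ln (1 - u) - (- u - u\<^sup>2 / 2 - u ^ 3 / 3) = u ^ 4 * L u"
      by (intro sums_unique2) (auto simp: power_add mult.commute)
    then show "Ln (1 - u) = - u - u\<^sup>2 / 2 - u ^ 3 / 3 + u ^ 4 * L u"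
      by (simp add: algebra_simps)
  qed
qed

section \<open>Weighted means of log |1 - z v|^2\<close>

definition circle_weight :: "complex \<Rightarrow> real" where
  "circle_weight z = (1 - Re z)\<^sup>2 * (1 + Re z)"

lemma circle_weight_eq_poly:
  assumes "cmod z = 1"
  shows "of_real (circle_weight z) = 1 / 2 - (z + cnj z) / 8 - (z\<^sup>2 + (cnj z)\<^sup>2) / 4 + (z ^ 3 + cnj z ^ 3) / 8"
proof -
  have zz: "z * cnj z = 1" using assms by (simp add: complex_norm_square[symmetric])
  have R: "of_real (Re z) = (z + cnj z) / 2" by (simp add: complex_add_cnj)
  have p: "(z + cnj z)\<^sup>2 = z\<^sup>2 + (cnj z)\<^sup>2 + 2" "(z + cnj z) ^ 3 = z ^ 3 + cnj z ^ 3 + 3 * (z + cnj z)"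
    using zz by algebra+
  have "of_real (circle_weight z) = (1 - (z + cnj z) / 2)\<^sup>2 * (1 + (z + cnj z) / 2)"
    unfolding circle_weight_def of_real_mult of_real_power of_real_diff of_real_add of_real_1 R ..
  also have "\<dots> = 1 - (z + cnj z) / 2 - (z + cnj z)\<^sup>2 / 4 + (z + cnj z) ^ 3 / 8"
    by (simp add: field_simps power2_eq_square power3_eq_cube)
  also have "\<dots> = 1 / 2 - (z + cnj z) / 8 - (z\<^sup>2 + (cnj z)\<^sup>2) / 4 + (z ^ 3 + cnj z ^ 3) / 8"
    unfolding p by (simp add: field_simps)
  finally show ?thesis .
qed

text \<open>The numbers \<open>c1\<close>, \<open>c2\<close>, \<open>c3\<close> are the first Taylor
  coefficients of \<open>Ln (1 - z * v z)\<close>, a disc algebra function vanishing at 0. The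
  weight is a Laurent polynomial on the circle, so its product with this function is analytic except
  for finitely many powers of \<open>cnj z\<close>; after these are reflected, the mean is a value
  at 0.\<close>

lemma weighted_log_mean:
  fixes v h :: "complex \<Rightarrow> complex"
  assumes v: "v \<in> disc_algebra" "h \<in> disc_algebra" and vm: "v \<in> borel_measurable borel"
    and lt: "\<And>z. cmod z \<le> 1 \<Longrightarrow> cmod (z * v z) < 1"
    and jet: "\<And>z. cmod z \<le> 1 \<Longrightarrow> v z = v0 + v1 * z + v2 * z\<^sup>2 + z ^ 3 * h z"
  defines "c1 \<equiv> - v0" and "c2 \<equiv> - v1 - v0\<^sup>2 / 2" and "c3 \<equiv> - v2 - v0 * v1 - v0 ^ 3 / 3"
  defines "f \<equiv> \<lambda>z. circle_weight z * ln ((cmod (1 - z * v z))\<^sup>2)"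
  shows "integrable circle_measure f" "integral\<^sup>L circle_measure f = Re (- c1 / 4 - c2 / 2 + c3 / 4)"
proof -
  obtain L where L: "L holomorphic_on ball 0 1"
    "\<And>u. cmod u < 1 \<Longrightarrow> Ln (1 - u) = - u - u\<^sup>2 / 2 - u ^ 3 / 3 + u ^ 4 * L u"
    by (rule Ln_one_minus_remainder) blast
  \<comment> \<open>Here \<open>v = v0 + z w\<close>, \<open>w = v1 + z s\<close> and
    \<open>s = v2 + z h\<close>. The function \<open>r\<close> then collects everything of order
    four and higher in the logarithm, divided by \<open>z^4\<close>.\<close>
  define w where "w z = v1 + v2 * z + z\<^sup>2 * h z" for z
  define s where "s z = v2 + z * h z" for z
  define r where "r z = - h z - (2 * v0 * s z + w z ^ 2) / 2
     - (3 * v0\<^sup>2 * w z + 3 * v0 * z * w z ^ 2 + z\<^sup>2 * w z ^ 3) / 3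
     + v z ^ 4 * L (z * v z)" for z
  define H where "H z = z * (c1 + c2 * z + c3 * z\<^sup>2 + z ^ 3 * r z)" for z
  have r: "r \<in> disc_algebra"
    unfolding r_def s_def w_def divide_inverse using lt
    by (intro disc_intros v disc_algebra_compose[OF L(1)]) auto
  have H: "H \<in> disc_algebra" unfolding H_def by (intro disc_intros r)
  have Ln: "Ln (1 - z * v z) = H z" if "cmod z \<le> 1" for z
  proof -
    have 1: "Ln (1 - z * v z) = - (z * v z) - (z * v z)\<^sup>2 / 2 - (z * v z) ^ 3 / 3 + (z * v z) ^ 4 * L (z * v z)"
      by (rule L(2)[OF lt[OF that]])
    have 2: "v z = v0 + z * w z" "w z = v1 + z * s z" "s z = v2 + z * h z"
      using jet[OF that] by (simp_all add: w_def s_def algebra_simps power2_eq_square power3_eq_cube)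
    have sq: "(v z)\<^sup>2 = v0\<^sup>2 + 2 * v0 * v1 * z + z\<^sup>2 * (2 * v0 * s z + w z ^ 2)"
      using 2 by algebra
    have cu: "v z ^ 3 = v0 ^ 3 + z * (3 * v0\<^sup>2 * w z + 3 * v0 * z * w z ^ 2 + z\<^sup>2 * w z ^ 3)"
      unfolding 2(1) by (simp add: algebra_simps power2_eq_square power3_eq_cube)
    have v: "z * v z = z * v0 + z\<^sup>2 * v1 + z ^ 3 * v2 + z ^ 4 * h z"
      using 2 by algebra
    have "Ln (1 - z * v z) = - (z * v z) - z\<^sup>2 * (v z)\<^sup>2 / 2 - z ^ 3 * v z ^ 3 / 3 + z ^ 4 * (v z ^ 4 * L (z * v z))"
      unfolding 1 by (simp add: power_mult_distrib)
    also have "\<dots> = H z"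
      unfolding sq cu unfolding v H_def r_def c1_def c2_def c3_def by (simp add: field_simps numeral_eq_Suc)
    finally show ?thesis .
  qed
  \<comment> \<open>Half of \<open>G\<close> is the weight times \<open>H\<close> with each leftover
    term \<open>c * cnj z ^ k\<close> replaced by its conjugate \<open>cnj c * z ^ k\<close>. This
    changes only the imaginary part and makes \<open>G\<close> analytic.\<close>
  define G where "G z = 2 * ((1 / 2 - z / 8 - z\<^sup>2 / 4 + z ^ 3 / 8) * H z
     - (c1 + c2 * z + c3 * z\<^sup>2 + z ^ 3 * r z) / 8 - (c2 + c3 * z + z\<^sup>2 * r z) / 4 - cnj c1 * z / 4 
     + (c3 + z * r z) / 8 + cnj c1 * z\<^sup>2 / 8 + cnj c2 * z / 8)" for z
  have G: "G \<in> disc_algebra" unfolding G_def divide_inverse by (intro disc_intros r H)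
  have eq: "f z = Re (G z)" if "z \<in> sphere 0 1" for z
  proof -
    have z: "cmod z = 1" using that by simp
    have zz: "z * cnj z = 1" using z by (simp add: complex_norm_square[symmetric])
    have n0: "1 - z * v z \<noteq> 0" using lt[of z] z by auto
    have "ln ((cmod (1 - z * v z))\<^sup>2) = 2 * Re (H z)"
      using Ln[of z] z n0 by (simp add: ln_realpow flip: Re_Ln)
    then have "f z = 2 * Re (of_real (circle_weight z) * H z)"
      unfolding f_def by simp
    also have "of_real (circle_weight z) * H z = G z / 2
      + ((cnj z * c1 / 8 * cnj z - z * cnj c1 / 8 * z) - (cnj z * c1 - z * cnj c1) / 4 + (cnj z * c2 - z * cnj c2) / 8)"
    proof -
      have y: "cnj z * H z = c1 + c2 * z + c3 * z\<^sup>2 + z ^ 3 * r z"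
        "(cnj z)\<^sup>2 * H z = c1 * cnj z + c2 + c3 * z + z\<^sup>2 * r z"
        "cnj z ^ 3 * H z = c1 * (cnj z)\<^sup>2 + c2 * cnj z + c3 + z * r z"
        unfolding H_def using zz by algebra+
      have q: "of_real (circle_weight z) * H z = (1 / 2 - z / 8 - z\<^sup>2 / 4 + z ^ 3 / 8) * H z
          - (cnj z * H z) / 8 - ((cnj z)\<^sup>2 * H z) / 4 + (cnj z ^ 3 * H z) / 8"
        unfolding circle_weight_eq_poly[OF z] by (simp add: field_simps)
      show ?thesis unfolding q y G_def by (simp add: field_simps power2_eq_square)
    qed
    also have "2 * Re \<dots> = Re (G z)" by (simp add: algebra_simps)
    finally show ?thesis .
  qed
  have fm: "f \<in> borel_measurable borel"
    unfolding f_def circle_weight_def using vm by measurable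
  show "integrable circle_measure f"
    by (rule disc_algebra_mean_Re(1)[OF G fm eq])
  have "integral\<^sup>L circle_measure f = Re (G 0)"
    by (rule disc_algebra_mean_Re(2)[OF G fm eq])
  then show "integral\<^sup>L circle_measure f = Re (- c1 / 4 - c2 / 2 + c3 / 4)"
    by (simp add: G_def H_def)
qed

subsection \<open>Szego recursion and orthogonality\<close>

text \<open>Total mass 1 is not part of the locale: for the Bernstein--Szego measures only
  finiteness is immediate, and their mass is computed from orthogonality relations proved inside the
  locale.\<close>

locale circle_finite_measure = finite_measure M for M :: "complex measure" +
  assumes sets_borel [measurable_cong, simp]: "sets M = sets borel"
    and AE_sphere: "AE z in M. z \<in> sphere 0 1"
begin

lemma space_UNIV [simp]: "space M = UNIV"
  using sets_eq_imp_space_eq[OF sets_borel] by simp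

lemma integrable_continuous:
  fixes f :: "complex \<Rightarrow> 'b :: {banach, second_countable_topology}"
  assumes f [measurable]: "f \<in> borel_measurable borel" and c: "continuous_on (sphere 0 1) f"
  shows "integrable M f"
proof -
  have "bounded (f ` sphere 0 1)"
    by (intro compact_imp_bounded compact_continuous_image c) simp
  then obtain B where "\<And>z. z \<in> sphere 0 1 \<Longrightarrow> norm (f z) \<le> B"
    unfolding bounded_iff by blast
  with AE_sphere have "AE z in M. norm (f z) \<le> B" by (auto elim: eventually_mono)
  then show ?thesis by (intro integrable_const_bound) auto
qed

lemma integrable_cont [intro]:
  fixes f :: "complex \<Rightarrow> 'b :: {banach, second_countable_topology}"
  assumes "continuous_on UNIV f"
  shows "integrable M f"
  using assms by (intro integrable_continuous borel_measurable_continuous_onI) (auto intro: continuous_on_subset)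

lemma integral_cong_sphere:
  fixes f g :: "complex \<Rightarrow> 'b :: {banach, second_countable_topology}"
  assumes "\<And>z. cmod z = 1 \<Longrightarrow> f z = g z" "f \<in> borel_measurable borel" "g \<in> borel_measurable borel"
  shows "integral\<^sup>L M f = integral\<^sup>L M g"
  by (rule integral_cong_AE) (use assms AE_sphere in \<open>auto elim!: eventually_mono\<close>)

lemma integral_cong_sphere_cont:
  fixes f g :: "complex \<Rightarrow> 'b :: {banach, second_countable_topology}"
  assumes "\<And>z. cmod z = 1 \<Longrightarrow> f z = g z" "continuous_on UNIV f" "continuous_on UNIV g"
  shows "integral\<^sup>L M f = integral\<^sup>L M g"
  using assms by (intro integral_cong_sphere borel_measurable_continuous_onI)

definition orthogonal_below :: "nat \<Rightarrow> complex poly \<Rightarrow> bool" where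
  "orthogonal_below n Q \<longleftrightarrow> (\<forall>k<n. (\<integral>z. cnj (z ^ k) * poly Q z \<partial>M) = 0)"

lemma orthogonal_below_degree:
  assumes "orthogonal_below n Q" "degree P < n"
  shows "(\<integral>z. cnj (poly P z) * poly Q z \<partial>M) = 0"
proof -
  have "(\<integral>z. cnj (poly P z) * poly Q z \<partial>M)
    = (\<integral>z. (\<Sum>i\<le>degree P. cnj (coeff P i) * (cnj (z ^ i) * poly Q z)) \<partial>M)"
    by (simp add: poly_altdef sum_distrib_right mult.assoc)
  also have "\<dots> = (\<Sum>i\<le>degree P. (\<integral>z. cnj (coeff P i) * (cnj (z ^ i) * poly Q z) \<partial>M))"
    by (rule Bochner_Integration.integral_sum) (intro integrable_cont continuous_intros)
  also have "\<dots> = (\<Sum>i\<le>degree P. cnj (coeff P i) * (\<integral>z. cnj (z ^ i) * poly Q z \<partial>M))"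
    by (intro sum.cong refl) (rule integral_mult_right_zero)
  also have "\<dots> = 0" using assms by (intro sum.neutral) (auto simp: orthogonal_below_def)
  finally show ?thesis .
qed

end

text \<open>The recursion mentions no measure, so \<mu> and all its Bernstein--Szego approximations
  can be compared through the same polynomials.\<close>

primrec szego_pair :: "(nat \<Rightarrow> complex) \<Rightarrow> nat \<Rightarrow> complex poly \<times> complex poly" where
  "szego_pair a 0 = (1, 1)"
| "szego_pair a (Suc n) = (case szego_pair a n of (p, s) \<Rightarrow>
    (pCons 0 p - smult (cnj (a n)) s, s - smult (a n) (pCons 0 p)))"

definition szego_poly :: "(nat \<Rightarrow> complex) \<Rightarrow> nat \<Rightarrow> complex poly" where
  "szego_poly a n = fst (szego_pair a n)"

text \<open>The reversed polynomial \<open>\<Phi>\<^sub>n\<^sup>*(z) = z\<^sup>n cnj (\<Phi>\<^sub>n (1 / cnj z))\<close>, generated here by the recursion.\<close>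

definition szego_star :: "(nat \<Rightarrow> complex) \<Rightarrow> nat \<Rightarrow> complex poly" where
  "szego_star a n = snd (szego_pair a n)"

lemma szego_0 [simp]: "szego_poly a 0 = 1" "szego_star a 0 = 1"
  by (simp_all add: szego_poly_def szego_star_def)

lemma szego_poly_Suc: "szego_poly a (Suc n) = pCons 0 (szego_poly a n) - smult (cnj (a n)) (szego_star a n)"
  and szego_star_Suc: "szego_star a (Suc n) = szego_star a n - smult (a n) (pCons 0 (szego_poly a n))"
  by (simp_all add: szego_poly_def szego_star_def split: prod.split)

lemma poly_szego_Suc:
  "poly (szego_poly a (Suc n)) z = z * poly (szego_poly a n) z - cnj (a n) * poly (szego_star a n) z"
  "poly (szego_star a (Suc n)) z = poly (szego_star a n) z - a n * (z * poly (szego_poly a n) z)"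
  by (simp_all add: szego_poly_Suc szego_star_Suc)

lemma degree_szego: "degree (szego_poly a n) = n \<and> coeff (szego_poly a n) n = 1 \<and> degree (szego_star a n) \<le> n"
proof (induction n)
  case (Suc n)
  have p: "degree (pCons 0 (szego_poly a n)) = Suc n"
    using Suc by (subst degree_pCons_eq) auto
  have "degree (szego_poly a (Suc n)) \<le> Suc n" "degree (szego_star a (Suc n)) \<le> Suc n"
    unfolding szego_poly_Suc szego_star_Suc
    by (intro degree_diff_le order_trans[OF degree_smult_le]; use Suc p in simp)+
  moreover have "coeff (szego_poly a (Suc n)) (Suc n) = 1"
    unfolding szego_poly_Suc using Suc by (simp add: coeff_eq_0)
  ultimately show ?case
    by (metis le_antisym le_degree zero_neq_one)
qed simp

lemma szego_star_0 [simp]: "poly (szego_star a n) 0 = 1"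
  by (induction n) (simp_all add: poly_szego_Suc)

lemma szego_star_circle:
  assumes "cmod z = 1"
  shows "poly (szego_star a n) z = z ^ n * cnj (poly (szego_poly a n) z)"
proof (induction n)
  case (Suc n)
  have z: "z * cnj z = 1" using assms by (simp add: complex_norm_square[symmetric])
  then have zn: "z ^ n * cnj z ^ n = 1" by (simp flip: power_mult_distrib)
  have c: "cnj (poly (szego_star a n) z) = cnj z ^ n * poly (szego_poly a n) z"
    unfolding Suc by simp
  have r: "z * z ^ n * (cnj z * x - b * (cnj z ^ n * y)) = (z * cnj z) * z ^ n * x - b * z * (z ^ n * cnj z ^ n) * y"
    for x y b by (simp add: algebra_simps)
  show ?case
    unfolding poly_szego_Suc Suc complex_cnj_diff complex_cnj_mult complex_cnj_power complex_cnj_cnj power_Suc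
      r z zn by (simp add: mult.assoc)
qed simp

lemma cmod_szego_circle: "cmod z = 1 \<Longrightarrow> cmod (poly (szego_star a n) z) = cmod (poly (szego_poly a n) z)"
  by (simp add: szego_star_circle norm_mult norm_power)

context
  fixes a :: "nat \<Rightarrow> complex"
  assumes a1: "\<And>j. cmod (a j) < 1"
begin

text \<open>Induction on both claims at once. From \<open>|z \<Phi>| \<le> |\<Phi>^*|\<close> and
  \<open>|a n| < 1\<close> the next reversed polynomial has no zero, and the identity \<open>|s - b
  p|^2 - |p - cnj b * s|^2 = (1 - |b|^2) (|s|^2 - |p|^2)\<close> carries the comparison of moduli
  along.\<close>

lemma szego_star_disc:
  assumes "cmod z \<le> 1"
  shows "poly (szego_star a n) z \<noteq> 0 \<and> cmod (poly (szego_poly a n) z) \<le> cmod (poly (szego_star a n) z)"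
proof (induction n)
  case (Suc n)
  let ?p = "z * poly (szego_poly a n) z" and ?s = "poly (szego_star a n) z"
  have le: "cmod ?p \<le> cmod ?s"
    using mult_mono[OF assms conjunct2[OF Suc]] by (simp add: norm_mult)
  have "cmod (a n * ?p) < cmod ?s"
  proof -
    have "cmod (a n * ?p) \<le> cmod (a n) * cmod ?s"
      using le by (simp add: norm_mult mult_left_mono)
    also have "\<dots> < 1 * cmod ?s" using a1 Suc by (intro mult_strict_right_mono) auto
    finally show ?thesis by simp
  qed
  then have "poly (szego_star a (Suc n)) z \<noteq> 0" unfolding poly_szego_Suc by auto
  moreover have "(cmod (poly (szego_poly a (Suc n)) z))\<^sup>2 \<le> (cmod (poly (szego_star a (Suc n)) z))\<^sup>2"
  proof -
    have "(cmod (?s - a n * ?p))\<^sup>2 - (cmod (?p - cnj (a n) * ?s))\<^sup>2 = (1 - (cmod (a n))\<^sup>2) * ((cmod ?s)\<^sup>2 - (cmod ?p)\<^sup>2)"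
    proof -
      have "(cmod (s - b * p))\<^sup>2 - (cmod (p - cnj b * s))\<^sup>2 = (1 - (cmod b)\<^sup>2) * ((cmod s)\<^sup>2 - (cmod p)\<^sup>2)" for s p b
        unfolding cmod_power2 by (simp add: algebra_simps power2_eq_square)
      then show ?thesis .
    qed
    moreover have "\<dots> \<ge> 0"
      using a1[of n] le by (intro mult_nonneg_nonneg) (auto intro: power_mono simp: power_le_one)
    ultimately show ?thesis unfolding poly_szego_Suc by linarith
  qed
  ultimately show ?case by (auto intro: power2_le_imp_le)
qed simp

lemma szego_star_nonzero: "cmod z \<le> 1 \<Longrightarrow> poly (szego_star a n) z \<noteq> 0"
  using szego_star_disc by blast

lemma szego_poly_nonzero: "cmod z = 1 \<Longrightarrow> poly (szego_poly a n) z \<noteq> 0"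
  using szego_star_nonzero[of z n] cmod_szego_circle[of z a n] by auto

end

context circle_finite_measure
begin

text \<open>On the circle reversal exchanges the powers \<open>k\<close> and \<open>n - k\<close>.
  Orthogonality of \<open>\<Phi>_n\<close> to \<open>1, ..., z^(n-1)\<close> thus becomes
  orthogonality of the reversed polynomial to \<open>z, ..., z^n\<close>.\<close>

lemma integral_szego_star:
  assumes "k \<le> n"
  shows "(\<integral>z. cnj (z ^ k) * poly (szego_star a n) z \<partial>M) = cnj (\<integral>z. cnj (z ^ (n - k)) * poly (szego_poly a n) z \<partial>M)"
proof -
  have "(\<integral>z. cnj (z ^ k) * poly (szego_star a n) z \<partial>M) = (\<integral>z. cnj (cnj (z ^ (n - k)) * poly (szego_poly a n) z) \<partial>M)"
  proof (rule integral_cong_sphere_cont)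
    fix z :: complex assume z: "cmod z = 1"
    have "z ^ n = z ^ (n - k) * z ^ k" using assms by (simp flip: power_add)
    moreover have "cnj (z ^ k) * z ^ k = 1"
      using z by (simp add: mult.commute[of "cnj _"] complex_norm_square[symmetric] norm_power flip: power_mult_distrib complex_cnj_power)
    ultimately show "cnj (z ^ k) * poly (szego_star a n) z = cnj (cnj (z ^ (n - k)) * poly (szego_poly a n) z)"
      unfolding szego_star_circle[OF z] by (simp add: mult.left_commute mult.commute)
  qed (intro continuous_intros)+
  then show ?thesis unfolding Bochner_Integration.integral_cnj .
qed

text \<open>Pythagoras for \<open>z \<Phi>_n = \<Phi>_(n+1) + cnj (a n) \<Phi>_n^*\<close>: the
  reversed polynomial has degree at most \<open>n\<close>, so the two summands are orthogonal, and
  on the circle it has the modulus of \<open>\<Phi>_n\<close>.\<close>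

lemma orthogonal_szego_step_norm:
  assumes "orthogonal_below (Suc n) (szego_poly a (Suc n))"
  shows "(\<integral>z. (cmod (poly (szego_poly a (Suc n)) z))\<^sup>2 \<partial>M)
    = (1 - (cmod (a n))\<^sup>2) * (\<integral>z. (cmod (poly (szego_poly a n) z))\<^sup>2 \<partial>M)"
proof -
  let ?p = "\<lambda>z. poly (szego_poly a n) z" and ?s = "\<lambda>z. poly (szego_star a n) z"
    and ?q = "\<lambda>z. poly (szego_poly a (Suc n)) z"
  have 0: "(\<integral>z. cnj (?s z) * ?q z \<partial>M) = 0"
    by (rule orthogonal_below_degree[OF assms]) (use degree_szego[of a n] in simp)
  have i: "integrable M (\<lambda>z. cnj (?s z) * ?q z)"
    by (intro integrable_cont continuous_intros)
  have "(\<integral>z. (cmod (?p z))\<^sup>2 \<partial>M) = (\<integral>z. (cmod (?q z))\<^sup>2 + (cmod (a n))\<^sup>2 * (cmod (?p z))\<^sup>2 + 2 * Re (a n * (cnj (?s z) * ?q z)) \<partial>M)"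
  proof (rule integral_cong_sphere_cont)
    fix z :: complex assume z: "cmod z = 1"
    have "(cmod (?p z))\<^sup>2 = (cmod (z * ?p z))\<^sup>2" using z by (simp add: norm_mult)
    also have "z * ?p z = ?q z + cnj (a n) * ?s z" unfolding poly_szego_Suc by simp
    also have "(cmod (?q z + cnj (a n) * ?s z))\<^sup>2 = (cmod (?q z))\<^sup>2 + (cmod (a n))\<^sup>2 * (cmod (?s z))\<^sup>2 + 2 * Re (a n * (cnj (?s z) * ?q z))"
      unfolding cmod_power2 by (simp add: algebra_simps power2_eq_square)
    finally show "(cmod (?p z))\<^sup>2 = (cmod (?q z))\<^sup>2 + (cmod (a n))\<^sup>2 * (cmod (?p z))\<^sup>2 + 2 * Re (a n * (cnj (?s z) * ?q z))"
      unfolding cmod_szego_circle[OF z] .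
  qed (intro continuous_intros)+
  also have "\<dots> = (\<integral>z. (cmod (?q z))\<^sup>2 + (cmod (a n))\<^sup>2 * (cmod (?p z))\<^sup>2 \<partial>M) + (\<integral>z. 2 * Re (a n * (cnj (?s z) * ?q z)) \<partial>M)"
    by (rule Bochner_Integration.integral_add) (intro integrable_cont continuous_intros)+
  also have "(\<integral>z. (cmod (?q z))\<^sup>2 + (cmod (a n))\<^sup>2 * (cmod (?p z))\<^sup>2 \<partial>M) = (\<integral>z. (cmod (?q z))\<^sup>2 \<partial>M) + (\<integral>z. (cmod (a n))\<^sup>2 * (cmod (?p z))\<^sup>2 \<partial>M)"
    by (rule Bochner_Integration.integral_add) (intro integrable_cont continuous_intros)+
  also have "(\<integral>z. 2 * Re (a n * (cnj (?s z) * ?q z)) \<partial>M) = 0"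
    unfolding integral_mult_right_zero integral_Re[OF integrable_mult_right[OF i, of "a n"]] 0 by simp
  finally show ?thesis unfolding integral_mult_right_zero left_diff_distrib mult_1 by linarith
qed

text \<open>The recursion is inverted: \<open>(1 - |a n|^2) z \<Phi>_n = \<Phi>_(n+1) + cnj (a n)
  \<Phi>_(n+1)^*\<close>. Descent is what the Bernstein--Szego measure needs, since there
  orthogonality is computed directly only at the top index.\<close>

lemma orthogonal_szego_down:
  assumes a1: "cmod (a n) < 1" and orth: "orthogonal_below (Suc n) (szego_poly a (Suc n))"
  shows "orthogonal_below n (szego_poly a n)"
  unfolding orthogonal_below_def
proof (intro allI impI)
  fix k assume k: "k < n"
  let ?p = "\<lambda>z. poly (szego_poly a n) z" and ?s = "\<lambda>z. poly (szego_star a (Suc n)) z"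
    and ?q = "\<lambda>z. poly (szego_poly a (Suc n)) z"
  have r: "1 - a n * cnj (a n) \<noteq> 0"
  proof
    assume "1 - a n * cnj (a n) = 0"
    then have "complex_of_real ((cmod (a n))\<^sup>2) = 1" unfolding complex_norm_square by simp
    then have "(cmod (a n))\<^sup>2 = 1" using of_real_eq_1_iff by blast
    with a1 norm_ge_zero[of "a n"] show False unfolding power2_eq_1_iff by linarith
  qed
  have "(1 - a n * cnj (a n)) * (\<integral>z. cnj (z ^ k) * ?p z \<partial>M) = (\<integral>z. (1 - a n * cnj (a n)) * (cnj (z ^ k) * ?p z) \<partial>M)"
    by simp
  also have "\<dots> = (\<integral>z. cnj (z ^ Suc k) * ?q z + cnj (a n) * (cnj (z ^ Suc k) * ?s z) \<partial>M)"
  proof (rule integral_cong_sphere_cont)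
    fix z :: complex assume z: "cmod z = 1"
    have zz: "z * cnj z = 1" using z by (simp add: complex_norm_square[symmetric])
    have r': "cnj z * c * (z * p - b * s) + b * (cnj z * c * (s - d * (z * p))) = (z * cnj z) * ((1 - d * b) * (c * p))"
      for b c d p s by (simp add: algebra_simps)
    show "(1 - a n * cnj (a n)) * (cnj (z ^ k) * ?p z) = cnj (z ^ Suc k) * ?q z + cnj (a n) * (cnj (z ^ Suc k) * ?s z)"
      unfolding poly_szego_Suc complex_cnj_power complex_cnj_mult power_Suc r' zz by simp
  qed (intro continuous_intros)+
  also have "\<dots> = (\<integral>z. cnj (z ^ Suc k) * ?q z \<partial>M) + (\<integral>z. cnj (a n) * (cnj (z ^ Suc k) * ?s z) \<partial>M)"
    by (rule Bochner_Integration.integral_add) (intro integrable_cont continuous_intros)+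
  also have "(\<integral>z. cnj (a n) * (cnj (z ^ Suc k) * ?s z) \<partial>M) = cnj (a n) * cnj (\<integral>z. cnj (z ^ (Suc n - Suc k)) * ?q z \<partial>M)"
    using integral_szego_star[of "Suc k" "Suc n" a] k by simp
  also have "(\<integral>z. cnj (z ^ (Suc n - Suc k)) * ?q z \<partial>M) = 0"
    by (rule orth[unfolded orthogonal_below_def, rule_format]) (use k in simp)
  also have "(\<integral>z. cnj (z ^ Suc k) * ?q z \<partial>M) = 0"
    by (rule orth[unfolded orthogonal_below_def, rule_format]) (use k in simp)
  finally show "(\<integral>z. cnj (z ^ k) * ?p z \<partial>M) = 0" using r by simp
qed

lemma orthogonal_szego_le:
  assumes a1: "\<And>j. cmod (a j) < 1" and orth: "orthogonal_below n (szego_poly a n)" and "j \<le> n"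
  shows "orthogonal_below j (szego_poly a j)"
  using \<open>j \<le> n\<close>
proof (induction j rule: inc_induct)
  case base
  show ?case by (rule orth)
next
  case (step m)
  show ?case by (rule orthogonal_szego_down[OF a1 step.IH])
qed

lemma norm_szego_prod:
  assumes "\<And>j. j \<le> n \<Longrightarrow> orthogonal_below j (szego_poly a j)"
  shows "(\<integral>z. (cmod (poly (szego_poly a n) z))\<^sup>2 \<partial>M) = (\<Prod>i<n. 1 - (cmod (a i))\<^sup>2) * (\<integral>z. 1 \<partial>M)"
  using assms
proof (induction n)
  case (Suc n)
  then show ?case
    using orthogonal_szego_step_norm[of n a] by (simp add: mult.commute)
qed simp

end

text \<open>For \<open>j > 0\<close> the relation \<open>\<integral> \<Phi>_j = 0\<close> expresses
  the moment of order \<open>j\<close> through lower ones, with coefficients that are the same for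
  both measures.\<close>

lemma moments_eq:
  assumes "circle_finite_measure M1" "circle_finite_measure M2"
    and "(\<integral>z. 1 \<partial>M1) = (1::complex)" "(\<integral>z. 1 \<partial>M2) = (1::complex)"
    and o1: "\<And>j. j \<le> n \<Longrightarrow> circle_finite_measure.orthogonal_below M1 j (szego_poly a j)"
    and o2: "\<And>j. j \<le> n \<Longrightarrow> circle_finite_measure.orthogonal_below M2 j (szego_poly a j)"
    and "j \<le> n"
  shows "(\<integral>z. z ^ j \<partial>M1) = (\<integral>z. z ^ j \<partial>M2)"
  using \<open>j \<le> n\<close>
proof (induction j rule: less_induct)
  case (less j)
  interpret M1: circle_finite_measure M1 by fact
  interpret M2: circle_finite_measure M2 by fact
  show ?case
  proof (cases "j = 0")
    case True
    then show ?thesis using assms by simp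
  next
    case False
    have ex: "(\<integral>z. z ^ j \<partial>M) = - (\<Sum>i<j. coeff (szego_poly a j) i * (\<integral>z. z ^ i \<partial>M))"
      if M: "circle_finite_measure M" "circle_finite_measure.orthogonal_below M j (szego_poly a j)" for M
    proof -
      interpret circle_finite_measure M by fact
      have "0 = (\<integral>z. cnj (z ^ 0) * poly (szego_poly a j) z \<partial>M)"
        by (rule M(2)[unfolded orthogonal_below_def, rule_format, symmetric]) (use False in simp)
      also have "\<dots> = (\<integral>z. poly (szego_poly a j) z \<partial>M)" by simp
      finally have "0 = (\<integral>z. poly (szego_poly a j) z \<partial>M)" .
      also have "\<dots> = (\<integral>z. (\<Sum>i\<le>j. coeff (szego_poly a j) i * z ^ i) \<partial>M)"
      proof -
        have "poly (szego_poly a j) z = (\<Sum>i\<le>j. coeff (szego_poly a j) i * z ^ i)" for z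
          unfolding poly_altdef using degree_szego[of a j] by simp
        then show ?thesis by simp
      qed
      also have "\<dots> = (\<Sum>i\<le>j. (\<integral>z. coeff (szego_poly a j) i * z ^ i \<partial>M))"
        by (rule Bochner_Integration.integral_sum) (intro integrable_cont continuous_intros)
      also have "\<dots> = (\<Sum>i\<le>j. coeff (szego_poly a j) i * (\<integral>z. z ^ i \<partial>M))"
        by simp
      also have "\<dots> = (\<integral>z. z ^ j \<partial>M) + (\<Sum>i<j. coeff (szego_poly a j) i * (\<integral>z. z ^ i \<partial>M))"
        unfolding lessThan_Suc_atMost[symmetric] sum.lessThan_Suc using degree_szego[of a j] by simp
      finally show ?thesis by (metis eq_neg_iff_add_eq_0)
    qed
    have "(\<integral>z. z ^ i \<partial>M1) = (\<integral>z. z ^ i \<partial>M2)" if "i < j" for i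
      using less that by simp
    then show ?thesis
      unfolding ex[OF assms(1) o1[OF less.prems]] ex[OF assms(2) o2[OF less.prems]] by simp
  qed
qed

subsection \<open>Entropy of the Bernstein--Szego approximations\<close>

interpretation circle: circle_finite_measure circle_measure
proof -
  interpret prob_space circle_measure by (rule prob_space_circle_measure)
  show "circle_finite_measure circle_measure"
    by unfold_locales (use AE_circle_measure in auto)
qed

lemma circle_weight_measurable [measurable]: "circle_weight \<in> borel_measurable borel"
  unfolding circle_weight_def by measurable

lemma circle_weight_continuous [continuous_intros]: "continuous_on S circle_weight"
  unfolding circle_weight_def by (intro continuous_intros)

lemma poly_measurable [measurable]: "poly p \<in> borel_measurable (borel :: complex measure)"
  by (intro borel_measurable_continuous_onI continuous_intros)

text \<open>For \<open>|a j| < 1\<close> this is a finite Blaschke product, known as the inverse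
  Schur iterate; it lies in the disc algebra and is bounded by 1 on the closed disc.\<close>

definition schur_fn :: "(nat \<Rightarrow> complex) \<Rightarrow> nat \<Rightarrow> complex \<Rightarrow> complex" where
  "schur_fn a n z = poly (szego_poly a n) z / poly (szego_star a n) z"

lemma schur_fn_measurable [measurable]: "schur_fn a n \<in> borel_measurable borel"
  unfolding schur_fn_def by measurable

text \<open>The prefix \<open>bs\<close> refers to the Bernstein--Szego measure with coefficients \<open>\<alpha>\<^sub>0, \<dots>, \<alpha>\<^sub>n\<^sub>-\<^sub>1, 0, 0, \<dots>\<close>;
  on the circle \<open>|\<Phi>\<^sub>n| = |\<Phi>\<^sub>n\<^sup>*|\<close>, and \<open>\<Phi>\<^sub>n\<^sup>*\<close> has no zero in the closed disc.\<close>

definition verblunsky_prod :: "(nat \<Rightarrow> complex) \<Rightarrow> nat \<Rightarrow> real" where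
  "verblunsky_prod a n = (\<Prod>i<n. 1 - (cmod (a i))\<^sup>2)"

definition bs_density :: "(nat \<Rightarrow> complex) \<Rightarrow> nat \<Rightarrow> complex \<Rightarrow> real" where
  "bs_density a n z = verblunsky_prod a n / (cmod (poly (szego_star a n) z))\<^sup>2"

definition bs_entropy :: "(nat \<Rightarrow> complex) \<Rightarrow> nat \<Rightarrow> real" where
  "bs_entropy a n = (\<integral>z. circle_weight z * ln (bs_density a n z) \<partial>circle_measure)"

lemma bs_density_measurable [measurable]: "bs_density a n \<in> borel_measurable borel"
  unfolding bs_density_def by measurable

lemma cnj_measurable [measurable]: "cnj \<in> borel_measurable borel"
  by (intro borel_measurable_continuous_onI continuous_intros)

context
  fixes a :: "nat \<Rightarrow> complex"
  assumes a1: "\<And>j. cmod (a j) < 1"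
begin

lemma schur_fn_disc_algebra: "schur_fn a n \<in> disc_algebra"
  unfolding schur_fn_def
  by (intro disc_algebra_divide disc_algebra_poly) (rule szego_star_nonzero[OF a1])

lemma schur_fn_le_1: "cmod z \<le> 1 \<Longrightarrow> cmod (schur_fn a n z) \<le> 1"
  using szego_star_disc[OF a1, where z=z and n=n] unfolding schur_fn_def by (simp add: norm_divide divide_le_eq)

lemma schur_fn_lt_1:
  assumes "cmod z \<le> 1"
  shows "cmod (z * (a m * schur_fn a n z)) < 1"
proof -
  have "cmod (z * schur_fn a n z) \<le> 1"
    using mult_mono[OF assms schur_fn_le_1[OF assms]] by (simp add: norm_mult)
  then have "cmod (a m) * cmod (z * schur_fn a n z) \<le> cmod (a m)"
    by (intro mult_left_le) auto
  then show ?thesis using a1[of m] by (simp add: norm_mult mult.left_commute)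
qed

lemma szego_star_Suc_schur:
  assumes "cmod z \<le> 1"
  shows "poly (szego_star a (Suc n)) z = poly (szego_star a n) z * (1 - z * (a n * schur_fn a n z))"
  using szego_star_nonzero[OF a1 assms, where n=n] unfolding poly_szego_Suc schur_fn_def
  by (simp add: field_simps)

lemma schur_fn_Suc:
  assumes "cmod z \<le> 1"
  shows "schur_fn a (Suc n) z * (1 - z * (a n * schur_fn a n z)) = z * schur_fn a n z - cnj (a n)"
    "1 - z * (a n * schur_fn a n z) \<noteq> 0"
proof -
  show n: "1 - z * (a n * schur_fn a n z) \<noteq> 0"
    using schur_fn_lt_1[OF assms, of n n] by auto
  have nz: "poly (szego_star a n) z \<noteq> 0" using szego_star_nonzero[OF a1 assms] .
  have "schur_fn a (Suc n) z = poly (szego_poly a (Suc n)) z / (poly (szego_star a n) z * (1 - z * (a n * schur_fn a n z)))"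
    unfolding schur_fn_def[of a "Suc n"] szego_star_Suc_schur[OF assms] ..
  then have "schur_fn a (Suc n) z * (1 - z * (a n * schur_fn a n z)) = poly (szego_poly a (Suc n)) z / poly (szego_star a n) z"
    using n nz by simp
  also have "\<dots> = z * schur_fn a n z - cnj (a n)"
    unfolding poly_szego_Suc schur_fn_def using nz by (simp add: field_simps)
  finally show "schur_fn a (Suc n) z * (1 - z * (a n * schur_fn a n z)) = z * schur_fn a n z - cnj (a n)" .
qed

text \<open>Solving the recursion for the next function gives \<open>b_(n+1) = - cnj (a n) + z (1 -
  |a n|^2) b_n / (1 - z a_n b_n)\<close>. Every step back along the sequence gains a factor
  \<open>z\<close>, so three steps determine the expansion through order 2, with a remainder still
  in the disc algebra.\<close>

lemma schur_fn_jet: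
  obtains h where "h \<in> disc_algebra"
    "\<And>z. cmod z \<le> 1 \<Longrightarrow> schur_fn a (Suc (Suc (Suc j))) z =
       - cnj (a (Suc (Suc j))) + - (1 - a (Suc (Suc j)) * cnj (a (Suc (Suc j)))) * cnj (a (Suc j)) * z
       + ((1 - a (Suc (Suc j)) * cnj (a (Suc (Suc j)))) * (a (Suc (Suc j)) * (cnj (a (Suc j)))\<^sup>2
            - (1 - a (Suc j) * cnj (a (Suc j))) * cnj (a j))) * z\<^sup>2
       + z ^ 3 * h z"
proof -
  define b where "b n = schur_fn a (n + j)" for n
  define x where "x n = a (n + j)" for n
  define r where "r n = 1 - x n * cnj (x n)" for n
  define q where "q n z = 1 / (1 - z * (x n * b n z))" for n z
  have b: "b n \<in> disc_algebra" for n unfolding b_def by (rule schur_fn_disc_algebra)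
  have q: "q n \<in> disc_algebra" for n
    unfolding q_def using schur_fn_Suc(2) by (intro disc_algebra_divide disc_intros b) (auto simp: b_def x_def)
  have D: "(1 - z * (x n * b n z)) * q n z = 1" if "cmod z \<le> 1" for n z
    unfolding q_def using schur_fn_Suc(2)[OF that, of "n + j"] by (simp add: b_def x_def)
  have R: "b (Suc n) z * (1 - z * (x n * b n z)) = z * b n z - cnj (x n)" if "cmod z \<le> 1" for n z
    using schur_fn_Suc(1)[OF that, of "n + j"] by (simp add: b_def x_def)
  have e1: "b (Suc n) z = - cnj (x n) + z * (r n * b n z * q n z)" if "cmod z \<le> 1" for n z
    using D[OF that, of n] R[OF that, of n] unfolding r_def by algebra
  have e2: "q n z = 1 + z * (x n * b n z * q n z)" if "cmod z \<le> 1" for n z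
    using D[OF that, of n] by algebra
  define g1 where "g1 z = r 0 * b 0 z * q 0 z" for z
  define s where "s z = r 1 * b 1 z * q 1 z" for z
  define h where "h z = r 2 * r 1 * g1 z + r 2 * (r 1 * (b 1 z * (x 1 * b 1 z * q 1 z)))
     + r 2 * (x 2 * (- 2 * cnj (x 1) * s z + z * (s z)\<^sup>2)) + r 2 * (x 2 * (b 2 z)\<^sup>2 * (x 2 * b 2 z * q 2 z))" for z
  have h: "h \<in> disc_algebra"
    unfolding h_def g1_def s_def by (intro disc_intros b q)
  show thesis
  proof (rule that[OF h])
    fix z :: complex assume z: "cmod z \<le> 1"
    have 1: "b 1 z = - cnj (x 0) + z * g1 z"
      using e1[OF z, of 0] by (simp add: g1_def)
    have 2: "b 2 z = - cnj (x 1) + z * s z"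
      using e1[OF z, of 1] by (simp add: s_def numeral_2_eq_2)
    have s: "s z = r 1 * (b 1 z + z * (b 1 z * (x 1 * b 1 z * q 1 z)))"
      unfolding s_def using e2[OF z, of 1] by algebra
    have 3: "b 3 z = - cnj (x 2) + z * (r 2 * b 2 z * q 2 z)"
      using e1[OF z, of 2] by (simp add: numeral_3_eq_3 numeral_2_eq_2)
    have q2: "b 2 z * q 2 z = b 2 z + z * (x 2 * (b 2 z)\<^sup>2) + z\<^sup>2 * (x 2 * (b 2 z)\<^sup>2 * (x 2 * b 2 z * q 2 z))"
      using e2[OF z, of 2] by algebra
    have "b 3 z = - cnj (x 2) + - r 2 * cnj (x 1) * z + (r 2 * (x 2 * (cnj (x 1))\<^sup>2 - r 1 * cnj (x 0))) * z\<^sup>2 + z ^ 3 * h z"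
    proof -
      have "b 3 z = - cnj (x 2) + z * r 2 * (b 2 z + z * (x 2 * (b 2 z)\<^sup>2) + z\<^sup>2 * (x 2 * (b 2 z)\<^sup>2 * (x 2 * b 2 z * q 2 z)))"
        unfolding 3 using q2 by algebra
      moreover have "b 2 z = - cnj (x 1) + z * r 1 * (- cnj (x 0) + z * g1 z + z * (b 1 z * (x 1 * b 1 z * q 1 z)))"
        using 2 s 1 by algebra
      ultimately show ?thesis
        unfolding h_def using 2 by algebra
    qed
    then show "schur_fn a (Suc (Suc (Suc j))) z =
       - cnj (a (Suc (Suc j))) + - (1 - a (Suc (Suc j)) * cnj (a (Suc (Suc j)))) * cnj (a (Suc j)) * z
       + ((1 - a (Suc (Suc j)) * cnj (a (Suc (Suc j)))) * (a (Suc (Suc j)) * (cnj (a (Suc j)))\<^sup>2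
            - (1 - a (Suc j) * cnj (a (Suc j))) * cnj (a j))) * z\<^sup>2
       + z ^ 3 * h z"
      by (simp add: b_def x_def r_def numeral_3_eq_3 numeral_2_eq_2)
  qed
qed

lemma weighted_log_mean_schur:
  fixes j :: nat
  defines "f \<equiv> \<lambda>z. circle_weight z * ln ((cmod (1 - z * (a (j + 3) * schur_fn a (j + 3) z)))\<^sup>2)"
  shows "integrable circle_measure f"
    "integral\<^sup>L circle_measure f = ln (1 - (cmod (a (j + 3)))\<^sup>2) / 2 - szego_term a j"
proof -
  define x0 x1 x2 x3 where x: "x0 = a j" "x1 = a (Suc j)" "x2 = a (Suc (Suc j))" "x3 = a (Suc (Suc (Suc j)))"
  obtain h where h: "h \<in> disc_algebra" "\<And>z. cmod z \<le> 1 \<Longrightarrow> schur_fn a (Suc (Suc (Suc j))) z =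
       - cnj x2 + - (1 - x2 * cnj x2) * cnj x1 * z
       + ((1 - x2 * cnj x2) * (x2 * (cnj x1)\<^sup>2 - (1 - x1 * cnj x1) * cnj x0)) * z\<^sup>2 + z ^ 3 * h z"
    using schur_fn_jet[of j] unfolding x by blast
  have j3: "j + 3 = Suc (Suc (Suc j))" by simp
  let ?v = "\<lambda>z. x3 * schur_fn a (Suc (Suc (Suc j))) z"
  have v: "?v \<in> disc_algebra" by (intro disc_intros schur_fn_disc_algebra)
  have h': "(\<lambda>z. x3 * h z) \<in> disc_algebra" by (intro disc_intros h)
  have vm: "?v \<in> borel_measurable borel" by measurable
  have lt: "cmod (z * ?v z) < 1" if "cmod z \<le> 1" for z
    unfolding x by (rule schur_fn_lt_1[OF that])
  have jet: "?v z = - x3 * cnj x2 + (- x3 * (1 - x2 * cnj x2) * cnj x1) * z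
     + (x3 * ((1 - x2 * cnj x2) * (x2 * (cnj x1)\<^sup>2 - (1 - x1 * cnj x1) * cnj x0))) * z\<^sup>2 + z ^ 3 * (x3 * h z)"
    if "cmod z \<le> 1" for z
    unfolding h(2)[OF that] by (simp add: algebra_simps)
  note w = weighted_log_mean[OF v h' vm lt jet]
  have f: "f = (\<lambda>z. circle_weight z * ln ((cmod (1 - z * ?v z))\<^sup>2))"
    unfolding f_def x j3 ..
  show "integrable circle_measure f"
    unfolding f by (rule w(1))
  have c1: "- (- x3 * cnj x2) = x3 * cnj x2" by simp
  have c2: "- (- x3 * (1 - x2 * cnj x2) * cnj x1) - (- x3 * cnj x2)\<^sup>2 / 2
    = (1 - x2 * cnj x2) * x3 * cnj x1 - x3\<^sup>2 * (cnj x2)\<^sup>2 / 2"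
    by (simp add: power_mult_distrib algebra_simps)
  have c3: "- (x3 * ((1 - x2 * cnj x2) * (x2 * (cnj x1)\<^sup>2 - (1 - x1 * cnj x1) * cnj x0)))
       - (- x3 * cnj x2) * (- x3 * (1 - x2 * cnj x2) * cnj x1) - (- x3 * cnj x2) ^ 3 / 3
    = (1 - x2 * cnj x2) * (1 - x1 * cnj x1) * x3 * cnj x0 - (1 - x2 * cnj x2) * x3 * x2 * (cnj x1)\<^sup>2
      - (1 - x2 * cnj x2) * x3\<^sup>2 * cnj x2 * cnj x1 + x3 ^ 3 * cnj x2 ^ 3 / 3"
    by (simp add: field_simps power2_eq_square power3_eq_cube)
  have n: "1 - y * cnj y = complex_of_real (1 - (cmod y)\<^sup>2)" for y
    unfolding of_real_diff complex_norm_square by simp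
  show "integral\<^sup>L circle_measure f = ln (1 - (cmod (a (j + 3)))\<^sup>2) / 2 - szego_term a j"
  proof -
    have e: "integral\<^sup>L circle_measure f = Re (- (- (- x3 * cnj x2)) / 4
        - (- (- x3 * (1 - x2 * cnj x2) * cnj x1) - (- x3 * cnj x2)\<^sup>2 / 2) / 2
        + (- (x3 * ((1 - x2 * cnj x2) * (x2 * (cnj x1)\<^sup>2 - (1 - x1 * cnj x1) * cnj x0)))
           - (- x3 * cnj x2) * (- x3 * (1 - x2 * cnj x2) * cnj x1) - (- x3 * cnj x2) ^ 3 / 3) / 4)"
      unfolding f by (rule w(2))
    have lin: "Re (- C1 / 4 - C2 / 2 + C3 / 4) = - Re C1 / 4 - Re C2 / 2 + Re C3 / 4" for C1 C2 C3 by simp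
    show ?thesis
      unfolding e unfolding c1 c2 c3 unfolding n lin szego_term_def Let_def x j3 add_2_eq_Suc' Suc_eq_plus1[symmetric]
      by linarith
  qed
qed

lemma verblunsky_prod_pos: "0 < verblunsky_prod a n"
  unfolding verblunsky_prod_def
  by (intro prod_pos) (use a1 in \<open>auto simp: abs_square_less_1\<close>)

lemma bs_density_pos: "cmod z = 1 \<Longrightarrow> 0 < bs_density a n z"
  unfolding bs_density_def using verblunsky_prod_pos szego_star_nonzero[OF a1, where z=z and n=n] by simp

lemma bs_density_nonneg: "0 \<le> bs_density a n z"
  unfolding bs_density_def using verblunsky_prod_pos[of n] by simp

lemma bs_density_continuous: "continuous_on (sphere 0 1) (bs_density a n)"
  unfolding bs_density_def using szego_star_nonzero[OF a1] by (intro continuous_intros) auto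

lemma integrable_bs_entropy: "integrable circle_measure (\<lambda>z. circle_weight z * ln (bs_density a n z))"
  by (intro circle.integrable_continuous continuous_intros bs_density_continuous)
    (use bs_density_pos[of _ n] in \<open>auto simp: less_imp_neq[symmetric] intro!: measurable\<close>)

lemma circle_weight_mean: "integral\<^sup>L circle_measure circle_weight = 1 / 2"
proof -
  let ?F = "\<lambda>z::complex. 1 / 2 - z / 4 - z\<^sup>2 / 2 + z ^ 3 / 4"
  have "?F \<in> disc_algebra" unfolding divide_inverse by (intro disc_intros)
  moreover have "circle_weight z = Re (?F z)" if "z \<in> sphere 0 1" for z
  proof -
    have "cmod z = 1" using that by simp
    from arg_cong[OF circle_weight_eq_poly[OF this], of Re] show ?thesis
      by (simp flip: complex_cnj_power)
  qed
  ultimately show ?thesis using disc_algebra_mean_Re(2)[of ?F circle_weight] by simp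
qed

text \<open>Adding the coefficient with index \<open>n = j + 3\<close> multiplies the density by
  \<open>(1 - |a n|^2) / |1 - z a_n b_n|^2\<close>. The offset 3 guarantees the three predecessors
  that enter the expansion of \<open>b_n\<close>; the mean 1/2 of the weight gives the half in front
  of the logarithm.\<close>

lemma bs_entropy_Suc: "bs_entropy a (Suc (j + 3)) = bs_entropy a (j + 3) + szego_term a j"
proof -
  let ?n = "j + 3"
  let ?g = "\<lambda>z. circle_weight z * ln ((cmod (1 - z * (a ?n * schur_fn a ?n z)))\<^sup>2)"
  let ?c = "ln (1 - (cmod (a ?n))\<^sup>2)"
  have w: "integrable circle_measure circle_weight"
    by (intro circle.integrable_cont continuous_intros)
  have pos: "0 < 1 - (cmod (a ?n))\<^sup>2" using a1[of ?n] by (simp add: abs_square_less_1)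
  have "bs_entropy a (Suc ?n) = (\<integral>z. circle_weight z * ln (bs_density a ?n z) + ?c * circle_weight z - ?g z \<partial>circle_measure)"
    unfolding bs_entropy_def
  proof (rule circle.integral_cong_sphere)
    fix z :: complex assume z: "cmod z = 1"
    have p: "0 < (cmod (1 - z * (a ?n * schur_fn a ?n z)))\<^sup>2" 
      using schur_fn_Suc(2)[of z ?n] z by simp
    have "bs_density a (Suc n) z = bs_density a n z * (1 - (cmod (a n))\<^sup>2) / (cmod (1 - z * (a n * schur_fn a n z)))\<^sup>2" for n
      using szego_star_Suc_schur[of z n] z
      by (simp add: bs_density_def verblunsky_prod_def norm_mult power_mult_distrib)
    from this[of ?n] have L: "ln (bs_density a (Suc ?n) z) = ln (bs_density a ?n z) + ?c - ln ((cmod (1 - z * (a ?n * schur_fn a ?n z)))\<^sup>2)"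
      using p pos bs_density_pos[OF z, of ?n] by (simp add: ln_div ln_mult del: add_Suc_right)
    show "circle_weight z * ln (bs_density a (Suc ?n) z) = circle_weight z * ln (bs_density a ?n z) + ?c * circle_weight z - ?g z"
      unfolding L by algebra
  qed measurable
  also have "\<dots> = (\<integral>z. circle_weight z * ln (bs_density a ?n z) + ?c * circle_weight z \<partial>circle_measure) - integral\<^sup>L circle_measure ?g"
    by (intro Bochner_Integration.integral_diff Bochner_Integration.integrable_add integrable_bs_entropy
      integrable_mult_right w weighted_log_mean_schur)
  also have "(\<integral>z. circle_weight z * ln (bs_density a ?n z) + ?c * circle_weight z \<partial>circle_measure)
      = bs_entropy a ?n + (\<integral>z. ?c * circle_weight z \<partial>circle_measure)"
    unfolding bs_entropy_def
    by (intro Bochner_Integration.integral_add integrable_bs_entropy integrable_mult_right w)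
  also have "(\<integral>z. ?c * circle_weight z \<partial>circle_measure) = ?c / 2"
    unfolding integral_mult_right_zero circle_weight_mean by simp
  finally show ?thesis unfolding weighted_log_mean_schur(2) by simp
qed

lemma bs_entropy_sum: "bs_entropy a (n + 3) = bs_entropy a 3 + (\<Sum>j<n. szego_term a j)"
  by (induction n) (use bs_entropy_Suc in auto)

end

subsection \<open>Weak convergence of the Bernstein--Szego approximations\<close>

definition bs_measure :: "(nat \<Rightarrow> complex) \<Rightarrow> nat \<Rightarrow> complex measure" where
  "bs_measure a n = density circle_measure (\<lambda>z. ennreal (bs_density a n z))"

context
  fixes a :: "nat \<Rightarrow> complex"
  assumes a1: "\<And>j. cmod (a j) < 1"
begin

lemma bs_measure_integral:
  fixes f :: "complex \<Rightarrow> 'b :: {banach, second_countable_topology}"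
  assumes "f \<in> borel_measurable borel"
  shows "integral\<^sup>L (bs_measure a n) f = (\<integral>z. bs_density a n z *\<^sub>R f z \<partial>circle_measure)"
  unfolding bs_measure_def using assms
  by (intro integral_density) (auto simp: bs_density_nonneg[OF a1])

lemma circle_finite_measure_bs: "circle_finite_measure (bs_measure a n)"
proof -
  have "integrable circle_measure (bs_density a n)"
    by (intro circle.integrable_continuous bs_density_continuous[OF a1] bs_density_measurable)
  then have "emeasure (bs_measure a n) (space (bs_measure a n)) \<noteq> \<infinity>"
    unfolding bs_measure_def
    by (simp add: emeasure_density nn_integral_eq_integral bs_density_nonneg[OF a1])
  then interpret finite_measure "bs_measure a n" by (rule finite_measureI)
  show ?thesis
  proof
    show "AE z in bs_measure a n. z \<in> sphere 0 1"
      unfolding bs_measure_def using AE_circle_measure by (subst AE_density) auto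
  qed (simp add: bs_measure_def)
qed

lemma bs_orthogonal: "circle_finite_measure.orthogonal_below (bs_measure a n) n (szego_poly a n)"
proof -
  interpret circle_finite_measure "bs_measure a n" by (rule circle_finite_measure_bs)
  show ?thesis
    unfolding orthogonal_below_def
  proof (intro allI impI)
    fix k assume k: "k < n"
    let ?F = "\<lambda>z. of_real (verblunsky_prod a n) * z ^ (n - k) / poly (szego_star a n) z"
    have F: "?F \<in> disc_algebra"
      by (intro disc_algebra_divide disc_intros szego_star_nonzero[OF a1])
    have eq: "bs_density a n z *\<^sub>R (cnj (z ^ k) * poly (szego_poly a n) z) = ?F z" if "z \<in> sphere 0 1" for z
    proof -
      have z: "cmod z = 1" using that by simp
      have zz: "cnj z * z = 1" using z by (simp add: mult.commute complex_norm_square[symmetric])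
      let ?s = "poly (szego_star a n) z" and ?p = "poly (szego_poly a n) z"
      have s0: "?s \<noteq> 0" using szego_star_nonzero[OF a1, where z=z and n=n] z by simp
      have zk: "cnj z ^ k * z ^ n = z ^ (n - k)"
      proof -
        have "cnj z ^ k * z ^ n = (cnj z * z) ^ k * z ^ (n - k)"
          using k by (simp add: power_mult_distrib mult.assoc flip: power_add)
        then show ?thesis using zz by simp
      qed
      have zn: "cnj z ^ n * z ^ n = 1" using zz by (simp flip: power_mult_distrib)
      have "z ^ n * cnj ?s = z ^ n * (cnj z ^ n * ?p)"
        unfolding szego_star_circle[OF z] by simp
      also have "\<dots> = ?p" using zn by (simp add: mult.assoc[symmetric] mult.commute[of "z ^ n"])
      finally have p: "?p = z ^ n * cnj ?s" ..
      have "bs_density a n z *\<^sub>R (cnj (z ^ k) * ?p) = of_real (verblunsky_prod a n) / (?s * cnj ?s) * (cnj z ^ k * z ^ n * cnj ?s)"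
        unfolding bs_density_def scaleR_conv_of_real of_real_divide complex_norm_square p
        by (simp add: mult.assoc)
      also have "\<dots> = ?F z" unfolding zk using s0 by (simp add: field_simps)
      finally show ?thesis .
    qed
    have "(\<integral>z. cnj (z ^ k) * poly (szego_poly a n) z \<partial>bs_measure a n)
      = (\<integral>z. bs_density a n z *\<^sub>R (cnj (z ^ k) * poly (szego_poly a n) z) \<partial>circle_measure)"
      by (intro bs_measure_integral) measurable
    also have "\<dots> = ?F 0"
      by (rule disc_algebra_mean(2)[OF F _ eq]) measurable
    also have "\<dots> = 0" using k by simp
    finally show "(\<integral>z. cnj (z ^ k) * poly (szego_poly a n) z \<partial>bs_measure a n) = 0" .
  qed
qed

lemma bs_orthogonal_le: "j \<le> n \<Longrightarrow> circle_finite_measure.orthogonal_below (bs_measure a n) j (szego_poly a j)"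
  by (rule circle_finite_measure.orthogonal_szego_le[OF circle_finite_measure_bs a1 bs_orthogonal])

text \<open>The squared norm of \<open>\<Phi>_n\<close> is computed twice: its product with the
  density is the constant \<open>verblunsky_prod a n\<close>, while the orthogonality relations give
  this constant times the total mass.\<close>

lemma bs_measure_total: "(\<integral>z. 1 \<partial>bs_measure a n) = (1 :: real)"
proof -
  interpret circle_finite_measure "bs_measure a n" by (rule circle_finite_measure_bs)
  have "verblunsky_prod a n * (\<integral>z. 1 \<partial>bs_measure a n) = (\<integral>z. (cmod (poly (szego_poly a n) z))\<^sup>2 \<partial>bs_measure a n)"
    unfolding verblunsky_prod_def by (rule norm_szego_prod[symmetric]) (rule bs_orthogonal_le)
  also have "\<dots> = (\<integral>z. bs_density a n z *\<^sub>R (cmod (poly (szego_poly a n) z))\<^sup>2 \<partial>circle_measure)"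
    by (intro bs_measure_integral) measurable
  also have "\<dots> = (\<integral>z. verblunsky_prod a n \<partial>circle_measure)"
  proof (rule circle.integral_cong_sphere)
    fix z :: complex assume z: "cmod z = 1"
    show "bs_density a n z *\<^sub>R (cmod (poly (szego_poly a n) z))\<^sup>2 = verblunsky_prod a n"
      using szego_poly_nonzero[OF a1 z, where n=n] unfolding bs_density_def cmod_szego_circle[OF z] by simp
  qed measurable
  also have "\<dots> = verblunsky_prod a n"
    using prob_space.prob_space[OF prob_space_circle_measure] by simp
  finally show ?thesis using verblunsky_prod_pos[of a n, OF a1] by simp
qed

end

section \<open>Trigonometric polynomials and moments\<close>

definition trig_poly :: "(complex \<Rightarrow> complex) \<Rightarrow> bool" where
  "trig_poly f \<longleftrightarrow> (\<exists>K P. \<forall>z. cmod z = 1 \<longrightarrow> f z = cnj z ^ K * poly P z)"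

lemma trig_poly_add:
  assumes "trig_poly f" "trig_poly g"
  shows "trig_poly (\<lambda>z. f z + g z)"
proof -
  obtain K P L Q where f: "\<And>z. cmod z = 1 \<Longrightarrow> f z = cnj z ^ K * poly P z"
    and g: "\<And>z. cmod z = 1 \<Longrightarrow> g z = cnj z ^ L * poly Q z"
    using assms unfolding trig_poly_def by metis
  have "f z + g z = cnj z ^ (K + L) * poly (monom 1 L * P + monom 1 K * Q) z" if z: "cmod z = 1" for z
  proof -
    have "cnj z ^ m * z ^ m = 1" for m
      using z by (simp add: mult.commute[of "cnj z"] complex_norm_square[symmetric] flip: power_mult_distrib)
    then have "cnj z ^ (K + L) * poly (monom 1 L * P + monom 1 K * Q) z
       = cnj z ^ K * poly P z * (cnj z ^ L * z ^ L) + cnj z ^ L * poly Q z * (cnj z ^ K * z ^ K)"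
      by (simp add: poly_monom power_add algebra_simps)
    also have "\<dots> = f z + g z" using f[OF z] g[OF z] \<open>\<And>m. cnj z ^ m * z ^ m = 1\<close> by simp
    finally show ?thesis ..
  qed
  then show ?thesis unfolding trig_poly_def by blast
qed

lemma trig_poly_mult:
  assumes "trig_poly f" "trig_poly g"
  shows "trig_poly (\<lambda>z. f z * g z)"
proof -
  obtain K P L Q where f: "\<And>z. cmod z = 1 \<Longrightarrow> f z = cnj z ^ K * poly P z"
    and g: "\<And>z. cmod z = 1 \<Longrightarrow> g z = cnj z ^ L * poly Q z"
    using assms unfolding trig_poly_def by metis
  have "f z * g z = cnj z ^ (K + L) * poly (P * Q) z" if z: "cmod z = 1" for z
    unfolding f[OF z] g[OF z] by (simp add: power_add)
  then show ?thesis unfolding trig_poly_def by blast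
qed

lemma trig_poly_const: "trig_poly (\<lambda>z. c)"
  unfolding trig_poly_def by (intro exI[of _ 0] exI[of _ "[:c:]"]) simp

lemma trig_poly_ident: "trig_poly (\<lambda>z. z)"
  unfolding trig_poly_def by (intro exI[of _ 0] exI[of _ "[:0, 1:]"]) simp

lemma trig_poly_cnj: "trig_poly cnj"
  unfolding trig_poly_def by (intro exI[of _ 1] exI[of _ 1]) simp

lemma trig_poly_real_polynomial_function:
  assumes "real_polynomial_function f"
  shows "trig_poly (\<lambda>z. of_real (f z))"
  using assms
proof (induction f rule: real_polynomial_function.induct)
  case (linear f)
  interpret bounded_linear f by (rule linear)
  have "complex_of_real (f z) = (of_real (f 1) / 2 - \<i> * of_real (f \<i>) / 2) * z + (of_real (f 1) / 2 + \<i> * of_real (f \<i>) / 2) * cnj z" for z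
  proof -
    have "z = Re z *\<^sub>R 1 + Im z *\<^sub>R \<i>" by (simp add: complex_eq_iff)
    then have "f z = Re z * f 1 + Im z * f \<i>" by (metis add scaleR real_scaleR_def)
    then show ?thesis by (simp add: complex_eq_iff algebra_simps)
  qed
  then have eq: "(\<lambda>z. complex_of_real (f z)) = (\<lambda>z. (of_real (f 1) / 2 - \<i> * of_real (f \<i>) / 2) * z + (of_real (f 1) / 2 + \<i> * of_real (f \<i>) / 2) * cnj z)"
    by (rule ext)
  show ?case
    by (subst eq) (intro trig_poly_add trig_poly_mult trig_poly_const trig_poly_ident trig_poly_cnj)
next
  case (const c)
  show ?case by (rule trig_poly_const)
next
  case (add f g)
  then show ?case using trig_poly_add by simp
next
  case (mult f g)
  then show ?case using trig_poly_mult by simp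
qed

text \<open>Moments of negative order are conjugates of moments of positive order. The bound
  \<open>n\<close> depends on \<open>f\<close> alone and so serves all pairs of measures.\<close>

lemma trig_poly_integral_eq:
  assumes "trig_poly f" "f \<in> borel_measurable borel"
  obtains n where "\<And>M1 M2. circle_finite_measure M1 \<Longrightarrow> circle_finite_measure M2 \<Longrightarrow>
    (\<And>j. j \<le> n \<Longrightarrow> (\<integral>z. z ^ j \<partial>M1) = (\<integral>z. z ^ j \<partial>M2)) \<Longrightarrow> integral\<^sup>L M1 f = integral\<^sup>L M2 f"
proof -
  obtain K P where f: "\<And>z. cmod z = 1 \<Longrightarrow> f z = cnj z ^ K * poly P z"
    using assms unfolding trig_poly_def by metis
  have ex: "integral\<^sup>L M f = (\<Sum>i\<le>degree P. coeff P i *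
      (if i \<le> K then cnj (\<integral>z. z ^ (K - i) \<partial>M) else (\<integral>z. z ^ (i - K) \<partial>M)))"
    if "circle_finite_measure M" for M
  proof -
    interpret circle_finite_measure M by fact
    have m: "(\<integral>z. cnj z ^ K * z ^ i \<partial>M) = (if i \<le> K then cnj (\<integral>z. z ^ (K - i) \<partial>M) else (\<integral>z. z ^ (i - K) \<partial>M))" for i
    proof -
      have one: "cnj z ^ m * z ^ m = 1" if "cmod z = 1" for z m
        using that by (simp add: mult.commute[of "cnj z"] complex_norm_square[symmetric] flip: power_mult_distrib)
      show ?thesis
      proof (cases "i \<le> K")
        case True
        have "(\<integral>z. cnj z ^ K * z ^ i \<partial>M) = (\<integral>z. cnj (z ^ (K - i)) \<partial>M)"
        proof (rule integral_cong_sphere_cont)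
          fix z :: complex assume z: "cmod z = 1"
          have "cnj z ^ K = cnj z ^ (K - i) * cnj z ^ i" using True by (simp flip: power_add)
          then show "cnj z ^ K * z ^ i = cnj (z ^ (K - i))" using one[OF z, of i] by (simp add: mult.assoc)
        qed (intro continuous_intros)+
        then show ?thesis using True unfolding Bochner_Integration.integral_cnj by simp
      next
        case False
        have "(\<integral>z. cnj z ^ K * z ^ i \<partial>M) = (\<integral>z. z ^ (i - K) \<partial>M)"
        proof (rule integral_cong_sphere_cont)
          fix z :: complex assume z: "cmod z = 1"
          have "z ^ i = z ^ K * z ^ (i - K)" using False by (simp flip: power_add)
          then show "cnj z ^ K * z ^ i = z ^ (i - K)" using one[OF z, of K] by (simp add: mult.assoc[symmetric])
        qed (intro continuous_intros)+
        then show ?thesis using False by simp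
      qed
    qed
    have "integral\<^sup>L M f = (\<integral>z. (\<Sum>i\<le>degree P. coeff P i * (cnj z ^ K * z ^ i)) \<partial>M)"
    proof (rule integral_cong_sphere)
      fix z :: complex assume "cmod z = 1"
      then show "f z = (\<Sum>i\<le>degree P. coeff P i * (cnj z ^ K * z ^ i))"
        by (simp add: f poly_altdef sum_distrib_left ac_simps)
    qed (use assms in \<open>auto intro!: borel_measurable_continuous_onI continuous_intros\<close>)
    also have "\<dots> = (\<Sum>i\<le>degree P. (\<integral>z. coeff P i * (cnj z ^ K * z ^ i) \<partial>M))"
      by (rule Bochner_Integration.integral_sum) (intro integrable_cont continuous_intros)
    also have "\<dots> = (\<Sum>i\<le>degree P. coeff P i * (\<integral>z. cnj z ^ K * z ^ i \<partial>M))"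
      by simp
    finally show ?thesis unfolding m .
  qed
  show thesis
  proof (rule that[of "K + degree P"])
    fix M1 M2 :: "complex measure"
    assume M: "circle_finite_measure M1" "circle_finite_measure M2"
      and eq: "\<And>j. j \<le> K + degree P \<Longrightarrow> (\<integral>z. z ^ j \<partial>M1) = (\<integral>z. z ^ j \<partial>M2)"
    show "integral\<^sup>L M1 f = integral\<^sup>L M2 f"
      unfolding ex[OF M(1)] ex[OF M(2)] by (intro sum.cong refl) (simp add: eq)
  qed
qed

text \<open>For a trigonometric polynomial the two integrals are exactly equal once \<open>n\<close>
  exceeds its order, because the moments agree up to \<open>n\<close>. Uniform density on the circle
  and total mass 1 do the rest.\<close>

lemma bs_measure_weak_conv:
  fixes a :: "nat \<Rightarrow> complex" and f :: "complex \<Rightarrow> real"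
  assumes a1: "\<And>j. cmod (a j) < 1" and \<mu>: "circle_finite_measure \<mu>" and one: "(\<integral>z. 1 \<partial>\<mu>) = (1 :: real)"
    and orth: "\<And>n. circle_finite_measure.orthogonal_below \<mu> n (szego_poly a n)"
    and f: "continuous_on UNIV f"
  shows "(\<lambda>n. integral\<^sup>L (bs_measure a n) f) \<longlonglongrightarrow> integral\<^sup>L \<mu> f"
proof (rule LIMSEQ_I)
  fix e :: real assume e: "0 < e"
  obtain g where g: "real_polynomial_function g" "\<And>x. x \<in> sphere 0 1 \<Longrightarrow> \<bar>f x - g x\<bar> < e / 3"
    by (rule Stone_Weierstrass_real_polynomial_function[of "sphere 0 1" f "e / 3"])
      (use e f in \<open>auto intro: continuous_on_subset\<close>)
  have gc: "continuous_on UNIV g"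
    using g(1) by (simp add: continuous_on_polymonial_function real_polynomial_function_eq)
  have gm: "(\<lambda>z. complex_of_real (g z)) \<in> borel_measurable borel"
    by (intro borel_measurable_continuous_onI continuous_intros gc)
  obtain n0 where n0: "\<And>M1 M2. circle_finite_measure M1 \<Longrightarrow> circle_finite_measure M2 \<Longrightarrow>
    (\<And>j. j \<le> n0 \<Longrightarrow> (\<integral>z. z ^ j \<partial>M1) = (\<integral>z. z ^ j \<partial>M2)) \<Longrightarrow>
    integral\<^sup>L M1 (\<lambda>z. complex_of_real (g z)) = integral\<^sup>L M2 (\<lambda>z. complex_of_real (g z))"
    using trig_poly_integral_eq[OF trig_poly_real_polynomial_function[OF g(1)] gm] by blast
  have close: "\<bar>integral\<^sup>L M f - integral\<^sup>L M g\<bar> \<le> e / 3"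
    if "circle_finite_measure M" "(\<integral>z. 1 \<partial>M) = (1 :: real)" for M
  proof -
    interpret circle_finite_measure M by fact
    have i: "integrable M (\<lambda>z. f z - g z)" "integrable M f" "integrable M g"
      by (intro integrable_cont continuous_intros f gc)+
    have "\<bar>integral\<^sup>L M f - integral\<^sup>L M g\<bar> = \<bar>\<integral>z. f z - g z \<partial>M\<bar>"
      using i by simp
    also have "\<dots> \<le> (\<integral>z. \<bar>f z - g z\<bar> \<partial>M)" by (rule integral_abs_bound)
    also have "\<dots> \<le> (\<integral>z. e / 3 * 1 \<partial>M)"
      by (intro integral_mono_AE integrable_abs i integrable_cont continuous_intros)
        (use AE_sphere g(2) in \<open>auto elim!: eventually_mono intro: less_imp_le\<close>)
    also have "\<dots> = e / 3" unfolding integral_mult_right_zero that(2) by simp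
    finally show ?thesis .
  qed
  have cone: "(\<integral>z. 1 \<partial>M) = (1 :: complex)" if "(\<integral>z. 1 \<partial>M) = (1 :: real)" for M :: "complex measure"
    using that integral_complex_of_real[of M "\<lambda>_. 1"] by simp
  show "\<exists>N. \<forall>n\<ge>N. norm (integral\<^sup>L (bs_measure a n) f - integral\<^sup>L \<mu> f) < e"
  proof (intro exI[of _ n0] allI impI)
    fix n assume n: "n0 \<le> n"
    note bs = circle_finite_measure_bs[of a, OF a1, where n=n]
    have "integral\<^sup>L (bs_measure a n) (\<lambda>z. complex_of_real (g z)) = integral\<^sup>L \<mu> (\<lambda>z. complex_of_real (g z))"
    proof (rule n0[OF bs \<mu>])
      fix j assume "j \<le> n0"
      show "(\<integral>z. z ^ j \<partial>bs_measure a n) = (\<integral>z. z ^ j \<partial>\<mu>)"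
        by (rule moments_eq[OF bs \<mu> cone cone, where a=a and n=n])
          (use one orth bs_orthogonal_le[of a, OF a1] bs_measure_total[of a, OF a1] \<open>j \<le> n0\<close> n in auto)
    qed
    then have "integral\<^sup>L (bs_measure a n) g = integral\<^sup>L \<mu> g" by simp
    moreover have "\<bar>x - y\<bar> < e" if "\<bar>x - u\<bar> \<le> e / 3" "\<bar>y - u\<bar> \<le> e / 3" for x y u :: real
      using that e abs_triangle_ineq4[of "x - u" "y - u"] by simp
    ultimately show "norm (integral\<^sup>L (bs_measure a n) f - integral\<^sup>L \<mu> f) < e"
      using close[OF bs bs_measure_total[of a, OF a1]] close[OF \<mu> one] by simp
  qed
qed

subsection \<open>The variational inequality\<close>

lemma nontrivial_circle_probD:
  assumes "nontrivial_circle_prob \<mu>"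
  shows "circle_finite_measure \<mu>" "prob_space \<mu>"
proof -
  show p: "prob_space \<mu>" using assms by (simp add: nontrivial_circle_prob_def)
  then interpret prob_space \<mu> .
  show "circle_finite_measure \<mu>"
    by unfold_locales (use assms in \<open>auto simp: nontrivial_circle_prob_def\<close>)
qed

text \<open>If the integral vanished, \<mu> would be carried by the finite zero set of
  \<open>P\<close>. The complement of that set is open and null, so the support would be
  finite.\<close>

lemma nontrivial_circle_prob_pos:
  assumes \<mu>: "nontrivial_circle_prob \<mu>" and P: "P \<noteq> 0"
  shows "0 < (\<integral>z. (cmod (poly P z))\<^sup>2 \<partial>\<mu>)"
proof (rule ccontr)
  interpret circle_finite_measure \<mu> using nontrivial_circle_probD(1)[OF \<mu>] .
  assume "\<not> 0 < (\<integral>z. (cmod (poly P z))\<^sup>2 \<partial>\<mu>)"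
  moreover have "0 \<le> (\<integral>z. (cmod (poly P z))\<^sup>2 \<partial>\<mu>)" by (rule integral_nonneg_AE) simp
  ultimately have "(\<integral>z. (cmod (poly P z))\<^sup>2 \<partial>\<mu>) = 0" by simp
  moreover have "integrable \<mu> (\<lambda>z. (cmod (poly P z))\<^sup>2)" by (intro integrable_cont continuous_intros)
  ultimately have "AE z in \<mu>. (cmod (poly P z))\<^sup>2 = 0"
    by (subst (asm) integral_nonneg_eq_0_iff_AE) auto
  then have ae: "AE z in \<mu>. z \<in> {z. poly P z = 0}" by simp
  have fin: "finite {z. poly P z = 0}" using poly_roots_finite[OF P] .
  have op: "open (- {z. poly P z = 0})" using fin by (simp add: finite_imp_closed open_Compl)
  have "emeasure \<mu> (- {z. poly P z = 0}) = 0"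
  proof -
    have "{z \<in> space \<mu>. z \<notin> {z. poly P z = 0}} \<in> null_sets \<mu>"
      using ae op by (subst (asm) AE_iff_null) (auto simp: Compl_eq)
    then show ?thesis by (simp add: null_sets_def Compl_eq)
  qed
  then have "measure_support \<mu> \<subseteq> {z. poly P z = 0}"
    unfolding measure_support_def using op by force
  then have "finite (measure_support \<mu>)" using fin finite_subset by blast
  then show False using \<mu> by (simp add: nontrivial_circle_prob_def)
qed

lemma monic_orthogonal_polys_eq_szego:
  assumes \<mu>: "nontrivial_circle_prob \<mu>" and \<Phi>: "monic_orthogonal_polys \<mu> \<Phi>"
  shows "\<Phi> n = szego_poly (verblunsky \<Phi>) n"
proof (induction n)
  case 0
  have "degree (\<Phi> 0) = 0" "lead_coeff (\<Phi> 0) = 1" using \<Phi> unfolding monic_orthogonal_polys_def by blast+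
  then show ?case by (auto elim!: degree_eq_zeroE)
next
  case (Suc n)
  interpret circle_finite_measure \<mu> using nontrivial_circle_probD(1)[OF \<mu>] .
  let ?a = "verblunsky \<Phi>"
  have orth: "orthogonal_below m (\<Phi> m)" for m
    using \<Phi> unfolding monic_orthogonal_polys_def orthogonal_below_def by blast
  have deg: "degree (\<Phi> (Suc n)) = Suc n" "coeff (\<Phi> (Suc n)) (Suc n) = 1"
    using \<Phi> unfolding monic_orthogonal_polys_def by metis+
  \<comment> \<open>\<open>R\<close> has degree at most \<open>n\<close>, vanishes at 0 and is orthogonal to \<open>z, \<dots>, z\<^sup>n\<close>, hence to itself.\<close>
  define R where "R = \<Phi> (Suc n) - pCons 0 (szego_poly ?a n) + smult (cnj (?a n)) (szego_star ?a n)"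
  have R0: "coeff R 0 = 0"
  proof -
    have "coeff (szego_star ?a n) 0 = 1"
      using szego_star_0[of ?a n] unfolding poly_0_coeff_0 .
    then show ?thesis by (simp add: R_def verblunsky_def poly_0_coeff_0)
  qed
  have Rn: "coeff R (Suc n) = 0"
    unfolding R_def using deg degree_szego[of ?a n] by (simp add: coeff_eq_0)
  have "degree R \<le> Suc n"
    unfolding R_def using deg degree_szego[of ?a n]
    by (intro degree_add_le degree_diff_le) (auto intro: order_trans[OF degree_pCons_le] order_trans[OF degree_smult_le])
  with Rn have Rdeg: "degree R \<le> n"
    by (metis le_SucE leading_coeff_0_iff degree_0 zero_le)
  have Rorth: "(\<integral>z. cnj (z ^ k) * poly R z \<partial>\<mu>) = 0" if "1 \<le> k" "k \<le> n" for k
  proof -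
    have 1: "(\<integral>z. cnj (z ^ k) * poly (\<Phi> (Suc n)) z \<partial>\<mu>) = 0"
      using orth[of "Suc n"] that unfolding orthogonal_below_def by (metis le_imp_less_Suc)
    have 2: "(\<integral>z. cnj (z ^ k) * (z * poly (szego_poly ?a n) z) \<partial>\<mu>) = 0"
    proof -
      have "(\<integral>z. cnj (z ^ k) * (z * poly (szego_poly ?a n) z) \<partial>\<mu>) = (\<integral>z. cnj (z ^ (k - 1)) * poly (szego_poly ?a n) z \<partial>\<mu>)"
      proof (rule integral_cong_sphere_cont)
        fix z :: complex assume z: "cmod z = 1"
        then have zz: "z * cnj z = 1" by (simp add: complex_norm_square[symmetric])
        have "cnj (z ^ k) = cnj z * cnj (z ^ (k - 1))" using that by (cases k) auto
        then show "cnj (z ^ k) * (z * poly (szego_poly ?a n) z) = cnj (z ^ (k - 1)) * poly (szego_poly ?a n) z"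
          using zz by algebra
      qed (intro continuous_intros)+
      also have "\<dots> = 0"
        by (rule orth[of n, unfolded Suc orthogonal_below_def, rule_format]) (use that in simp)
      finally show ?thesis .
    qed
    have 3: "(\<integral>z. cnj (z ^ k) * poly (szego_star ?a n) z \<partial>\<mu>) = 0"
    proof -
      have "(\<integral>z. cnj (z ^ (n - k)) * poly (szego_poly ?a n) z \<partial>\<mu>) = 0"
        by (rule orth[of n, unfolded Suc orthogonal_below_def, rule_format]) (use that in simp)
      then show ?thesis using integral_szego_star[of k n ?a] that by simp
    qed
    have "(\<integral>z. cnj (z ^ k) * poly R z \<partial>\<mu>) = (\<integral>z. cnj (z ^ k) * poly (\<Phi> (Suc n)) z
        - cnj (z ^ k) * (z * poly (szego_poly ?a n) z) + cnj (?a n) * (cnj (z ^ k) * poly (szego_star ?a n) z) \<partial>\<mu>)"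
      unfolding R_def by (simp add: algebra_simps)
    also have "\<dots> = (\<integral>z. cnj (z ^ k) * poly (\<Phi> (Suc n)) z - cnj (z ^ k) * (z * poly (szego_poly ?a n) z) \<partial>\<mu>)
        + (\<integral>z. cnj (?a n) * (cnj (z ^ k) * poly (szego_star ?a n) z) \<partial>\<mu>)"
      by (rule Bochner_Integration.integral_add) (intro integrable_cont continuous_intros)+
    also have "(\<integral>z. cnj (z ^ k) * poly (\<Phi> (Suc n)) z - cnj (z ^ k) * (z * poly (szego_poly ?a n) z) \<partial>\<mu>)
      = (\<integral>z. cnj (z ^ k) * poly (\<Phi> (Suc n)) z \<partial>\<mu>) - (\<integral>z. cnj (z ^ k) * (z * poly (szego_poly ?a n) z) \<partial>\<mu>)"
      by (rule Bochner_Integration.integral_diff) (intro integrable_cont continuous_intros)+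
    finally show ?thesis unfolding 1 2 integral_mult_right_zero 3 by simp
  qed
  have "(\<integral>z. cnj (poly R z) * poly R z \<partial>\<mu>) = (\<integral>z. (\<Sum>i\<le>degree R. cnj (coeff R i) * (cnj (z ^ i) * poly R z)) \<partial>\<mu>)"
  proof -
    have "cnj (poly R z) * poly R z = (\<Sum>i\<le>degree R. cnj (coeff R i) * (cnj (z ^ i) * poly R z))" for z
      by (subst poly_altdef) (simp add: sum_distrib_right mult.assoc)
    then show ?thesis by presburger
  qed
  also have "\<dots> = (\<Sum>i\<le>degree R. (\<integral>z. cnj (coeff R i) * (cnj (z ^ i) * poly R z) \<partial>\<mu>))"
    by (rule Bochner_Integration.integral_sum) (intro integrable_cont continuous_intros)
  also have "\<dots> = (\<Sum>i\<le>degree R. cnj (coeff R i) * (\<integral>z. cnj (z ^ i) * poly R z \<partial>\<mu>))"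
    by (intro sum.cong refl) (rule integral_mult_right_zero)
  also have "\<dots> = 0"
  proof (rule sum.neutral, intro ballI)
    fix i assume "i \<in> {..degree R}"
    then show "cnj (coeff R i) * (\<integral>z. cnj (z ^ i) * poly R z \<partial>\<mu>) = 0"
      using R0 Rorth[of i] Rdeg by (cases "i = 0") auto
  qed
  finally have "(\<integral>z. complex_of_real ((cmod (poly R z))\<^sup>2) \<partial>\<mu>) = 0"
    unfolding complex_norm_square by (simp add: mult.commute)
  then have "(\<integral>z. (cmod (poly R z))\<^sup>2 \<partial>\<mu>) = 0"
    unfolding integral_complex_of_real of_real_eq_0_iff .
  then have "R = 0" using nontrivial_circle_prob_pos[OF \<mu>, of R] by force
  then show ?case unfolding szego_poly_Suc R_def by (simp add: algebra_simps)
qed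

text \<open>By the norm recursion \<open>1 - |\<alpha>_n|^2\<close> is the ratio of two squared
  norms, both positive because the support is infinite.\<close>

lemma verblunsky_properties:
  assumes \<mu>: "nontrivial_circle_prob \<mu>" and \<Phi>: "monic_orthogonal_polys \<mu> \<Phi>"
  shows "circle_finite_measure.orthogonal_below \<mu> n (szego_poly (verblunsky \<Phi>) n)"
    and "cmod (verblunsky \<Phi> n) < 1"
proof -
  interpret circle_finite_measure \<mu> using nontrivial_circle_probD(1)[OF \<mu>] .
  have orth: "orthogonal_below n (szego_poly (verblunsky \<Phi>) n)" for n
    using \<Phi> unfolding monic_orthogonal_polys_eq_szego[OF \<mu> \<Phi>, symmetric]
      monic_orthogonal_polys_def orthogonal_below_def by blast
  show "orthogonal_below n (szego_poly (verblunsky \<Phi>) n)" by (rule orth)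
  have pos: "0 < (\<integral>z. (cmod (poly (szego_poly (verblunsky \<Phi>) m) z))\<^sup>2 \<partial>\<mu>)" for m
    by (rule nontrivial_circle_prob_pos[OF \<mu>]) (use degree_szego[of "verblunsky \<Phi>" m] in auto)
  have "0 < 1 - (cmod (verblunsky \<Phi> n))\<^sup>2"
    using pos[of "Suc n"] pos[of n] unfolding orthogonal_szego_step_norm[OF orth]
    by (simp add: zero_less_mult_iff)
  then show "cmod (verblunsky \<Phi> n) < 1" by (simp add: abs_square_less_1)
qed

lemma circle_weight_bounds:
  assumes "cmod z = 1"
  shows "0 \<le> circle_weight z" "circle_weight z \<le> 8"
proof -
  have r: "\<bar>Re z\<bar> \<le> 1" using abs_Re_le_cmod[of z] assms by simp
  then show "0 \<le> circle_weight z" unfolding circle_weight_def by (auto simp: abs_le_iff)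
  have "(1 - Re z)\<^sup>2 \<le> 2\<^sup>2" using r by (intro power_mono) auto
  \<comment> \<open>The bound 8 is the crude product of 4 and 2. The constants 16 and 24 further on
    derive from it, and their size is immaterial.\<close>
  then have "(1 - Re z)\<^sup>2 * (1 + Re z) \<le> 4 * 2" using r by (intro mult_mono) auto
  then show "circle_weight z \<le> 8" unfolding circle_weight_def by simp
qed

lemma AE_circle_weight_bounds:
  assumes "circle_finite_measure M"
  shows "AE z in M. 0 \<le> circle_weight z \<and> circle_weight z \<le> 8"
  using circle_finite_measure.AE_sphere[OF assms] by eventually_elim (simp add: circle_weight_bounds)

text \<open>On \<open>[1, \<infinity>)\<close> the logarithm is 1-Lipschitz, so closeness in mean
  passes from test functions to their logarithms. This is why test functions are kept at least
  1.\<close>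

lemma abs_ln_diff_le:
  fixes x y :: real
  assumes "1 \<le> x" "1 \<le> y"
  shows "\<bar>ln x - ln y\<bar> \<le> \<bar>x - y\<bar>"
proof -
  have *: "ln u - ln v \<le> \<bar>u - v\<bar>" if "1 \<le> u" "1 \<le> v" for u v :: real
  proof -
    have "ln u - ln v \<le> (u - v) / v" using that by (intro ln_diff_le) auto
    also have "\<dots> \<le> \<bar>u - v\<bar> / v" using that by (intro divide_right_mono) auto
    also have "\<dots> \<le> \<bar>u - v\<bar> / 1" using that by (intro divide_left_mono) auto
    finally show ?thesis by simp
  qed
  show ?thesis using *[OF assms] *[OF assms(2,1)] by (simp add: abs_le_iff abs_minus_commute)
qed

context
  fixes a :: "nat \<Rightarrow> complex" and \<mu> :: "complex measure" and L :: real
  assumes a1: "\<And>j. cmod (a j) < 1" and \<mu>: "circle_finite_measure \<mu>" and one: "(\<integral>z. 1 \<partial>\<mu>) = (1 :: real)"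
    and orth: "\<And>n. circle_finite_measure.orthogonal_below \<mu> n (szego_poly a n)"
    and L: "\<And>n. L \<le> bs_entropy a n"
begin

text \<open>Integrating \<open>ln t \<le> t\<close> for \<open>t = bs_density a n z * f z\<close>
  against the weight bounds the entropy plus the mean of \<open>ln f\<close> by an integral over the
  Bernstein--Szego measure. The left side is bounded below uniformly in \<open>n\<close>, and the
  right side converges weakly.\<close>

lemma entropy_inequality_continuous:
  assumes f: "continuous_on UNIV f" "\<And>z. 0 < f z"
  shows "L + (\<integral>z. circle_weight z * ln (f z) \<partial>circle_measure) \<le> (\<integral>z. circle_weight z * f z \<partial>\<mu>)"
proof (rule LIMSEQ_le_const)
  have fm [measurable]: "f \<in> borel_measurable borel" by (intro borel_measurable_continuous_onI f)
  have cf: "continuous_on S f" for S using f(1) continuous_on_subset by blast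
  show "(\<lambda>n. \<integral>z. circle_weight z * f z \<partial>bs_measure a n) \<longlonglongrightarrow> (\<integral>z. circle_weight z * f z \<partial>\<mu>)"
    by (intro bs_measure_weak_conv[OF a1 \<mu> one orth] continuous_intros f)
  have "L + (\<integral>z. circle_weight z * ln (f z) \<partial>circle_measure) \<le> (\<integral>z. circle_weight z * f z \<partial>bs_measure a n)" for n
  proof -
    have i: "integrable circle_measure (\<lambda>z. circle_weight z * ln (f z))"
      by (intro circle.integrable_cont continuous_intros f) (use f in \<open>auto simp: less_imp_neq[symmetric]\<close>)
    have "L + (\<integral>z. circle_weight z * ln (f z) \<partial>circle_measure)
      \<le> bs_entropy a n + (\<integral>z. circle_weight z * ln (f z) \<partial>circle_measure)"
      using L by simp
    also have "\<dots> = (\<integral>z. circle_weight z * ln (bs_density a n z) + circle_weight z * ln (f z) \<partial>circle_measure)"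
      unfolding bs_entropy_def
      by (rule Bochner_Integration.integral_add[symmetric]) (intro integrable_bs_entropy[OF a1] i)+
    also have "\<dots> \<le> (\<integral>z. bs_density a n z *\<^sub>R (circle_weight z * f z) \<partial>circle_measure)"
    proof (rule integral_mono_AE)
      show "integrable circle_measure (\<lambda>z. circle_weight z * ln (bs_density a n z) + circle_weight z * ln (f z))"
        by (intro Bochner_Integration.integrable_add integrable_bs_entropy[OF a1] i)
      show "integrable circle_measure (\<lambda>z. bs_density a n z *\<^sub>R (circle_weight z * f z))"
        by (intro circle.integrable_continuous continuous_intros bs_density_continuous[OF a1] cf) measurable
      show "AE z in circle_measure. circle_weight z * ln (bs_density a n z) + circle_weight z * ln (f z)
          \<le> bs_density a n z *\<^sub>R (circle_weight z * f z)"
        using AE_circle_measure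
      proof eventually_elim
        case (elim z)
        then have z: "cmod z = 1" by simp
        have p: "0 < bs_density a n z" by (rule bs_density_pos[OF a1 z])
        have "ln (bs_density a n z) + ln (f z) = ln (bs_density a n z * f z)"
          using p f(2)[of z] by (simp add: ln_mult)
        also have "\<dots> \<le> bs_density a n z * f z"
          using p f(2)[of z] by (intro ln_bound) auto
        finally have "circle_weight z * (ln (bs_density a n z) + ln (f z)) \<le> circle_weight z * (bs_density a n z * f z)"
          by (intro mult_left_mono circle_weight_bounds z)
        then show ?case by (simp add: algebra_simps)
      qed
    qed
    also have "\<dots> = (\<integral>z. circle_weight z * f z \<partial>bs_measure a n)"
      by (rule bs_measure_integral[OF a1, symmetric]) measurable
    finally show ?thesis .
  qed
  then show "\<exists>N. \<forall>n\<ge>N. L + (\<integral>z. circle_weight z * ln (f z) \<partial>circle_measure) \<le> (\<integral>z. circle_weight z * f z \<partial>bs_measure a n)"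
    by blast
qed

lemma entropy_inequality_bounded:
  assumes f [measurable]: "f \<in> borel_measurable borel" and f1: "\<And>z. 1 \<le> f z" and fB: "\<And>z. f z \<le> B"
  shows "L + (\<integral>z. circle_weight z * ln (f z) \<partial>circle_measure) \<le> (\<integral>z. circle_weight z * f z \<partial>\<mu>)"
proof (rule field_le_epsilon)
  interpret \<mu>: circle_finite_measure \<mu> by (rule \<mu>)
  fix e :: real assume e: "0 < e"
  have f0: "0 \<le> f z" for z using f1[of z] by simp
  have "continuous_approx circle_measure \<mu> f"
    by (rule continuous_approx_bounded[OF _ _ _ _ f f0 fB])
      (auto intro: circle.finite_measure_axioms \<mu>.finite_measure_axioms)
  then obtain g where g: "continuous_on UNIV g" "(\<integral>\<^sup>+z. ennreal \<bar>f z - g z\<bar> \<partial>circle_measure) < ennreal (e / 16)"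
    "(\<integral>\<^sup>+z. ennreal \<bar>f z - g z\<bar> \<partial>\<mu>) < ennreal (e / 16)"
    by (rule continuous_approxD[of _ _ _ "e / 16"]) (use e in auto)
  \<comment> \<open>Truncation at 1 does not increase the distance to \<open>f\<close>, since
    \<open>f \<ge> 1\<close>. An error \<open>e / 16\<close>, a weight of at most 8 and two
    integrals add up to \<open>e\<close>.\<close>
  define h where "h z = max 1 (g z)" for z
  have h: "continuous_on UNIV h" unfolding h_def by (intro continuous_intros g)
  have hm [measurable]: "h \<in> borel_measurable borel" by (intro borel_measurable_continuous_onI h)
  have h1: "1 \<le> h z" for z by (simp add: h_def)
  then have h0: "0 < h z" for z using less_le_trans[OF zero_less_one] by blast
  have fh: "\<bar>f z - h z\<bar> \<le> \<bar>f z - g z\<bar>" for z using f1[of z] by (simp add: h_def max_def)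
  have close: "\<bar>(\<integral>z. circle_weight z * u z \<partial>M) - (\<integral>z. circle_weight z * v z \<partial>M)\<bar> \<le> e / 2"
    if M: "circle_finite_measure M" and "(\<integral>\<^sup>+z. ennreal \<bar>f z - g z\<bar> \<partial>M) < ennreal (e / 16)"
      and u: "integrable M (\<lambda>z. circle_weight z * u z)" and v: "integrable M (\<lambda>z. circle_weight z * v z)"
      and uv: "\<And>z. \<bar>u z - v z\<bar> \<le> \<bar>f z - h z\<bar>" for M u v
  proof -
    interpret M: circle_finite_measure M by (rule M)
    have if_: "integrable M f"
      by (rule M.integrable_const_bound[of _ B]) (use f0 fB in auto)
    have ih: "integrable M h" by (rule M.integrable_cont[OF h])
    have i: "integrable M (\<lambda>z. \<bar>f z - h z\<bar>)" by (intro integrable_abs Bochner_Integration.integrable_diff if_ ih)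
    have "ennreal (\<integral>z. \<bar>f z - h z\<bar> \<partial>M) = (\<integral>\<^sup>+z. ennreal \<bar>f z - h z\<bar> \<partial>M)"
      by (rule nn_integral_eq_integral[symmetric, OF i]) simp
    also have "\<dots> \<le> (\<integral>\<^sup>+z. ennreal \<bar>f z - g z\<bar> \<partial>M)"
      by (intro nn_integral_mono ennreal_leI fh)
    also have "\<dots> < ennreal (e / 16)" by fact
    finally have le: "(\<integral>z. \<bar>f z - h z\<bar> \<partial>M) \<le> e / 16"
      using e by (simp add: ennreal_less_iff)
    have "\<bar>(\<integral>z. circle_weight z * u z \<partial>M) - (\<integral>z. circle_weight z * v z \<partial>M)\<bar>
      = \<bar>\<integral>z. circle_weight z * u z - circle_weight z * v z \<partial>M\<bar>"
      using u v by simp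
    also have "\<dots> \<le> (\<integral>z. \<bar>circle_weight z * u z - circle_weight z * v z\<bar> \<partial>M)"
      by (rule integral_abs_bound)
    also have "\<dots> \<le> (\<integral>z. 8 * \<bar>f z - h z\<bar> \<partial>M)"
    proof (rule integral_mono_AE)
      show "AE z in M. \<bar>circle_weight z * u z - circle_weight z * v z\<bar> \<le> 8 * \<bar>f z - h z\<bar>"
        using AE_circle_weight_bounds[OF M]
      proof eventually_elim
        case (elim z)
        then have "circle_weight z * \<bar>u z - v z\<bar> \<le> 8 * \<bar>f z - h z\<bar>"
          using uv by (intro mult_mono) auto
        then show ?case using elim by (simp add: abs_mult flip: right_diff_distrib)
      qed
    qed (intro integrable_abs Bochner_Integration.integrable_diff integrable_mult_right u v if_ ih)+
    also have "\<dots> \<le> e / 2" using le by simp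
    finally show ?thesis .
  qed
  have bw: "integrable M (\<lambda>z. circle_weight z * u z)"
    if M: "circle_finite_measure M" and u: "u \<in> borel_measurable borel" "\<And>z. \<bar>u z\<bar> \<le> C" for M u C
  proof -
    interpret M: circle_finite_measure M by (rule M)
    note u(1) [measurable]
    show ?thesis
    proof (rule M.integrable_const_bound[of _ "8 * C"])
      show "AE z in M. norm (circle_weight z * u z) \<le> 8 * C"
        using AE_circle_weight_bounds[OF M]
        by eventually_elim (use u(2) in \<open>auto simp: abs_mult intro!: mult_mono\<close>)
    qed simp
  qed
  have lnb: "\<bar>ln (f z)\<bar> \<le> B" for z
    using f1[of z] fB[of z] ln_bound[of "f z"] by simp
  have 1: "\<bar>(\<integral>z. circle_weight z * ln (f z) \<partial>circle_measure) - (\<integral>z. circle_weight z * ln (h z) \<partial>circle_measure)\<bar> \<le> e / 2"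
  proof (rule close[OF circle.circle_finite_measure_axioms g(2)])
    show "integrable circle_measure (\<lambda>z. circle_weight z * ln (f z))"
      by (rule bw[OF circle.circle_finite_measure_axioms _ lnb]) measurable
    show "integrable circle_measure (\<lambda>z. circle_weight z * ln (h z))"
      by (intro circle.integrable_cont continuous_intros h) (use h0 in \<open>auto simp: less_imp_neq[symmetric]\<close>)
  qed (rule abs_ln_diff_le[OF f1 h1])
  have 2: "\<bar>(\<integral>z. circle_weight z * f z \<partial>\<mu>) - (\<integral>z. circle_weight z * h z \<partial>\<mu>)\<bar> \<le> e / 2"
  proof (rule close[OF \<mu> g(3)])
    show "integrable \<mu> (\<lambda>z. circle_weight z * f z)"
      by (rule bw[OF \<mu> f, of B]) (use f0 fB in simp)
    show "integrable \<mu> (\<lambda>z. circle_weight z * h z)"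
      by (intro \<mu>.integrable_cont continuous_intros h)
  qed simp
  show "L + (\<integral>z. circle_weight z * ln (f z) \<partial>circle_measure) \<le> (\<integral>z. circle_weight z * f z \<partial>\<mu>) + e"
    using entropy_inequality_continuous[OF h h0] 1 2 unfolding abs_le_iff by linarith
qed

end

subsection \<open>Finiteness of the entropy integral\<close>

lemma Arg2pi_measurable: "Arg2pi \<in> borel_measurable borel"
proof -
  have "(\<lambda>z. if z \<in> \<real>\<^sub>\<ge>\<^sub>0 then 0 else Arg2pi z) \<in> borel_measurable borel"
    by (intro borel_measurable_continuous_on_if continuous_on_const)
      (auto intro!: continuous_at_imp_continuous_on continuous_at_Arg2pi borel_closed)
  moreover have "(\<lambda>z. if z \<in> \<real>\<^sub>\<ge>\<^sub>0 then 0 else Arg2pi z) = Arg2pi"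
    by (auto simp: fun_eq_iff Arg2pi_eq_0 complex_nonneg_Reals_iff complex_is_Real_iff)
  ultimately show ?thesis by simp
qed

lemma Arg2pi_cis: "\<theta> \<in> {0..<2 * pi} \<Longrightarrow> Arg2pi (cis \<theta>) = \<theta>"
  by (rule Arg2pi_unique[of 1]) (auto simp: cis_conv_exp)

text \<open>With \<open>W = w \<circ> Arg2pi\<close> the absolutely continuous part becomes a
  density on the circle; the endpoint where \<open>W\<close> and \<open>w\<close> may disagree is
  null. The last two properties are all that is retained of the singular part: it only adds mass,
  and it sits on \<open>N\<close>.\<close>

lemma circle_decomposition_density:
  assumes D: "circle_lebesgue_decomposition \<mu> w \<mu>\<^sub>s"
  obtains W N where "W \<in> borel_measurable borel" "\<And>z. 0 \<le> W z"
    "\<And>\<theta>. \<theta> \<in> {0..<2 * pi} \<Longrightarrow> W (cis \<theta>) = w \<theta>"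
    "N \<in> sets borel" "emeasure circle_measure N = 0"
    "\<And>A. A \<in> sets borel \<Longrightarrow> emeasure (density circle_measure (\<lambda>z. ennreal (W z))) A \<le> emeasure \<mu> A"
    "\<And>A. A \<in> sets borel \<Longrightarrow> A \<inter> N = {} \<Longrightarrow> emeasure \<mu> A = emeasure (density circle_measure (\<lambda>z. ennreal (W z))) A"
proof -
  from D have wm [measurable]: "w \<in> borel_measurable borel" and w0: "\<And>\<theta>. 0 \<le> w \<theta>"
    and s: "sets \<mu>\<^sub>s = sets borel"
    and dec: "\<And>A. A \<in> sets borel \<Longrightarrow> emeasure \<mu> A =
        emeasure (distr (density normalized_angle (\<lambda>\<theta>. ennreal (w \<theta>))) borel cis) A + emeasure \<mu>\<^sub>s A"
    unfolding circle_lebesgue_decomposition_def by auto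
  from D obtain N where N: "N \<in> sets borel" "emeasure (distr normalized_angle borel cis) N = 0" "emeasure \<mu>\<^sub>s (- N) = 0"
    unfolding circle_lebesgue_decomposition_def by blast
  define W where "W z = w (Arg2pi z)" for z
  have Wm [measurable]: "W \<in> borel_measurable borel"
    unfolding W_def using measurable_compose[OF Arg2pi_measurable wm] .
  have W: "W (cis \<theta>) = w \<theta>" if "\<theta> \<in> {0..<2 * pi}" for \<theta>
    unfolding W_def Arg2pi_cis[OF that] ..
  have eq: "emeasure (distr (density normalized_angle (\<lambda>\<theta>. ennreal (w \<theta>))) borel cis) A
      = emeasure (density circle_measure (\<lambda>z. ennreal (W z))) A" if [measurable]: "A \<in> sets borel" for A
  proof -
    have [measurable]: "cis -` A \<in> sets borel"
      using measurable_sets[OF cis_measurable that] by simp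
    have "emeasure (distr (density normalized_angle (\<lambda>\<theta>. ennreal (w \<theta>))) borel cis) A
      = emeasure (density normalized_angle (\<lambda>\<theta>. ennreal (w \<theta>))) (cis -` A)"
      by (subst emeasure_distr) auto
    also have "\<dots> = (\<integral>\<^sup>+\<theta>. ennreal (w \<theta>) * indicator (cis -` A) \<theta> \<partial>normalized_angle)"
      by (rule emeasure_density) auto
    also have "\<dots> = (\<integral>\<^sup>+\<theta>. ennreal (W (cis \<theta>)) * indicator A (cis \<theta>) \<partial>normalized_angle)"
    proof (rule nn_integral_cong_AE)
      show "AE \<theta> in normalized_angle. ennreal (w \<theta>) * indicator (cis -` A) \<theta> = ennreal (W (cis \<theta>)) * indicator A (cis \<theta>)"
        using AE_normalized_angle by eventually_elim (simp add: W indicator_def)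
    qed
    also have "\<dots> = (\<integral>\<^sup>+z. ennreal (W z) * indicator A z \<partial>circle_measure)"
      unfolding circle_measure_def by (subst nn_integral_distr) auto
    also have "\<dots> = emeasure (density circle_measure (\<lambda>z. ennreal (W z))) A"
      by (rule emeasure_density[symmetric]) auto
    finally show ?thesis .
  qed
  show thesis
  proof (rule that[of W N])
    fix A :: "complex set" assume A: "A \<in> sets borel"
    show "emeasure (density circle_measure (\<lambda>z. ennreal (W z))) A \<le> emeasure \<mu> A"
      unfolding dec[OF A] eq[OF A] by simp
    assume "A \<inter> N = {}"
    then have "emeasure \<mu>\<^sub>s A \<le> emeasure \<mu>\<^sub>s (- N)"
      using N(1) s by (intro emeasure_mono) auto
    then show "emeasure \<mu> A = emeasure (density circle_measure (\<lambda>z. ennreal (W z))) A"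
      unfolding dec[OF A] eq[OF A] N(3) by simp
  qed (use W N Wm in \<open>auto simp: W_def w0 circle_measure_def\<close>)
qed

lemma ext_log_measurable [measurable]: "ext_log \<in> borel_measurable borel"
  unfolding ext_log_def by measurable

text \<open>This is the pointwise input for Fatou's lemma. The functions
  \<open>1 / (x + 1/(k+1))\<close>, cut off below at 1, are bounded for each \<open>k\<close>, and
  the \<open>liminf\<close> dominates the negative part of the logarithm even at
  \<open>x = 0\<close>, where it is infinite for \<open>q > 0\<close>. For \<open>q = 0\<close> the
  left side is 0 by the convention that 0 times infinity is 0.\<close>

lemma neg_log_le_liminf:
  fixes q x :: real
  assumes q: "0 \<le> q" and x: "0 \<le> x"
  shows "e2ennreal (- (ereal q * ext_log x))
    \<le> liminf (\<lambda>k. ennreal (q * ln (max (1 / (x + 1 / real (Suc k))) 1)))"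
proof -
  consider "q = 0" | "0 < q" "x = 0" | "0 < x" using q x by linarith
  then show ?thesis
  proof cases
    case 1
    then show ?thesis by (simp add: zero_ereal_def[symmetric] e2ennreal_neg)
  next
    case 2
    have "eventually (\<lambda>k. y < ennreal (q * ln (max (1 / (x + 1 / real (Suc k))) 1))) sequentially"
      if y: "y < \<top>" for y
    proof -
      obtain r where r: "y = ennreal r" "0 \<le> r" using y by (cases y) auto
      obtain K :: nat where K: "exp (r / q) < real K" using reals_Archimedean2 by blast
      have "y < ennreal (q * ln (max (1 / (x + 1 / real (Suc k))) 1))" if "K \<le> k" for k
      proof -
        have "exp (r / q) < real (Suc k)" using K that by linarith
        then have "r / q < ln (real (Suc k))" by (metis exp_gt_zero ln_exp ln_less_cancel_iff of_nat_0_less_iff zero_less_Suc)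
        then have "r < q * ln (real (Suc k))" using 2 by (simp add: field_simps)
        moreover from this have "0 < k" using r by (cases "k = 0") auto
        ultimately show ?thesis using 2 r by (simp add: ennreal_less_iff max_def)
      qed
      then show ?thesis unfolding eventually_sequentially by blast
    qed
    then have "\<top> \<le> liminf (\<lambda>k. ennreal (q * ln (max (1 / (x + 1 / real (Suc k))) 1)))"
      unfolding le_Liminf_iff by blast
    then show ?thesis using top_le by (metis top_greatest)
  next
    case 3
    have "(\<lambda>k. 1 / real (Suc k)) \<longlonglongrightarrow> 0"
      using LIMSEQ_inverse_real_of_nat by (simp add: inverse_eq_divide)
    then have "(\<lambda>k. ennreal (q * ln (max (1 / (x + 1 / real (Suc k))) 1))) \<longlonglongrightarrow> ennreal (q * ln (max (1 / (x + 0)) 1))"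
      using 3 by (intro tendsto_intros tendsto_ennrealI) auto
    then have l: "liminf (\<lambda>k. ennreal (q * ln (max (1 / (x + 1 / real (Suc k))) 1))) = ennreal (q * ln (max (1 / (x + 0)) 1))"
      by (intro lim_imp_Liminf) auto
    have "- ln x = ln (1 / x)" using 3 by (simp add: ln_div)
    also have "\<dots> \<le> ln (max (1 / (x + 0)) 1)" using 3 by (subst ln_le_cancel_iff) auto
    finally have "q * - ln x \<le> q * ln (max (1 / (x + 0)) 1)" using q by (rule mult_left_mono)
    then show ?thesis unfolding l using 3 by (simp add: ext_log_def ennreal_leI)
  qed
qed

section \<open>Finite entropy and bounded Bernstein--Szego entropies\<close>

locale szego_decomposition = circle_finite_measure \<mu> for \<mu> +
  fixes a :: "nat \<Rightarrow> complex" and W :: "complex \<Rightarrow> real" and N :: "complex set"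
  assumes a1: "\<And>j. cmod (a j) < 1" and prob: "prob_space \<mu>"
    and orth: "\<And>n. orthogonal_below n (szego_poly a n)"
    and Wm [measurable]: "W \<in> borel_measurable borel" and W0: "\<And>z. 0 \<le> W z"
    and N [measurable]: "N \<in> sets borel" and N0: "emeasure circle_measure N = 0"
    and le: "\<And>A. A \<in> sets borel \<Longrightarrow> emeasure (density circle_measure (\<lambda>z. ennreal (W z))) A \<le> emeasure \<mu> A"
    and eq: "\<And>A. A \<in> sets borel \<Longrightarrow> A \<inter> N = {} \<Longrightarrow> emeasure \<mu> A = emeasure (density circle_measure (\<lambda>z. ennreal (W z))) A"
begin

lemmas \<mu> = circle_finite_measure_axioms

abbreviation (input) neg_entropy :: ennreal where
  "neg_entropy \<equiv> \<integral>\<^sup>+z. e2ennreal (- (ereal (circle_weight z) * ext_log (W z))) \<partial>circle_measure"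

lemma total_one: "(\<integral>z. 1 \<partial>\<mu>) = (1 :: real)"
  using prob_space.prob_space[OF prob] by simp

lemma nn_integral_density_le:
  assumes [measurable]: "g \<in> borel_measurable borel"
  shows "(\<integral>\<^sup>+z. ennreal (W z) * g z \<partial>circle_measure) \<le> (\<integral>\<^sup>+z. g z \<partial>\<mu>)"
proof -
  have "(\<integral>\<^sup>+z. ennreal (W z) * g z \<partial>circle_measure) = (\<integral>\<^sup>+z. g z \<partial>density circle_measure (\<lambda>z. ennreal (W z)))"
    by (rule nn_integral_density[symmetric]) auto
  also have "\<dots> \<le> (\<integral>\<^sup>+z. g z \<partial>\<mu>)"
    by (intro nn_integral_mono_measure le_measure[THEN iffD2] ballI) (auto intro: le)
  finally show ?thesis .
qed

lemma nn_integral_off_null_set: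
  assumes [measurable]: "g \<in> borel_measurable borel"
  shows "(\<integral>\<^sup>+z. g z * indicator (- N) z \<partial>\<mu>) \<le> (\<integral>\<^sup>+z. ennreal (W z) * g z \<partial>circle_measure)"
proof -
  let ?\<nu> = "density circle_measure (\<lambda>z. ennreal (W z))"
  have m: "density \<mu> (indicator (- N)) = density ?\<nu> (indicator (- N))"
  proof (rule measure_eqI)
    fix A assume "A \<in> sets (density \<mu> (indicator (- N)))"
    then have A [measurable]: "A \<in> sets borel" by simp
    have "emeasure (density \<mu> (indicator (- N))) A = emeasure \<mu> (- N \<inter> A)"
      by (subst emeasure_density) (auto simp: indicator_inter_arith[symmetric])
    also have "\<dots> = emeasure ?\<nu> (- N \<inter> A)" by (rule eq) auto
    also have "\<dots> = emeasure (density ?\<nu> (indicator (- N))) A"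
      by (subst (2) emeasure_density) (auto simp: indicator_inter_arith[symmetric])
    finally show "emeasure (density \<mu> (indicator (- N))) A = emeasure (density ?\<nu> (indicator (- N))) A" .
  qed simp
  have "(\<integral>\<^sup>+z. g z * indicator (- N) z \<partial>\<mu>) = (\<integral>\<^sup>+z. g z \<partial>density \<mu> (indicator (- N)))"
    by (subst nn_integral_density) (auto simp: mult.commute)
  also have "\<dots> = (\<integral>\<^sup>+z. g z * indicator (- N) z \<partial>?\<nu>)"
    unfolding m by (subst nn_integral_density) (auto simp: mult.commute)
  also have "\<dots> \<le> (\<integral>\<^sup>+z. g z \<partial>?\<nu>)"
    by (intro nn_integral_mono) (auto simp: indicator_def)
  also have "\<dots> = (\<integral>\<^sup>+z. ennreal (W z) * g z \<partial>circle_measure)"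
    by (rule nn_integral_density) auto
  finally show ?thesis .
qed

text \<open>Pointwise \<open>ln W - ln (bs_density a n) \<le> W |\<Phi>_n|^2 / c\<close> with
  \<open>c = verblunsky_prod a n\<close>. The part of \<mu> with density \<open>W\<close> lies below
  \<mu>, for which \<open>|\<Phi>_n|^2 / c\<close> has integral 1; the weight is at most 8, hence
  the bound \<open>-(h + 8)\<close>.\<close>

lemma bs_entropy_bounded_below:
  assumes fin: "neg_entropy < \<top>"
  obtains L where "\<And>n. L \<le> bs_entropy a n"
proof -
  obtain h where h: "neg_entropy = ennreal h" "0 \<le> h" using fin by (cases neg_entropy) auto
  have "- (h + 8) \<le> bs_entropy a n" for n
  proof -
    let ?P = "\<lambda>z. cmod (poly (szego_poly a n) z)" and ?c = "verblunsky_prod a n"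
    have c: "0 < ?c" by (rule verblunsky_prod_pos[OF a1])
    have pt: "ennreal (- (circle_weight z * ln (bs_density a n z)))
        \<le> e2ennreal (- (ereal (circle_weight z) * ext_log (W z))) + 8 * (ennreal (W z) * ennreal ((?P z)\<^sup>2 / ?c))"
      if z: "cmod z = 1" for z
    proof -
      let ?q = "circle_weight z"
      have q: "0 \<le> ?q" "?q \<le> 8" using circle_weight_bounds[OF z] by auto
      have d: "bs_density a n z = ?c / (?P z)\<^sup>2" "0 < bs_density a n z"
        using cmod_szego_circle[OF z, of a n] bs_density_pos[of a z n, OF a1 z] by (simp_all add: bs_density_def)
      \<comment> \<open>In the first case the left side is 0, and in the second the negative part on
        the right is infinite, so only \<open>W z > 0\<close> needs the logarithmic
        inequality.\<close>
      consider "?q = 0" | "0 < ?q" "W z = 0" | "0 < W z" using q W0[of z] by linarith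
      then show ?thesis
      proof cases
        case 3
        have p: "0 < W z * ((?P z)\<^sup>2 / ?c)"
          using 3 d c by (simp add: zero_less_divide_iff)
        have "ln (W z) - ln (bs_density a n z) = ln (W z * ((?P z)\<^sup>2 / ?c))"
        proof -
          have "W z * ((?P z)\<^sup>2 / ?c) = W z / bs_density a n z" unfolding d(1) by simp
          then show ?thesis using 3 d(2) by (simp add: ln_div)
        qed
        also have "\<dots> \<le> W z * ((?P z)\<^sup>2 / ?c)" using p by (rule ln_bound)
        finally have "?q * (ln (W z) - ln (bs_density a n z)) \<le> 8 * (W z * ((?P z)\<^sup>2 / ?c))"
          using q p
          by (intro order_trans[OF mult_left_mono mult_right_mono]) auto
        then have "- (?q * ln (bs_density a n z)) \<le> max 0 (- (?q * ln (W z))) + 8 * (W z * ((?P z)\<^sup>2 / ?c))"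
          by (simp add: algebra_simps max_def)
        then have "ennreal (- (?q * ln (bs_density a n z))) \<le> ennreal (max 0 (- (?q * ln (W z))) + 8 * (W z * ((?P z)\<^sup>2 / ?c)))"
          by (rule ennreal_leI)
        also have "\<dots> = ennreal (- (?q * ln (W z))) + 8 * (ennreal (W z) * ennreal ((?P z)\<^sup>2 / ?c))"
        proof -
          have em: "ennreal (8 * (u * v)) = 8 * (ennreal u * ennreal v)" if "0 \<le> u" "0 \<le> v" for u v
            using that by (simp add: ennreal_mult)
          have "0 \<le> (?P z)\<^sup>2 / ?c" using c by simp
          then show ?thesis
            using 3 p by (subst ennreal_plus) (auto simp: em ennreal_max_0 simp del: times_divide_eq_right)
        qed
        finally show ?thesis using 3 by (simp add: ext_log_def)
      qed (auto simp: ext_log_def)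
    qed
    have i: "integrable circle_measure (\<lambda>z. - (circle_weight z * ln (bs_density a n z)))"
      by (intro Bochner_Integration.integrable_minus integrable_bs_entropy[OF a1])
    have norm: "(\<integral>\<^sup>+z. ennreal ((?P z)\<^sup>2 / ?c) \<partial>\<mu>) = 1"
    proof -
      have "integrable \<mu> (\<lambda>z. (?P z)\<^sup>2 / ?c)" using c by (intro integrable_cont continuous_intros) auto
      then have "(\<integral>\<^sup>+z. ennreal ((?P z)\<^sup>2 / ?c) \<partial>\<mu>) = ennreal (\<integral>z. (?P z)\<^sup>2 / ?c \<partial>\<mu>)"
        using c by (intro nn_integral_eq_integral) auto
      also have "(\<integral>z. (?P z)\<^sup>2 / ?c \<partial>\<mu>) = 1"
      proof -
        have "(\<integral>z. (?P z)\<^sup>2 \<partial>\<mu>) = ?c"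
          using norm_szego_prod[of n a] orth unfolding total_one verblunsky_prod_def by simp
        then show ?thesis using c by simp
      qed
      finally show ?thesis by simp
    qed
    have "(\<integral>\<^sup>+z. ennreal (- (circle_weight z * ln (bs_density a n z))) \<partial>circle_measure)
      \<le> (\<integral>\<^sup>+z. e2ennreal (- (ereal (circle_weight z) * ext_log (W z))) + 8 * (ennreal (W z) * ennreal ((?P z)\<^sup>2 / ?c)) \<partial>circle_measure)"
      using AE_circle_measure by (intro nn_integral_mono_AE) (auto elim!: eventually_mono intro: pt)
    also have "\<dots> = neg_entropy + 8 * (\<integral>\<^sup>+z. ennreal (W z) * ennreal ((?P z)\<^sup>2 / ?c) \<partial>circle_measure)"
      by (subst nn_integral_add) (auto simp: nn_integral_cmult)
    also have "\<dots> \<le> ennreal h + 8 * 1"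
      unfolding h using nn_integral_density_le[of "\<lambda>z. ennreal ((?P z)\<^sup>2 / ?c)"] norm
      by (intro add_left_mono mult_left_mono) auto
    also have "\<dots> = ennreal (h + 8)" using h by simp
    finally have "enn2real (\<integral>\<^sup>+z. ennreal (- (circle_weight z * ln (bs_density a n z))) \<partial>circle_measure) \<le> h + 8"
      using h by (intro enn2real_leI) auto
    moreover have "- bs_entropy a n \<le> enn2real (\<integral>\<^sup>+z. ennreal (- (circle_weight z * ln (bs_density a n z))) \<partial>circle_measure)"
      using real_lebesgue_integral_def[OF i] by (simp add: bs_entropy_def)
    ultimately show ?thesis by linarith
  qed
  then show thesis by (rule that)
qed

text \<open>The test functions \<open>F k\<close> approximate \<open>1 / W\<close> from bounded
  functions at least 1. They satisfy \<open>W * F k \<le> 1 + W\<close>, so the right side of the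
  variational inequality is bounded uniformly in \<open>k\<close>, and Fatou's lemma passes to the
  limit.\<close>

lemma neg_entropy_finite:
  assumes L: "\<And>n. L \<le> bs_entropy a n"
  shows "neg_entropy < \<top>"
proof -
  define F where "F k z = max (1 / (W z + 1 / real (Suc k))) 1" for k z
  have Fm [measurable]: "F k \<in> borel_measurable borel" for k unfolding F_def by measurable
  have F1: "1 \<le> F k z" for k z by (simp add: F_def)
  have FB: "F k z \<le> real (Suc k)" for k z
  proof -
    have "1 / (W z + 1 / real (Suc k)) \<le> 1 / (1 / real (Suc k))"
      using W0[of z] add_nonneg_pos[of "W z" "1 / real (Suc k)"] by (intro divide_left_mono mult_pos_pos) auto
    then show ?thesis by (simp add: F_def)
  qed
  have WF: "W z * F k z \<le> 1 + W z" for k z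
  proof (cases "1 \<le> 1 / (W z + 1 / real (Suc k))")
    case True
    have "W z \<le> W z + 1 / real (Suc k)" by simp
    moreover have "0 < W z + 1 / real (Suc k)" using W0[of z] by (intro add_nonneg_pos) auto
    ultimately have "W z / (W z + 1 / real (Suc k)) \<le> 1" by (subst divide_le_eq_1_pos)
    then show ?thesis using True W0[of z] by (simp add: F_def max_def)
  next
    case False
    then show ?thesis using W0[of z] by (simp add: F_def max_def)
  qed
  have tot: "(\<integral>\<^sup>+z. 1 \<partial>\<mu>) = 1" using prob_space.emeasure_space_1[OF prob] by simp
  have bound: "(\<integral>\<^sup>+z. ennreal (circle_weight z * ln (F k z)) \<partial>circle_measure) \<le> ennreal (24 - L)" for k
  proof -
    \<comment> \<open>On \<open>N\<close> the test function is reset to 1. This keeps the singular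
      part of \<mu> from being multiplied by values that grow with \<open>k\<close>, and does not
      affect the integral of \<open>ln f\<close> because \<open>N\<close> is null for arc
      length.\<close>
    define f where "f z = (if z \<in> N then 1 else F k z)" for z
    have fm [measurable]: "f \<in> borel_measurable borel" unfolding f_def by measurable
    have f1: "1 \<le> f z" and fB: "f z \<le> real (Suc k)" for z
      using F1[of k z] FB[of k z] by (auto simp: f_def)
    have ineq: "L + (\<integral>z. circle_weight z * ln (f z) \<partial>circle_measure) \<le> (\<integral>z. circle_weight z * f z \<partial>\<mu>)"
      by (rule entropy_inequality_bounded[OF a1 \<mu> total_one orth L fm f1 fB])
    have "(\<integral>\<^sup>+z. ennreal (circle_weight z * f z) \<partial>\<mu>) \<le> (\<integral>\<^sup>+z. 8 * (1 + ennreal (F k z) * indicator (- N) z) \<partial>\<mu>)"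
    proof (rule nn_integral_mono_AE)
      show "AE z in \<mu>. ennreal (circle_weight z * f z) \<le> 8 * (1 + ennreal (F k z) * indicator (- N) z)"
        using AE_circle_weight_bounds[OF \<mu>]
      proof eventually_elim
        case (elim z)
        have "circle_weight z * f z \<le> 8 * f z" using elim f1[of z] by (intro mult_right_mono) auto
        also have "\<dots> \<le> 8 * (1 + F k z * indicator (- N) z)"
          using F1[of k z] by (auto simp: f_def)
        finally have "ennreal (circle_weight z * f z) \<le> ennreal (8 * (1 + F k z * indicator (- N) z))" by (rule ennreal_leI)
        also have "\<dots> = 8 * (1 + ennreal (F k z) * indicator (- N) z)"
          using F1[of k z] by (auto simp: ennreal_mult indicator_def)
        finally show ?case .
      qed
    qed
    also have "\<dots> = 8 * (1 + (\<integral>\<^sup>+z. ennreal (F k z) * indicator (- N) z \<partial>\<mu>))"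
      using tot by (simp add: nn_integral_cmult nn_integral_add)
    \<comment> \<open>The 1 is the mass of \<mu>; the 2 bounds the integral of \<open>1 + W\<close>,
      whose two terms each contribute at most 1.\<close>
    also have "\<dots> \<le> 8 * (1 + 2)"
    proof (intro mult_left_mono add_left_mono)
      have "(\<integral>\<^sup>+z. ennreal (F k z) * indicator (- N) z \<partial>\<mu>) \<le> (\<integral>\<^sup>+z. ennreal (W z) * ennreal (F k z) \<partial>circle_measure)"
        by (rule nn_integral_off_null_set) measurable
      also have "\<dots> \<le> (\<integral>\<^sup>+z. 1 + ennreal (W z) * 1 \<partial>circle_measure)"
      proof (rule nn_integral_mono)
        fix z
        have "ennreal (W z) * ennreal (F k z) = ennreal (W z * F k z)"
          using W0[of z] F1[of k z] by (simp add: ennreal_mult)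
        also have "\<dots> \<le> ennreal (1 + W z)" by (intro ennreal_leI WF)
        finally show "ennreal (W z) * ennreal (F k z) \<le> 1 + ennreal (W z) * 1"
          using W0[of z] by simp
      qed
      also have "\<dots> = 1 + (\<integral>\<^sup>+z. ennreal (W z) * 1 \<partial>circle_measure)"
        using prob_space.emeasure_space_1[OF prob_space_circle_measure] by (subst nn_integral_add) auto
      also have "\<dots> \<le> 1 + 1"
        using nn_integral_density_le[of "\<lambda>_. 1"] tot by (intro add_left_mono) simp
      finally show "(\<integral>\<^sup>+z. ennreal (F k z) * indicator (- N) z \<partial>\<mu>) \<le> 2" by simp
    qed auto
    finally have "enn2real (\<integral>\<^sup>+z. ennreal (circle_weight z * f z) \<partial>\<mu>) \<le> 24"
      by (intro enn2real_leI) auto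
    moreover have "(\<integral>z. circle_weight z * f z \<partial>\<mu>) \<le> enn2real (\<integral>\<^sup>+z. ennreal (circle_weight z * f z) \<partial>\<mu>)"
    proof -
      have "AE z in \<mu>. 0 \<le> circle_weight z * f z"
        using AE_circle_weight_bounds[OF \<mu>] 
      proof eventually_elim
        case (elim z)
        then show ?case using f1[of z] by simp
      qed
      then show ?thesis by (subst integral_eq_nn_integral) auto
    qed
    ultimately have *: "(\<integral>z. circle_weight z * f z \<partial>\<mu>) \<le> 24" by linarith
    have ln0: "0 \<le> ln (f z)" for z using f1[of z] by simp
    have lnb: "ln (f z) \<le> real (Suc k)" for z
      using f1[of z] fB[of z] ln_bound[of "f z"] by simp
    have ae: "AE z in circle_measure. 0 \<le> circle_weight z * ln (f z)"
      using AE_circle_weight_bounds[OF circle.circle_finite_measure_axioms]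
      by eventually_elim (use ln0 in auto)
    have i: "integrable circle_measure (\<lambda>z. circle_weight z * ln (f z))"
    proof (rule circle.integrable_const_bound[of _ "8 * real (Suc k)"])
      show "AE z in circle_measure. norm (circle_weight z * ln (f z)) \<le> 8 * real (Suc k)"
        using AE_circle_weight_bounds[OF circle.circle_finite_measure_axioms]
      proof eventually_elim
        case (elim z)
        then have "circle_weight z * ln (f z) \<le> 8 * real (Suc k)"
          using ln0[of z] lnb[of z] by (intro mult_mono) auto
        then show ?case using elim ln0[of z] by (simp add: abs_mult)
      qed
    qed measurable
    have nN: "AE z in circle_measure. z \<notin> N"
      using N0 by (intro AE_not_in) (auto simp: null_sets_def)
    have "(\<integral>\<^sup>+z. ennreal (circle_weight z * ln (F k z)) \<partial>circle_measure) = (\<integral>\<^sup>+z. ennreal (circle_weight z * ln (f z)) \<partial>circle_measure)"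
      using nN by (intro nn_integral_cong_AE) (auto elim!: eventually_mono simp: f_def)
    also have "\<dots> = ennreal (\<integral>z. circle_weight z * ln (f z) \<partial>circle_measure)"
      by (rule nn_integral_eq_integral[OF i ae])
    also have "\<dots> \<le> ennreal (24 - L)"
      using ineq * by (intro ennreal_leI) simp
    finally show ?thesis .
  qed
  have "neg_entropy \<le> (\<integral>\<^sup>+z. liminf (\<lambda>k. ennreal (circle_weight z * ln (F k z))) \<partial>circle_measure)"
  proof (rule nn_integral_mono_AE)
    show "AE z in circle_measure. e2ennreal (- (ereal (circle_weight z) * ext_log (W z)))
        \<le> liminf (\<lambda>k. ennreal (circle_weight z * ln (F k z)))"
      using AE_circle_weight_bounds[OF circle.circle_finite_measure_axioms]
      by eventually_elim (unfold F_def, intro neg_log_le_liminf W0, simp)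
  qed
  also have "\<dots> \<le> liminf (\<lambda>k. \<integral>\<^sup>+z. ennreal (circle_weight z * ln (F k z)) \<partial>circle_measure)"
    by (rule nn_integral_liminf) measurable
  also have "\<dots> \<le> ennreal (24 - L)"
    by (intro Liminf_le) (use bound in auto)
  also have "\<dots> < \<top>" by simp
  finally show ?thesis .
qed

end

theorem theorem4p19:
  fixes \<mu> \<mu>\<^sub>s :: "complex measure" and w :: "real \<Rightarrow> real"
    and \<Phi> :: "nat \<Rightarrow> complex poly" and \<alpha> :: "nat \<Rightarrow> complex"
  assumes "nontrivial_circle_prob \<mu>"
    and "circle_lebesgue_decomposition \<mu> w \<mu>\<^sub>s"
    and "monic_orthogonal_polys \<mu> \<Phi>"
    and "\<alpha> = verblunsky \<Phi>"
    and "S2_minus_1 \<alpha> \<in> ell 3"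
    and "\<alpha> \<in> ell 6"
  shows "ext_integral normalized_angle
           (\<lambda>\<theta>. ereal ((1 - cos \<theta>)\<^sup>2 * (1 + cos \<theta>)) * ext_log (w \<theta>)) > -\<infinity>
     \<longleftrightarrow> S_minus_1 \<alpha> \<in> ell 4 \<and> S_minus_1 (S_minus_1 (S_plus_1 \<alpha>)) \<in> ell 2"
proof -
  note \<mu> = nontrivial_circle_probD[OF assms(1)]
  have a1: "cmod (\<alpha> j) < 1" for j
    unfolding assms(4) by (rule verblunsky_properties(2)[OF assms(1,3)])
  have orth: "circle_finite_measure.orthogonal_below \<mu> n (szego_poly \<alpha> n)" for n
    unfolding assms(4) by (rule verblunsky_properties(1)[OF assms(1,3)])
  obtain W N where Wm [measurable]: "W \<in> borel_measurable borel" and W0: "\<And>z. 0 \<le> W z"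
    and Ww: "\<And>\<theta>. \<theta> \<in> {0..<2 * pi} \<Longrightarrow> W (cis \<theta>) = w \<theta>"
    and N: "N \<in> sets borel" "emeasure circle_measure N = 0"
    and le: "\<And>A. A \<in> sets borel \<Longrightarrow> emeasure (density circle_measure (\<lambda>z. ennreal (W z))) A \<le> emeasure \<mu> A"
    and eq: "\<And>A. A \<in> sets borel \<Longrightarrow> A \<inter> N = {} \<Longrightarrow> emeasure \<mu> A = emeasure (density circle_measure (\<lambda>z. ennreal (W z))) A"
    by (rule circle_decomposition_density[OF assms(2)]) blast
  interpret \<mu>: circle_finite_measure \<mu> by (rule \<mu>(1))
  interpret D: szego_decomposition \<mu> \<alpha> W N
    by (intro szego_decomposition.intro szego_decomposition_axioms.intro \<mu> a1 orth Wm W0 N le eq)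
  have transfer: "(\<integral>\<^sup>+\<theta>. g ((1 - cos \<theta>)\<^sup>2 * (1 + cos \<theta>)) (w \<theta>) \<partial>normalized_angle)
      = (\<integral>\<^sup>+z. g (circle_weight z) (W z) \<partial>circle_measure)"
    if [measurable]: "(\<lambda>z. g (circle_weight z) (W z)) \<in> borel_measurable borel" for g :: "real \<Rightarrow> real \<Rightarrow> ennreal"
  proof -
    have "(\<integral>\<^sup>+z. g (circle_weight z) (W z) \<partial>circle_measure) = (\<integral>\<^sup>+\<theta>. g (circle_weight (cis \<theta>)) (W (cis \<theta>)) \<partial>normalized_angle)"
      unfolding circle_measure_def by (subst nn_integral_distr) auto
    also have "\<dots> = (\<integral>\<^sup>+\<theta>. g ((1 - cos \<theta>)\<^sup>2 * (1 + cos \<theta>)) (w \<theta>) \<partial>normalized_angle)"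
    proof (rule nn_integral_cong_AE)
      show "AE \<theta> in normalized_angle. g (circle_weight (cis \<theta>)) (W (cis \<theta>)) = g ((1 - cos \<theta>)\<^sup>2 * (1 + cos \<theta>)) (w \<theta>)"
        using AE_normalized_angle by eventually_elim (simp add: circle_weight_def Ww)
    qed
    finally show ?thesis ..
  qed
  let ?neg = "\<integral>\<^sup>+z. e2ennreal (- (ereal (circle_weight z) * ext_log (W z))) \<partial>circle_measure"
  let ?pos = "\<integral>\<^sup>+z. e2ennreal (ereal (circle_weight z) * ext_log (W z)) \<partial>circle_measure"
  \<comment> \<open>The positive part is always finite, by \<open>ln t \<le> t\<close> and the total
    mass of \<mu>. Hence the extended integral exceeds \<open>-\<infinity>\<close> exactly when the
    negative part is finite.\<close>
  have "?pos \<le> (\<integral>\<^sup>+z. 8 * (ennreal (W z) * 1) \<partial>circle_measure)"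
  proof (rule nn_integral_mono_AE)
    show "AE z in circle_measure. e2ennreal (ereal (circle_weight z) * ext_log (W z)) \<le> 8 * (ennreal (W z) * 1)"
      using AE_circle_weight_bounds[OF circle.circle_finite_measure_axioms]
    proof eventually_elim
      case (elim z)
      show ?case
      proof (cases "W z = 0")
        case True
        then show ?thesis using elim by (cases "circle_weight z = 0") (auto simp: ext_log_def e2ennreal_neg)
      next
        case False
        then have p: "0 < W z" using W0[of z] by simp
        have "circle_weight z * ln (W z) \<le> circle_weight z * W z"
          using elim ln_bound[OF p] by (intro mult_left_mono) auto
        also have "\<dots> \<le> 8 * W z" using elim p by (intro mult_right_mono) auto
        finally have "ennreal (circle_weight z * ln (W z)) \<le> ennreal (8 * W z)" by (rule ennreal_leI)
        then show ?thesis using False p by (simp add: ext_log_def ennreal_mult)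
      qed
    qed
  qed
  also have "\<dots> = 8 * (\<integral>\<^sup>+z. ennreal (W z) * 1 \<partial>circle_measure)"
    by (rule nn_integral_cmult) measurable
  also have "\<dots> \<le> 8 * (\<integral>\<^sup>+z. 1 \<partial>\<mu>)"
    by (intro mult_left_mono D.nn_integral_density_le) auto
  also have "\<dots> < \<top>"
    using prob_space.emeasure_space_1[OF \<mu>(2)] by (simp add: less_top[symmetric])
  finally have pos: "?pos < \<top>" .
  have "ext_integral normalized_angle (\<lambda>\<theta>. ereal ((1 - cos \<theta>)\<^sup>2 * (1 + cos \<theta>)) * ext_log (w \<theta>))
      = enn2ereal ?pos - enn2ereal ?neg"
    unfolding ext_integral_def
    using transfer[of "\<lambda>q x. e2ennreal (ereal q * ext_log x)"] transfer[of "\<lambda>q x. e2ennreal (- (ereal q * ext_log x))"]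
    by simp
  also have "\<dots> > - \<infinity> \<longleftrightarrow> ?neg < \<top>"
    using pos by (cases ?pos; cases ?neg) (auto simp: top_ennreal.rep_eq)
  also have "\<dots> \<longleftrightarrow> (\<exists>L. \<forall>n. L \<le> bs_entropy \<alpha> n)"
  proof
    assume "?neg < \<top>"
    from D.bs_entropy_bounded_below[OF this]
    show "\<exists>L. \<forall>n. L \<le> bs_entropy \<alpha> n" by blast
  next
    assume "\<exists>L. \<forall>n. L \<le> bs_entropy \<alpha> n"
    then obtain L where "\<And>n. L \<le> bs_entropy \<alpha> n" by blast
    from D.neg_entropy_finite[OF this]
    show "?neg < \<top>" by blast
  qed
  also have "\<dots> \<longleftrightarrow> (\<exists>L. \<forall>n. L \<le> (\<Sum>j<n. szego_term \<alpha> j))"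
  proof
    assume "\<exists>L. \<forall>n. L \<le> bs_entropy \<alpha> n"
    then obtain L where L: "\<And>n. L \<le> bs_entropy \<alpha> n" by blast
    have "L \<le> bs_entropy \<alpha> 3 + (\<Sum>j<n. szego_term \<alpha> j)" for n
      using L[of "n + 3"] bs_entropy_sum[of \<alpha> n, OF a1] by simp
    then have "L - bs_entropy \<alpha> 3 \<le> (\<Sum>j<n. szego_term \<alpha> j)" for n
      by (simp add: algebra_simps)
    then show "\<exists>L. \<forall>n. L \<le> (\<Sum>j<n. szego_term \<alpha> j)" by blast
  next
    assume "\<exists>L. \<forall>n. L \<le> (\<Sum>j<n. szego_term \<alpha> j)"
    then obtain L where L: "\<And>n. L \<le> (\<Sum>j<n. szego_term \<alpha> j)" by blast
    \<comment> \<open>The summation formula starts at index 3, so the entropies with indices 0, 1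
      and 2 enter the lower bound separately.\<close>
    define M where "M = Min (insert (bs_entropy \<alpha> 3 + L) (bs_entropy \<alpha> ` {..<3}))"
    have "M \<le> bs_entropy \<alpha> n" for n
    proof (cases "n < 3")
      case True
      then show ?thesis unfolding M_def by (intro Min_le) auto
    next
      case False
      then obtain k where n: "n = k + 3" by (metis add.commute le_Suc_ex not_less)
      have "M \<le> bs_entropy \<alpha> 3 + L" unfolding M_def by (intro Min_le) auto
      also have "\<dots> \<le> bs_entropy \<alpha> n" unfolding n bs_entropy_sum[of \<alpha> k, OF a1] using L by simp
      finally show ?thesis .
    qed
    then show "\<exists>L. \<forall>n. L \<le> bs_entropy \<alpha> n" by blast
  qed
  also have "\<dots> \<longleftrightarrow> S_minus_1 \<alpha> \<in> ell 4 \<and> S_minus_1 (S_minus_1 (S_plus_1 \<alpha>)) \<in> ell 2"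
    by (rule szego_term_sums_bounded_below_iff[OF a1 assms(5,6)])
  finally show ?thesis .
qed

end
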